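(* Let $X$ be a Banach space, let $A$ be the infinitesimal generator of an analytic semigroup $(\mathrm{e}^{tA})_{t\ge 0}$ on $X$, and let $g\colon X\to X$. Suppose that the initial value problem $u'(t)=Au(t)+g(u(t))=:F(u(t))$, $u(t_0)=u_0$, has a solution $u\colon[t_0,t_{\mathrm{end}}]\to X$ that is sufficiently smooth with derivatives in $X$, that $g$ is sufficiently often Fr\'echet differentiable in a strip along this exact solution, and that all occurring derivatives are uniformly bounded. Consider an explicit exponential Runge--Kutta method (as defined in the context) that satisfies either (i) all the 36 stiff order conditions (listed in the context) in the strong sense, or (ii) all of these 36 conditions in the strong sense with the only exception of condition No. 17, which is satisfied in the weakened form $\sum_{i=2}^{s} b_i(0)\frac{c_i^5}{5!}=\varphi_6(0)=\frac{1}{6!}$. Then the method converges with order 6. In particular, the numerical solution $u_n$ produced with constant step size $h>0$ from the initial value $u_0$ satisfies $$\|u_n-u(t_n)\|\le C h^6$$ uniformly on $t_0\le t_n=t_0+nh\le t_{\mathrm{end}}$, with a constant $C$ that depends on $t_{\mathrm{end}}-t_0$, but is independent of $n$ and $h$.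
   Context: **Functions.** $\varphi_k(z)=\int_0^1 \mathrm{e}^{(1-\theta)z}\frac{\theta^{k-1}}{(k-1)!}\,d\theta$ for $k\ge1$; for an operator $\varphi_k(chA)$ ($c\ge 0$, $h>0$) is defined by the same integral using the semigroup. In particular $\varphi_k(0)=1/k!$. **Method.** An explicit $s$-stage exponential Runge--Kutta (ExpRK) method with nodes $c_i\ge0$ and coefficient functions $a_{ij}(z)$, $b_i(z)$ (linear combinations of the functions $\varphi_k(z)$ and their scaled versions $\varphi_k(c_\ell z)$, so that $a_{ij}(hA),b_i(hA)$ are bounded operators on $X$) computes $u_{n+1}\approx u(t_{n+1})$, $t_{n+1}=t_n+h$, from $u_n$ by $$U_{ni}=u_n+c_ih\,\varphi_1(c_ihA)F(u_n)+h\sum_{j=2}^{i-1}a_{ij}(hA)D_{nj},\quad 2\le i\le s,$$ $$u_{n+1}=u_n+h\,\varphi_1(hA)F(u_n)+h\sum_{i=2}^{s}b_i(hA)D_{ni},\qquad D_{ni}=g(U_{ni})-g(u_n).$$ **The functions $\psi_{q,i}$.** $\psi_{q,i}(Z)=\sum_{k=2}^{i-1}a_{ik}(Z)\frac{c_k^{q-1}}{(q-1)!}-c_i^q\varphi_q(c_iZ)$. **The 36 stiff order conditions.** Below, $a_{ij}=a_{ij}(Z)$, $b_i=b_i(Z)$, $\varphi_q=\varphi_q(Z)$, $\psi_{q,i}=\psi_{q,i}(Z)$; $\sum_i$ runs over $2\le i\le s$, $\sum_j$ over $2\le j\le i-1$, $\sum_k$ over $2\le k\le j-1$, $\sum_l$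 over $2\le l\le k-1$. Each condition is required to hold (strong sense) with $Z=hA$ for all $h>0$, and for arbitrary bounded linear operators $J,K,L$ on $X$ and arbitrary bounded bilinear maps $B\colon X\times X\to X$ (arbitrary square matrices $Z,J,K,L$ and bilinear maps in the finite-dimensional case); an expression $B(P,Q)$ with operators $P,Q$ stands for $(v,w)\mapsto B(Pv,Qw)$. Order 2: $\sum_i b_ic_i=\varphi_2$. Order 3: $\sum_i b_i\frac{c_i^2}{2!}=\varphi_3$; $\sum_i b_iJ\psi_{2,i}=0$. Order 4: $\sum_i b_i\frac{c_i^3}{3!}=\varphi_4$; $\sum_i b_iJ\psi_{3,i}=0$; $\sum_i b_iJ\sum_j a_{ij}J\psi_{2,j}=0$; $\sum_i b_ic_iK\psi_{2,i}=0$. Order 5: $\sum_i b_i\frac{c_i^4}{4!}=\varphi_5$; $\sum_i b_iJ\psi_{4,i}=0$; $\sum_i b_iJ\sum_j a_{ij}J\psi_{3,j}=0$; $\sum_i b_iJ\sum_j a_{ij}J\sum_k a_{jk}J\psi_{2,k}=0$; $\sum_i b_iJ\sum_j a_{ij}c_jK\psi_{2,j}=0$; $\sum_i b_ic_iK\psi_{3,i}=0$; $\sum_i b_ic_iK\sum_j a_{ij}J\psi_{2,j}=0$; $\sum_i b_iB(\psi_{2,i},\psi_{2,i})=0$; $\sum_i b_ic_i^2L\psi_{2,i}=0$. Order 6: condition No. 17: $\sum_i b_i\frac{c_i^5}{5!}=\varphi_6$; and conditions No. 18--36: $\sum_i b_iJ\psi_{5,i}=0$; $\sum_i b_iJ\sum_j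 a_{ij}J\psi_{4,j}=0$; $\sum_i b_iJ\sum_j a_{ij}J\sum_k a_{jk}J\psi_{3,k}=0$; $\sum_i b_iJ\sum_j a_{ij}J\sum_k a_{jk}J\sum_l a_{kl}J\psi_{2,l}=0$; $\sum_i b_iJ\sum_j a_{ij}J\sum_k a_{jk}c_kK\psi_{2,k}=0$; $\sum_i b_iJ\sum_j a_{ij}c_jK\psi_{3,j}=0$; $\sum_i b_iJ\sum_j a_{ij}c_jK\sum_k a_{jk}J\psi_{2,k}=0$; $\sum_i b_iJ\sum_j a_{ij}B(\psi_{2,j},\psi_{2,j})=0$; $\sum_i b_iJ\sum_j a_{ij}c_j^2L\psi_{2,j}=0$; $\sum_i b_ic_iK\psi_{4,i}=0$; $\sum_i b_ic_iK\sum_j a_{ij}J\psi_{3,j}=0$; $\sum_i b_ic_iK\sum_j a_{ij}J\sum_k a_{jk}J\psi_{2,k}=0$; $\sum_i b_ic_iK\sum_j a_{ij}c_jK\psi_{2,j}=0$; $\sum_i b_iB(\psi_{2,i},\psi_{3,i})=0$; $\sum_i b_iB\big(\psi_{2,i},\sum_j a_{ij}J\psi_{2,j}\big)=0$; $\sum_i b_ic_i^2L\psi_{3,i}=0$; $\sum_i b_ic_i^2L\sum_j a_{ij}J\psi_{2,j}=0$; $\sum_i b_ic_iB(\psi_{2,i},\psi_{2,i})=0$; $\sum_i b_ic_i^3L\psi_{2,i}=0$.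
   Formalization: The error bound is proved for all sufficiently small step sizes 0 < h ≤ h0, with C and h0 independent of n and h; for large h the literal claim fails, since stages may leave the strip around the exact solution, where nothing is assumed on g. *)

theory Defs
  imports "HOL-Analysis.Analysis"
begin

section \<open>The scalar field\<close>

text \<open>
  A Banach space over \<open>\<real>\<close> is a type of class \<open>banach\<close>. A Banach space over \<open>\<complex>\<close> is a type of class
  \<open>banach\<close> together with the operator \<open>\<iota>\<close> "multiplication by \<open>\<i>\<close>", which has to be compatible with
  the norm. The datatype below selects one of the two cases, so that "linear operator" and
  "bilinear map" can be read over the actual scalar field of the space.
\<close>

datatype 'a scalars = Real_Scalars | Complex_Scalars "'a \<Rightarrow> 'a"

definition complex_structure :: "('a::banach \<Rightarrow> 'a) \<Rightarrow> bool" where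
  "complex_structure \<iota> \<longleftrightarrow> bounded_linear \<iota> \<and> (\<forall>x. \<iota> (\<iota> x) = - x) \<and>
     (\<forall>a b x. norm (a *\<^sub>R x + b *\<^sub>R \<iota> x) = cmod (Complex a b) * norm x)"

fun banach_over :: "('a::banach) scalars \<Rightarrow> bool" where
  "banach_over Real_Scalars \<longleftrightarrow> True"
| "banach_over (Complex_Scalars \<iota>) \<longleftrightarrow> complex_structure \<iota>"

fun bounded_linear_over :: "('a::banach) scalars \<Rightarrow> ('a \<Rightarrow> 'a) \<Rightarrow> bool" where
  "bounded_linear_over Real_Scalars f \<longleftrightarrow> bounded_linear f"
| "bounded_linear_over (Complex_Scalars \<iota>) f \<longleftrightarrow> bounded_linear f \<and> (\<forall>x. f (\<iota> x) = \<iota> (f x))"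

definition bounded_bilinear_over :: "('a::banach) scalars \<Rightarrow> ('a \<Rightarrow> 'a \<Rightarrow> 'a) \<Rightarrow> bool" where
  "bounded_bilinear_over \<K> B \<longleftrightarrow> bounded_bilinear B \<and>
     (\<forall>x. bounded_linear_over \<K> (B x)) \<and> (\<forall>y. bounded_linear_over \<K> (\<lambda>x. B x y))"


section \<open>Analytic semigroups and their generators\<close>

definition strongly_continuous_semigroup ::
    "('a::banach) scalars \<Rightarrow> (real \<Rightarrow> 'a \<Rightarrow>\<^sub>L 'a) \<Rightarrow> bool" where
  "strongly_continuous_semigroup \<K> T \<longleftrightarrow>
     (\<forall>t\<ge>0. bounded_linear_over \<K> (T t)) \<and> T 0 = id_blinfun \<and>
     (\<forall>s\<ge>0. \<forall>t\<ge>0. T (s + t) = T s o\<^sub>L T t) \<and>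
     (\<forall>x. ((\<lambda>t. T t x) \<longlongrightarrow> x) (at_right 0))"

definition open_sector :: "real \<Rightarrow> complex set" where
  "open_sector \<alpha> = {z. z \<noteq> 0 \<and> \<bar>Arg z\<bar> < \<alpha>}"

text \<open>
  \<open>E\<close> (defined for nonnegative times) extends to an analytic operator family on a sector around the
  positive real axis; \<open>\<iota>\<close> is the multiplication by \<open>\<i>\<close> on the underlying complex space. Analyticity
  is complex differentiability with respect to the operator norm: the real Frechet derivative \<open>S'\<close>
  of \<open>S\<close> at \<open>z\<close> is complex linear.
\<close>

definition extends_to_sector :: "('b::banach \<Rightarrow> 'b) \<Rightarrow> (real \<Rightarrow> 'b \<Rightarrow> 'b) \<Rightarrow> bool" where
  "extends_to_sector \<iota> E \<longleftrightarrow>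
     (\<exists>\<alpha> (S :: complex \<Rightarrow> 'b \<Rightarrow>\<^sub>L 'b). 0 < \<alpha> \<and> \<alpha> \<le> pi / 2 \<and>
        (\<forall>t\<ge>0. \<forall>x. blinfun_apply (S (of_real t)) x = E t x) \<and>
        (\<forall>z\<in>open_sector \<alpha>. \<forall>x. blinfun_apply (S z) (\<iota> x) = \<iota> (blinfun_apply (S z) x)) \<and>
        (\<forall>z\<in>open_sector \<alpha>. \<forall>w\<in>open_sector \<alpha>. S (z + w) = S z o\<^sub>L S w) \<and>
        (\<forall>z\<in>open_sector \<alpha>. \<exists>S' :: complex \<Rightarrow> 'b \<Rightarrow>\<^sub>L 'b. (S has_derivative S') (at z) \<and>
            (\<forall>w x. blinfun_apply (S' (\<i> * w)) x = \<iota> (blinfun_apply (S' w) x))) \<and>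
        (\<forall>x. ((\<lambda>z. blinfun_apply (S z) x) \<longlongrightarrow> x) (at 0 within open_sector \<alpha>)))"

text \<open>
  On a real Banach space a semigroup is analytic if its complexification is. The complexification
  of \<open>'a\<close> is \<open>'a \<times> 'a\<close>, with \<open>(x, y)\<close> for \<open>x + \<i> y\<close>. The product norm is only equivalent to a norm
  that is homogeneous over \<open>\<complex>\<close>, which is irrelevant for convergence and differentiability.
\<close>

fun extends_analytically :: "('a::banach) scalars \<Rightarrow> (real \<Rightarrow> 'a \<Rightarrow>\<^sub>L 'a) \<Rightarrow> bool" where
  "extends_analytically Real_Scalars T \<longleftrightarrow>
     extends_to_sector (\<lambda>(x, y). (- y, x)) (\<lambda>t (x, y). (T t x, T t y))"
| "extends_analytically (Complex_Scalars \<iota>) T \<longleftrightarrow> extends_to_sector \<iota> (\<lambda>t x. T t x)"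

definition analytic_semigroup :: "('a::banach) scalars \<Rightarrow> (real \<Rightarrow> 'a \<Rightarrow>\<^sub>L 'a) \<Rightarrow> bool" where
  "analytic_semigroup \<K> T \<longleftrightarrow> strongly_continuous_semigroup \<K> T \<and> extends_analytically \<K> T"

text \<open>The unbounded operator \<open>A\<close> has domain \<open>D\<close>; the values of \<open>A\<close> outside \<open>D\<close> are irrelevant.\<close>

definition infinitesimal_generator ::
    "(real \<Rightarrow> 'a::banach \<Rightarrow>\<^sub>L 'a) \<Rightarrow> 'a set \<Rightarrow> ('a \<Rightarrow> 'a) \<Rightarrow> bool" where
  "infinitesimal_generator T D A \<longleftrightarrow>
     D = {x. \<exists>y. ((\<lambda>t. (T t x - x) /\<^sub>R t) \<longlongrightarrow> y) (at_right 0)} \<and>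
     (\<forall>x\<in>D. ((\<lambda>t. (T t x - x) /\<^sub>R t) \<longlongrightarrow> A x) (at_right 0))"


section \<open>Regularity of the solution and of the nonlinearity\<close>

definition smooth_solution ::
    "'a::banach set \<Rightarrow> ('a \<Rightarrow> 'a) \<Rightarrow> ('a \<Rightarrow> 'a) \<Rightarrow> real \<Rightarrow> real \<Rightarrow> 'a \<Rightarrow> (real \<Rightarrow> 'a) \<Rightarrow> bool" where
  "smooth_solution D A g t0 tend u0 u \<longleftrightarrow>
     u t0 = u0 \<and>
     (\<forall>t\<in>{t0..tend}. u t \<in> D \<and>
        (u has_vector_derivative (A (u t) + g (u t))) (at t within {t0..tend})) \<and>
     (\<exists>w :: nat \<Rightarrow> real \<Rightarrow> 'a. \<exists>M. w 0 = u \<and>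
        (\<forall>k<6. \<forall>t\<in>{t0..tend}. (w k has_vector_derivative w (Suc k) t) (at t within {t0..tend})) \<and>
        (\<forall>k\<le>6. \<forall>t\<in>{t0..tend}. norm (w k t) \<le> M))"

definition strip_along :: "(real \<Rightarrow> 'a::metric_space) \<Rightarrow> real \<Rightarrow> real \<Rightarrow> real \<Rightarrow> 'a set" where
  "strip_along u t0 tend r = (\<Union>t\<in>{t0..tend}. ball (u t) r)"

text \<open>
  Six times Frechet differentiable on the open set \<open>S\<close>, with bounded derivatives. Over \<open>\<complex>\<close> it suffices
  to require complex linearity of the first derivative \<open>g1 x\<close>, as the higher ones inherit it.
\<close>

definition frechet_differentiable6 :: "('a::banach) scalars \<Rightarrow> ('a \<Rightarrow> 'a) \<Rightarrow> 'a set \<Rightarrow> bool" where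
  "frechet_differentiable6 \<K> g S \<longleftrightarrow>
     (\<exists>(g1 :: 'a \<Rightarrow> 'a \<Rightarrow>\<^sub>L 'a)
       (g2 :: 'a \<Rightarrow> 'a \<Rightarrow>\<^sub>L 'a \<Rightarrow>\<^sub>L 'a)
       (g3 :: 'a \<Rightarrow> 'a \<Rightarrow>\<^sub>L 'a \<Rightarrow>\<^sub>L 'a \<Rightarrow>\<^sub>L 'a)
       (g4 :: 'a \<Rightarrow> 'a \<Rightarrow>\<^sub>L 'a \<Rightarrow>\<^sub>L 'a \<Rightarrow>\<^sub>L 'a \<Rightarrow>\<^sub>L 'a)
       (g5 :: 'a \<Rightarrow> 'a \<Rightarrow>\<^sub>L 'a \<Rightarrow>\<^sub>L 'a \<Rightarrow>\<^sub>L 'a \<Rightarrow>\<^sub>L 'a \<Rightarrow>\<^sub>L 'a)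
       (g6 :: 'a \<Rightarrow> 'a \<Rightarrow>\<^sub>L 'a \<Rightarrow>\<^sub>L 'a \<Rightarrow>\<^sub>L 'a \<Rightarrow>\<^sub>L 'a \<Rightarrow>\<^sub>L 'a \<Rightarrow>\<^sub>L 'a) M.
      \<forall>x\<in>S.
        bounded_linear_over \<K> (blinfun_apply (g1 x)) \<and>
        (g has_derivative blinfun_apply (g1 x)) (at x) \<and>
        (g1 has_derivative blinfun_apply (g2 x)) (at x) \<and>
        (g2 has_derivative blinfun_apply (g3 x)) (at x) \<and>
        (g3 has_derivative blinfun_apply (g4 x)) (at x) \<and>
        (g4 has_derivative blinfun_apply (g5 x)) (at x) \<and>
        (g5 has_derivative blinfun_apply (g6 x)) (at x) \<and>
        norm (g1 x) \<le> M \<and> norm (g2 x) \<le> M \<and> norm (g3 x) \<le> M \<and>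
        norm (g4 x) \<le> M \<and> norm (g5 x) \<le> M \<and> norm (g6 x) \<le> M)"


section \<open>The functions \<open>\<phi>\<^sub>k\<close> and their linear combinations\<close>

definition phi :: "nat \<Rightarrow> real \<Rightarrow> real" where
  "phi k z = integral {0..1} (\<lambda>\<theta>. exp ((1 - \<theta>) * z) * (\<theta> ^ (k - 1) / fact (k - 1)))"

text \<open>\<open>phi_op T k \<tau>\<close> is \<open>\<phi>\<^sub>k(\<tau>A)\<close>, where \<open>A\<close> generates \<open>T\<close>.\<close>

definition phi_op :: "(real \<Rightarrow> 'a::banach \<Rightarrow>\<^sub>L 'a) \<Rightarrow> nat \<Rightarrow> real \<Rightarrow> 'a \<Rightarrow> 'a" where
  "phi_op T k \<tau> x = integral {0..1} (\<lambda>\<theta>. (\<theta> ^ (k - 1) / fact (k - 1)) *\<^sub>R T ((1 - \<theta>) * \<tau>) x)"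

text \<open>A list of triples \<open>(w, k, r)\<close> stands for the function \<open>z \<mapsto> \<Sum> w \<phi>\<^sub>k(r z)\<close>.\<close>

type_synonym phi_comb = "(real \<times> nat \<times> real) list"

definition comb_val :: "phi_comb \<Rightarrow> real \<Rightarrow> real" where
  "comb_val p z = (\<Sum>(w, k, r)\<leftarrow>p. w * phi k (r * z))"

text \<open>\<open>comb_op T h p\<close> is the value of \<open>p\<close> at \<open>hA\<close>, where \<open>A\<close> generates \<open>T\<close>.\<close>

definition comb_op :: "(real \<Rightarrow> 'a::banach \<Rightarrow>\<^sub>L 'a) \<Rightarrow> real \<Rightarrow> phi_comb \<Rightarrow> 'a \<Rightarrow> 'a" where
  "comb_op T h p x = (\<Sum>(w, k, r)\<leftarrow>p. w *\<^sub>R phi_op T k (r * h) x)"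


section \<open>Explicit exponential Runge--Kutta methods\<close>

record exprk =
  stages :: nat
  node :: "nat \<Rightarrow> real"
  acoef :: "nat \<Rightarrow> nat \<Rightarrow> phi_comb"
  bcoef :: "nat \<Rightarrow> phi_comb"

definition admissible_coef :: "exprk \<Rightarrow> phi_comb \<Rightarrow> bool" where
  "admissible_coef M p \<longleftrightarrow> (\<forall>(w, k, r)\<in>set p. 1 \<le> k \<and> r \<in> insert 1 (node M ` {1..stages M}))"

definition exprk_method :: "exprk \<Rightarrow> bool" where
  "exprk_method M \<longleftrightarrow>
     (\<forall>i\<in>{1..stages M}. 0 \<le> node M i) \<and>
     (\<forall>i\<in>{2..stages M}. \<forall>j\<in>{2..<i}. admissible_coef M (acoef M i j)) \<and>
     (\<forall>i\<in>{2..stages M}. admissible_coef M (bcoef M i))"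

text \<open>
  \<open>exp_euler T D A g \<tau> x\<close> is \<open>x + \<tau> \<phi>\<^sub>1(\<tau>A) F(x)\<close> with \<open>F(x) = A x + g(x)\<close>. If a coefficient function
  involves a scaling by \<open>0\<close>, it has a constant part, and the numerical solution may leave the domain
  \<open>D\<close> of \<open>A\<close>. On \<open>X\<close> the formula is understood by means of \<open>z \<phi>\<^sub>1(z) = e\<^sup>z - 1\<close>, i.e., through its
  continuous extension in the argument of \<open>A\<close>.
\<close>

definition exp_euler ::
    "(real \<Rightarrow> 'a::banach \<Rightarrow>\<^sub>L 'a) \<Rightarrow> 'a set \<Rightarrow> ('a \<Rightarrow> 'a) \<Rightarrow> ('a \<Rightarrow> 'a) \<Rightarrow> real \<Rightarrow> 'a \<Rightarrow> 'a" where
  "exp_euler T D A g \<tau> x =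
     (if x \<in> D then x + \<tau> *\<^sub>R phi_op T 1 \<tau> (A x + g x)
      else T \<tau> x + \<tau> *\<^sub>R phi_op T 1 \<tau> (g x))"

fun exprk_stage ::
    "exprk \<Rightarrow> (real \<Rightarrow> 'a::banach \<Rightarrow>\<^sub>L 'a) \<Rightarrow> 'a set \<Rightarrow> ('a \<Rightarrow> 'a) \<Rightarrow> ('a \<Rightarrow> 'a) \<Rightarrow> real \<Rightarrow> 'a \<Rightarrow> nat \<Rightarrow> 'a"
  where
  "exprk_stage M T D A g h x i =
     exp_euler T D A g (node M i * h) x +
     h *\<^sub>R (\<Sum>j=2..<i. comb_op T h (acoef M i j) (g (exprk_stage M T D A g h x j) - g x))"

declare exprk_stage.simps [simp del]

definition exprk_step ::
    "exprk \<Rightarrow> (real \<Rightarrow> 'a::banach \<Rightarrow>\<^sub>L 'a) \<Rightarrow> 'a set \<Rightarrow> ('a \<Rightarrow> 'a) \<Rightarrow> ('a \<Rightarrow> 'a) \<Rightarrow> real \<Rightarrow> 'a \<Rightarrow> 'a" where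
  "exprk_step M T D A g h x =
     exp_euler T D A g h x +
     h *\<^sub>R (\<Sum>i=2..stages M. comb_op T h (bcoef M i) (g (exprk_stage M T D A g h x i) - g x))"

definition exprk_solution ::
    "exprk \<Rightarrow> (real \<Rightarrow> 'a::banach \<Rightarrow>\<^sub>L 'a) \<Rightarrow> 'a set \<Rightarrow> ('a \<Rightarrow> 'a) \<Rightarrow> ('a \<Rightarrow> 'a) \<Rightarrow> 'a \<Rightarrow> real \<Rightarrow> nat \<Rightarrow> 'a"
  where
  "exprk_solution M T D A g u0 h n = (exprk_step M T D A g h ^^ n) u0"


section \<open>The stiff order conditions\<close>

text \<open>\<open>psi_op T M h q i\<close> is \<open>\<psi>\<^sub>q\<^sub>,\<^sub>i(hA)\<close>.\<close>

definition psi_op ::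
    "(real \<Rightarrow> 'a::banach \<Rightarrow>\<^sub>L 'a) \<Rightarrow> exprk \<Rightarrow> real \<Rightarrow> nat \<Rightarrow> nat \<Rightarrow> 'a \<Rightarrow> 'a" where
  "psi_op T M h q i x =
     (\<Sum>k=2..<i. (node M k ^ (q - 1) / fact (q - 1)) *\<^sub>R comb_op T h (acoef M i k) x)
     - node M i ^ q *\<^sub>R phi_op T q (node M i * h) x"

text \<open>
  The quadrature condition \<open>\<Sum>\<^sub>i b\<^sub>i(Z) c\<^sub>i\<^sup>q\<^sup>-\<^sup>1/(q-1)! = \<phi>\<^sub>q(Z)\<close>, in strong form at \<open>Z = hA\<close>, and in weak
  form, i.e., at \<open>Z = 0\<close>.
\<close>

definition quadrature_condition ::
    "(real \<Rightarrow> 'a::banach \<Rightarrow>\<^sub>L 'a) \<Rightarrow> exprk \<Rightarrow> real \<Rightarrow> nat \<Rightarrow> bool" where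
  "quadrature_condition T M h q \<longleftrightarrow>
     (\<forall>v. (\<Sum>i=2..stages M. (node M i ^ (q - 1) / fact (q - 1)) *\<^sub>R comb_op T h (bcoef M i) v)
          = phi_op T q h v)"

definition weak_quadrature_condition :: "exprk \<Rightarrow> nat \<Rightarrow> bool" where
  "weak_quadrature_condition M q \<longleftrightarrow>
     (\<Sum>i=2..stages M. comb_val (bcoef M i) 0 * (node M i ^ (q - 1) / fact (q - 1))) = phi q 0"

text \<open>All conditions up to order 6 except for the quadrature condition with \<open>q = 6\<close>, at \<open>Z = hA\<close>.\<close>

definition stiff_conditions_except_quadrature6 ::
    "('a::banach) scalars \<Rightarrow> (real \<Rightarrow> 'a \<Rightarrow>\<^sub>L 'a) \<Rightarrow> exprk \<Rightarrow> real \<Rightarrow> bool" where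
  "stiff_conditions_except_quadrature6 \<K> T M h \<longleftrightarrow>
    (let s = stages M; c = node M;
         a = (\<lambda>i j. comb_op T h (acoef M i j));
         b = (\<lambda>i. comb_op T h (bcoef M i));
         \<psi> = psi_op T M h
     in
       quadrature_condition T M h 2 \<and> quadrature_condition T M h 3 \<and>
       quadrature_condition T M h 4 \<and> quadrature_condition T M h 5 \<and>
       (\<forall>J K L B.
          bounded_linear_over \<K> J \<and> bounded_linear_over \<K> K \<and> bounded_linear_over \<K> L \<and>
          bounded_bilinear_over \<K> B \<longrightarrow>
          (\<forall>v w.
            \<comment> \<open>order 3\<close>
            (\<Sum>i=2..s. b i (J (\<psi> 2 i v))) = 0 \<and>
            \<comment> \<open>order 4\<close>
            (\<Sum>i=2..s. b i (J (\<psi> 3 i v))) = 0 \<and>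
            (\<Sum>i=2..s. b i (J (\<Sum>j=2..<i. a i j (J (\<psi> 2 j v))))) = 0 \<and>
            (\<Sum>i=2..s. c i *\<^sub>R b i (K (\<psi> 2 i v))) = 0 \<and>
            \<comment> \<open>order 5\<close>
            (\<Sum>i=2..s. b i (J (\<psi> 4 i v))) = 0 \<and>
            (\<Sum>i=2..s. b i (J (\<Sum>j=2..<i. a i j (J (\<psi> 3 j v))))) = 0 \<and>
            (\<Sum>i=2..s. b i (J (\<Sum>j=2..<i. a i j (J (\<Sum>k=2..<j. a j k (J (\<psi> 2 k v))))))) = 0 \<and>
            (\<Sum>i=2..s. b i (J (\<Sum>j=2..<i. c j *\<^sub>R a i j (K (\<psi> 2 j v))))) = 0 \<and>
            (\<Sum>i=2..s. c i *\<^sub>R b i (K (\<psi> 3 i v))) = 0 \<and>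
            (\<Sum>i=2..s. c i *\<^sub>R b i (K (\<Sum>j=2..<i. a i j (J (\<psi> 2 j v))))) = 0 \<and>
            (\<Sum>i=2..s. b i (B (\<psi> 2 i v) (\<psi> 2 i w))) = 0 \<and>
            (\<Sum>i=2..s. (c i)\<^sup>2 *\<^sub>R b i (L (\<psi> 2 i v))) = 0 \<and>
            \<comment> \<open>order 6\<close>
            (\<Sum>i=2..s. b i (J (\<psi> 5 i v))) = 0 \<and>
            (\<Sum>i=2..s. b i (J (\<Sum>j=2..<i. a i j (J (\<psi> 4 j v))))) = 0 \<and>
            (\<Sum>i=2..s. b i (J (\<Sum>j=2..<i. a i j (J (\<Sum>k=2..<j. a j k (J (\<psi> 3 k v))))))) = 0 \<and>
            (\<Sum>i=2..s. b i (J (\<Sum>j=2..<i. a i j (J (\<Sum>k=2..<j. a j k (J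
                (\<Sum>l=2..<k. a k l (J (\<psi> 2 l v))))))))) = 0 \<and>
            (\<Sum>i=2..s. b i (J (\<Sum>j=2..<i. a i j (J (\<Sum>k=2..<j. c k *\<^sub>R a j k (K (\<psi> 2 k v))))))) = 0 \<and>
            (\<Sum>i=2..s. b i (J (\<Sum>j=2..<i. c j *\<^sub>R a i j (K (\<psi> 3 j v))))) = 0 \<and>
            (\<Sum>i=2..s. b i (J (\<Sum>j=2..<i. c j *\<^sub>R a i j (K (\<Sum>k=2..<j. a j k (J (\<psi> 2 k v))))))) = 0 \<and>
            (\<Sum>i=2..s. b i (J (\<Sum>j=2..<i. a i j (B (\<psi> 2 j v) (\<psi> 2 j w))))) = 0 \<and>
            (\<Sum>i=2..s. b i (J (\<Sum>j=2..<i. (c j)\<^sup>2 *\<^sub>R a i j (L (\<psi> 2 j v))))) = 0 \<and>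
            (\<Sum>i=2..s. c i *\<^sub>R b i (K (\<psi> 4 i v))) = 0 \<and>
            (\<Sum>i=2..s. c i *\<^sub>R b i (K (\<Sum>j=2..<i. a i j (J (\<psi> 3 j v))))) = 0 \<and>
            (\<Sum>i=2..s. c i *\<^sub>R b i (K (\<Sum>j=2..<i. a i j (J (\<Sum>k=2..<j. a j k (J (\<psi> 2 k v))))))) = 0 \<and>
            (\<Sum>i=2..s. c i *\<^sub>R b i (K (\<Sum>j=2..<i. c j *\<^sub>R a i j (K (\<psi> 2 j v))))) = 0 \<and>
            (\<Sum>i=2..s. b i (B (\<psi> 2 i v) (\<psi> 3 i w))) = 0 \<and>
            (\<Sum>i=2..s. b i (B (\<psi> 2 i v) (\<Sum>j=2..<i. a i j (J (\<psi> 2 j w))))) = 0 \<and>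
            (\<Sum>i=2..s. (c i)\<^sup>2 *\<^sub>R b i (L (\<psi> 3 i v))) = 0 \<and>
            (\<Sum>i=2..s. (c i)\<^sup>2 *\<^sub>R b i (L (\<Sum>j=2..<i. a i j (J (\<psi> 2 j v))))) = 0 \<and>
            (\<Sum>i=2..s. c i *\<^sub>R b i (B (\<psi> 2 i v) (\<psi> 2 i w))) = 0 \<and>
            (\<Sum>i=2..s. (c i)^3 *\<^sub>R b i (L (\<psi> 2 i v))) = 0)))"

end

theory Submission
  imports Defs
begin

text \<open>
  The method is compared with the variation-of-constants formula, in which the unbounded operator \<open>A\<close>
  enters only through the semigroup. All constants therefore come from bounds for the semigroup, for the
  derivatives of the solution and of \<open>g\<close>, and from the coefficients of the method.

  \<^item> \<^emph>\<open>Local error.\<close> Start the method at the exact value \<open>u(t)\<close>. Since \<open>u\<close> and \<open>g \<circ> u\<close> are smooth, the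
  recursion of the \<open>\<phi>\<close>-functions turns \<open>u(t + c\<^sub>i h)\<close> into \<open>u(t)\<close> plus terms \<open>\<phi>\<^sub>q(c\<^sub>i h A)\<close> applied to
  time derivatives of \<open>g \<circ> u\<close> (lemmas \<open>exponential_taylor\<close> and \<open>exact_step_expansion\<close>). Hence the error
  of stage \<open>i\<close> is \<open>\<Sum> h\<^sup>q \<psi>\<^sub>q\<^sub>,\<^sub>i f\<^sup>(\<^sup>q\<^sup>-\<^sup>1\<^sup>)(t)\<close> plus the effect of the errors of the previous stages. Expanding
  \<open>g\<close> along the solution and substituting recursively (\<open>stage_expansion\<close>), every term below order \<open>h\<^sup>7\<close>
  in the weighted sum of the stage contributions is one of the expressions in the stiff order conditions,
  with \<open>J, K, L\<close> the Taylor coefficients of \<open>g'(u(t))\<close> and \<open>B\<close> those of \<open>g''(u(t))\<close>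
  (\<open>order_conditions_cancel\<close>). The strong quadrature conditions remove the rest except for
  \<open>h\<^sup>6 \<delta>(hA) f\<^sup>(\<^sup>5\<^sup>)(t)\<close> with \<open>\<delta> = \<Sum> b\<^sub>i c\<^sub>i\<^sup>5/5! - \<phi>\<^sub>6\<close> (\<open>local_error\<close>).

  \<^item> \<^emph>\<open>Global error.\<close> The step map is the semigroup plus \<open>h\<close> times a map that is Lipschitz continuous near
  the solution (\<open>step_stability\<close>). Solving the error recursion, the \<open>O(h\<^sup>7)\<close> defects add up to \<open>O(h\<^sup>6)\<close>
  and a discrete Gronwall inequality finishes the proof (\<open>convergence\<close>), provided that the leading
  defects, which are only \<open>O(h\<^sup>6)\<close> each, do not accumulate.

  \<^item> \<^emph>\<open>No accumulation.\<close> If the sixth quadrature condition holds in the strong sense, then \<open>\<delta>(hA) = 0\<close>.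
  In the weak form \<open>\<delta>(0) = 0\<close>, and \<open>\<delta>(hA)\<close> is a linear combination of averages of differences
  \<open>e\<^sup>\<sigma>\<^sup>h\<^sup>A - I\<close>. The sums
  \<open>\<Sum>\<^sub>l e\<^sup>l\<^sup>h\<^sup>A (e\<^sup>\<sigma>\<^sup>h\<^sup>A - I)\<close> are bounded uniformly in \<open>h\<close>: for \<open>\<sigma> = 1\<close> they telescope, and for
  other \<open>\<sigma>\<close> the deviation from \<open>\<sigma>\<close> times the telescoping sum is a sum of second differences, which
  analyticity bounds by \<open>O(1/l\<^sup>2)\<close> (\<open>shifted_grid_sum_bound\<close>). Summation by parts transfers the bound to
  \<open>\<Sum> e\<^sup>l\<^sup>h\<^sup>A \<delta>(hA) f\<^sup>(\<^sup>5\<^sup>)(t\<^sub>n)\<close>, as \<open>f\<^sup>(\<^sup>5\<^sup>)\<close> is Lipschitz continuous.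
\<close>

section \<open>Uniform boundedness\<close>

text \<open>
  The Banach--Steinhaus theorem: the sets of points at which the family is bounded by \<open>n\<close> are closed and
  cover the space, so that by the Baire category theorem one of them contains a ball.
\<close>

lemma uniform_boundedness:
  fixes F :: "('a::banach \<Rightarrow>\<^sub>L 'b::real_normed_vector) set"
  assumes pw: "\<And>x. \<exists>c. \<forall>f\<in>F. norm (blinfun_apply f x) \<le> c"
  shows "\<exists>C. \<forall>f\<in>F. norm f \<le> C"
proof -
  define G where "G n = {x. \<forall>f\<in>F. norm (blinfun_apply f x) \<le> real n}" for n
  have closed: "closed (G n)" for n
  proof -
    have "G n = (\<Inter>f\<in>F. {x. norm (blinfun_apply f x) \<le> real n})" by (auto simp: G_def)
    moreover have "closed {x. norm (blinfun_apply f x) \<le> real n}" for f :: "'a \<Rightarrow>\<^sub>L 'b"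
      by (intro closed_Collect_le continuous_intros)
    ultimately show ?thesis by auto
  qed
  have cover: "\<Union>(range G) = UNIV"
  proof -
    have "\<exists>n. x \<in> G n" for x
    proof -
      obtain c where c: "\<forall>f\<in>F. norm (blinfun_apply f x) \<le> c" using pw by blast
      obtain n where "c \<le> real n" using real_arch_simple by blast
      then show ?thesis using c unfolding G_def by (auto intro!: exI[of _ n] intro: order_trans)
    qed
    then show ?thesis by auto
  qed
  have "\<exists>n. interior (G n) \<noteq> {}"
  proof (rule ccontr)
    assume "\<not> ?thesis"
    then have "euclidean interior_of \<Union>(range G) = {}"
      using closed by (intro Baire_category_alt) (auto simp: completely_metrizable_space_euclidean)
    then show False using cover by simp
  qed
  then obtain n x0 where "x0 \<in> interior (G n)" by auto
  then obtain e where e: "e > 0" "ball x0 e \<subseteq> G n"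
    by (auto simp: mem_interior)
  have "norm f \<le> 4 * real n / e" if "f \<in> F" for f
  proof (rule norm_blinfun_bound)
    show "0 \<le> 4 * real n / e" using e by simp
    fix y
    show "norm (blinfun_apply f y) \<le> 4 * real n / e * norm y"
    proof (cases "y = 0")
      case False
      define s where "s = e / (2 * norm y)"
      have s: "s > 0" using e False by (simp add: s_def)
      have "norm (s *\<^sub>R y) < e" using e False by (simp add: s_def)
      then have "x0 + s *\<^sub>R y \<in> G n" "x0 \<in> G n" using e by (auto simp: dist_norm)
      then have "norm (blinfun_apply f (x0 + s *\<^sub>R y)) \<le> n" "norm (blinfun_apply f x0) \<le> n"
        using that by (auto simp: G_def)
      moreover have eq: "blinfun_apply f (s *\<^sub>R y) = blinfun_apply f (x0 + s *\<^sub>R y) - blinfun_apply f x0"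
        by (simp add: blinfun.add_right)
      ultimately have "norm (blinfun_apply f (s *\<^sub>R y)) \<le> 2 * real n"
        using norm_triangle_ineq4[of "blinfun_apply f (x0 + s *\<^sub>R y)" "blinfun_apply f x0"] unfolding eq by linarith
      then have "s * norm (blinfun_apply f y) \<le> 2 * real n" using s by (simp add: blinfun.scaleR_right)
      then show ?thesis using e False by (simp add: s_def field_simps)
    qed simp
  qed
  then show ?thesis by blast
qed

section \<open>Bounded derivatives and Taylor expansion\<close>

lemma vector_derivative_norm_bound:
  fixes f :: "real \<Rightarrow> 'b::real_normed_vector"
  assumes "a \<le> b" "\<And>t. t \<in> {a..b} \<Longrightarrow> (f has_vector_derivative f' t) (at t within {a..b})"
    and "\<And>t. t \<in> {a..b} \<Longrightarrow> norm (f' t) \<le> B"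
  shows "norm (f b - f a) \<le> B * (b - a)"
proof -
  have "norm (f b - f a) \<le> B * norm (b - a)"
  proof (rule differentiable_bound[where S="{a..b}" and f'="\<lambda>t h. h *\<^sub>R f' t"])
    show "onorm (\<lambda>h. h *\<^sub>R f' t) \<le> B" if "t \<in> {a..b}" for t
      using assms(3)[OF that] by (intro onorm_le) (simp add: mult.commute[of B] mult_left_mono)
  qed (use assms in \<open>auto simp: has_vector_derivative_def\<close>)
  then show ?thesis using assms(1) by simp
qed

lemma taylor_polynomial_derivative:
  fixes v :: "nat \<Rightarrow> 'b::real_normed_vector"
  shows "((\<lambda>s. \<Sum>k<Suc n. (s ^ k / fact k) *\<^sub>R v k) has_vector_derivative
           (\<Sum>k<n. (s ^ k / fact k) *\<^sub>R v (Suc k))) (at s within S)"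
proof (induction n)
  case (Suc n)
  have "((\<lambda>s. s ^ Suc n / fact (Suc n)) has_real_derivative s ^ n / fact n) (at s within S)"
  proof -
    have "((\<lambda>s. s ^ Suc n / fact (Suc n)) has_real_derivative real (Suc n) * s ^ n / fact (Suc n)) (at s within S)"
      by (auto intro!: derivative_eq_intros simp del: power_Suc fact_Suc)
    moreover have "real (Suc n) * s ^ n / fact (Suc n) = s ^ n / fact n"
      by (simp del: of_nat_Suc)
    ultimately show ?thesis by simp
  qed
  then have "((\<lambda>s. (s ^ Suc n / fact (Suc n)) *\<^sub>R v (Suc n)) has_vector_derivative
      (s ^ n / fact n) *\<^sub>R v (Suc n)) (at s within S)"
    by (rule has_vector_derivative_scaleR[where g="\<lambda>_. v (Suc n)" and g'=0, THEN has_vector_derivative_eq_rhs]) auto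
  from has_vector_derivative_add[OF Suc this] show ?case
    by simp
qed simp

text \<open>
  The recursion over the derivative makes the Leibniz rule and the chain rule plain inductions. The last
  derivative is bounded but possibly discontinuous, which is all that the Taylor remainders need.
\<close>

primrec boundedly_differentiable :: "nat \<Rightarrow> real set \<Rightarrow> (real \<Rightarrow> 'b::real_normed_vector) \<Rightarrow> bool" where
  "boundedly_differentiable 0 I F \<longleftrightarrow> bounded (F ` I)"
| "boundedly_differentiable (Suc n) I F \<longleftrightarrow> bounded (F ` I) \<and>
     (\<exists>F'. (\<forall>t\<in>I. (F has_vector_derivative F' t) (at t within I)) \<and> boundedly_differentiable n I F')"

lemma boundedly_differentiable_bounded: "boundedly_differentiable n I F \<Longrightarrow> bounded (F ` I)"
  by (cases n) auto

lemma boundedly_differentiable_SucD: "boundedly_differentiable (Suc n) I F \<Longrightarrow> boundedly_differentiable n I F"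
proof (induction n arbitrary: F)
  case (Suc n)
  then obtain F' where "\<forall>t\<in>I. (F has_vector_derivative F' t) (at t within I)" "boundedly_differentiable (Suc n) I F'"
    by auto
  with Suc.IH[of F'] boundedly_differentiable_bounded[OF Suc.prems] show ?case by auto
qed simp

lemma boundedly_differentiable_add: "boundedly_differentiable n I F \<Longrightarrow> boundedly_differentiable n I G \<Longrightarrow> boundedly_differentiable n I (\<lambda>t. F t + G t)"
proof (induction n arbitrary: F G)
  case 0
  then show ?case by (simp add: bounded_plus_comp)
next
  case (Suc n)
  obtain F' where F': "\<forall>t\<in>I. (F has_vector_derivative F' t) (at t within I)" "boundedly_differentiable n I F'"
    using Suc.prems by auto
  obtain G' where G': "\<forall>t\<in>I. (G has_vector_derivative G' t) (at t within I)" "boundedly_differentiable n I G'"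
    using Suc.prems by auto
  have "bounded ((\<lambda>t. F t + G t) ` I)"
    using Suc.prems by (auto intro: bounded_plus_comp)
  moreover have "\<forall>t\<in>I. ((\<lambda>t. F t + G t) has_vector_derivative F' t + G' t) (at t within I)"
    using F' G' by (auto intro: has_vector_derivative_add)
  ultimately show ?case using Suc.IH[OF F'(2) G'(2)] by auto
qed

lemma (in bounded_bilinear) bounded_image:
  assumes "bounded (F ` I)" "bounded (G ` I)"
  shows "bounded ((\<lambda>t. prod (F t) (G t)) ` I)"
proof -
  obtain K where K: "K > 0" "\<And>a b. norm (prod a b) \<le> norm a * norm b * K"
    using pos_bounded by blast
  obtain C where C: "C > 0" "\<And>t. t \<in> I \<Longrightarrow> norm (F t) \<le> C"
    using assms(1) by (auto simp: bounded_pos)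
  obtain E where E: "E > 0" "\<And>t. t \<in> I \<Longrightarrow> norm (G t) \<le> E"
    using assms(2) by (auto simp: bounded_pos)
  have "norm (prod (F t) (G t)) \<le> C * E * K" if "t \<in> I" for t
  proof -
    have "norm (F t) * norm (G t) \<le> C * E" using C E that by (intro mult_mono) auto
    then have "norm (F t) * norm (G t) * K \<le> C * E * K" using K by (intro mult_right_mono) auto
    then show ?thesis using K(2)[of "F t" "G t"] by linarith
  qed
  then show ?thesis by (auto simp: bounded_iff)
qed

lemma boundedly_differentiable_bilinear:
  assumes "bounded_bilinear pr"
  shows "boundedly_differentiable n I F \<Longrightarrow> boundedly_differentiable n I G \<Longrightarrow> boundedly_differentiable n I (\<lambda>t. pr (F t) (G t))"
proof (induction n arbitrary: F G)
  case 0
  then show ?case using bounded_bilinear.bounded_image[OF assms] by simp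
next
  case (Suc n)
  obtain F' where F': "\<forall>t\<in>I. (F has_vector_derivative F' t) (at t within I)" "boundedly_differentiable n I F'"
    using Suc.prems by auto
  obtain G' where G': "\<forall>t\<in>I. (G has_vector_derivative G' t) (at t within I)" "boundedly_differentiable n I G'"
    using Suc.prems by auto
  have "bounded ((\<lambda>t. pr (F t) (G t)) ` I)"
    using Suc.prems bounded_bilinear.bounded_image[OF assms] by auto
  moreover have "\<forall>t\<in>I. ((\<lambda>t. pr (F t) (G t)) has_vector_derivative
      pr (F t) (G' t) + pr (F' t) (G t)) (at t within I)"
    using F' G' by (auto intro: bounded_bilinear.has_vector_derivative[OF assms])
  moreover have "boundedly_differentiable n I (\<lambda>t. pr (F t) (G' t) + pr (F' t) (G t))"
    using Suc.IH[OF _ G'(2)] Suc.IH[OF F'(2)] boundedly_differentiable_SucD[OF Suc.prems(1)] boundedly_differentiable_SucD[OF Suc.prems(2)]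
    by (intro boundedly_differentiable_add) auto
  ultimately show ?case by auto
qed

lemma boundedly_differentiable_seq:
  assumes "boundedly_differentiable n I F"
  obtains W C where "W 0 = F"
    "\<And>k t. k < n \<Longrightarrow> t \<in> I \<Longrightarrow> (W k has_vector_derivative W (Suc k) t) (at t within I)"
    "\<And>k t. k \<le> n \<Longrightarrow> t \<in> I \<Longrightarrow> norm (W k t) \<le> C"
proof -
  have "\<exists>W C. W 0 = F \<and> (\<forall>k t. k < n \<longrightarrow> t \<in> I \<longrightarrow> (W k has_vector_derivative W (Suc k) t) (at t within I))
    \<and> (\<forall>k t. k \<le> n \<longrightarrow> t \<in> I \<longrightarrow> norm (W k t) \<le> C)"
    using assms
  proof (induction n arbitrary: F)
    case 0
    then obtain C where "\<And>t. t \<in> I \<Longrightarrow> norm (F t) \<le> C" by (auto simp: bounded_iff)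
    then show ?case by (intro exI[of _ "\<lambda>_. F"] exI[of _ C]) auto
  next
    case (Suc n)
    then obtain F' where F': "\<forall>t\<in>I. (F has_vector_derivative F' t) (at t within I)" "boundedly_differentiable n I F'"
      and bd: "bounded (F ` I)" by auto
    obtain W C where W: "W 0 = F'" "\<forall>k t. k < n \<longrightarrow> t \<in> I \<longrightarrow> (W k has_vector_derivative W (Suc k) t) (at t within I)"
       "\<forall>k t. k \<le> n \<longrightarrow> t \<in> I \<longrightarrow> norm (W k t) \<le> C"
      using Suc.IH[OF F'(2)] by auto
    obtain E where E: "\<And>t. t \<in> I \<Longrightarrow> norm (F t) \<le> E" using bd by (auto simp: bounded_iff)
    show ?case
    proof (intro exI[of _ "case_nat F W"] exI[of _ "max C E"] conjI allI impI)
      fix k t assume "k < Suc n" "t \<in> I"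
      then show "(case_nat F W k has_vector_derivative case_nat F W (Suc k) t) (at t within I)"
        using F' W by (cases k) auto
    next
      fix k t assume "k \<le> Suc n" "t \<in> I"
      then show "norm (case_nat F W k t) \<le> max C E"
        using E W by (cases k) (auto simp: le_max_iff_disj)
    qed simp
  qed
  then show ?thesis using that by blast
qed

lemma boundedly_differentiable_of_seq:
  assumes "\<And>k t. k < n \<Longrightarrow> t \<in> I \<Longrightarrow> (W k has_vector_derivative W (Suc k) t) (at t within I)"
    "\<And>k t. k \<le> n \<Longrightarrow> t \<in> I \<Longrightarrow> norm (W k t) \<le> C"
  shows "boundedly_differentiable n I (W 0)"
  using assms
proof (induction n arbitrary: W)
  case 0
  then show ?case by (auto simp: bounded_iff)
next
  case (Suc n)
  have "boundedly_differentiable n I ((\<lambda>k. W (Suc k)) 0)" using Suc.prems by (intro Suc.IH) auto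
  moreover have "bounded (W 0 ` I)" using Suc.prems(2)[of 0] by (auto simp: bounded_iff)
  ultimately show ?case using Suc.prems(1)[of 0] by auto
qed

text \<open>
  Induction on the order: the remainder of a function is the primitive of the remainder of its derivative,
  so the mean value inequality suffices and the factorial in the constant is given away.
\<close>

lemma taylor_bound:
  fixes W :: "nat \<Rightarrow> real \<Rightarrow> 'b::real_normed_vector"
  assumes "\<And>k s. k < n \<Longrightarrow> s \<in> {a..b} \<Longrightarrow> (W k has_vector_derivative W (Suc k) s) (at s within {a..b})"
    and "\<And>s. s \<in> {a..b} \<Longrightarrow> norm (W n s) \<le> B"
    and "t \<in> {a..b}" "t + \<tau> \<in> {a..b}" "0 \<le> \<tau>"
  shows "norm (W 0 (t + \<tau>) - (\<Sum>k<n. (\<tau> ^ k / fact k) *\<^sub>R W k t)) \<le> B * \<tau> ^ n"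
  using assms
proof (induction n arbitrary: W \<tau>)
  case 0
  then show ?case by simp
next
  case (Suc n)
  have B: "0 \<le> B" using Suc.prems(2)[OF Suc.prems(3)] norm_ge_zero order_trans by blast
  define R where "R s = W 0 (t + s) - (\<Sum>k<Suc n. (s ^ k / fact k) *\<^sub>R W k t)" for s
  define R' where "R' s = W 1 (t + s) - (\<Sum>k<n. (s ^ k / fact k) *\<^sub>R W (Suc k) t)" for s
  have der: "(R has_vector_derivative R' s) (at s within {0..\<tau>})" if s: "s \<in> {0..\<tau>}" for s
  proof -
    have im: "(\<lambda>s. t + s) ` {0..\<tau>} \<subseteq> {a..b}" using Suc.prems by auto
    have *: "(W 0 has_vector_derivative W 1 (t + s)) (at (t + s) within (\<lambda>s. t + s) ` {0..\<tau>})"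
      using Suc.prems(1)[of 0 "t + s"] im s
      by (intro has_vector_derivative_within_subset[OF _ im]) (auto simp: image_subset_iff)
    have "((\<lambda>s. W 0 (t + s)) has_vector_derivative W 1 (t + s)) (at s within {0..\<tau>})"
    proof -
      have "((\<lambda>s. t + s) has_vector_derivative 1) (at s within {0..\<tau>})"
        by (auto intro!: derivative_eq_intros)
      from vector_diff_chain_within[OF this *] show ?thesis by (simp add: o_def)
    qed
    then show ?thesis unfolding R_def R'_def
      by (intro has_vector_derivative_diff taylor_polynomial_derivative)
  qed
  have bd: "norm (R' s) \<le> B * \<tau> ^ n" if s: "s \<in> {0..\<tau>}" for s
  proof -
    have "norm (R' s) \<le> B * s ^ n"
      unfolding R'_def
      using Suc.IH[of "\<lambda>k. W (Suc k)" s] Suc.prems s by auto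
    also have "\<dots> \<le> B * \<tau> ^ n" using s B by (intro mult_left_mono power_mono) auto
    finally show ?thesis .
  qed
  have "norm (R \<tau> - R 0) \<le> B * \<tau> ^ n * (\<tau> - 0)"
    using Suc.prems der bd by (intro vector_derivative_norm_bound[where f'=R']) auto
  moreover have "R 0 = 0" unfolding R_def by (simp add: lessThan_Suc_eq_insert_0 sum.reindex zero_notin_Suc_image)
  ultimately show ?case by (simp add: R_def mult_ac)
qed

section \<open>Symmetry of second derivatives\<close>

text \<open>
  Along the \<open>z\<close>-direction, the difference \<open>g(x + s y + b z) - g(x + b z)\<close> has a derivative close to \<open>s\<close>
  times \<open>g''(x)(y, z)\<close>, since \<open>g'\<close> is differentiable at \<open>x\<close>. The symmetric left-hand side then forces the
  second derivative to be symmetric.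
\<close>

lemma second_difference_approx:
  fixes g :: "'a::real_normed_vector \<Rightarrow> 'b::real_normed_vector"
  assumes "open S" "x \<in> S" and g: "\<And>p. p \<in> S \<Longrightarrow> (g has_derivative blinfun_apply (g1 p)) (at p)"
    and g1: "(g1 has_derivative blinfun_apply (g2 x)) (at x)" and "\<epsilon> > 0"
  shows "\<exists>s0>0. \<forall>s. 0 < s \<and> s \<le> s0 \<longrightarrow>
    norm (g (x + s *\<^sub>R y + s *\<^sub>R z) - g (x + s *\<^sub>R y) - g (x + s *\<^sub>R z) + g x - s\<^sup>2 *\<^sub>R g2 x y z) \<le> \<epsilon> * s\<^sup>2"
proof -
  define k where "k = norm y + norm z + 1"
  have k: "k > 0" by (simp add: k_def add_nonneg_pos)
  define \<eta> where "\<eta> = \<epsilon> / (2 * k * k)"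
  have \<eta>: "\<eta> > 0" using assms(5) k by (simp add: \<eta>_def)
  obtain d1 where d1: "d1 > 0" "ball x d1 \<subseteq> S" using assms(1,2) open_contains_ball by blast
  obtain d2 where d2: "d2 > 0" "\<And>p. norm (p - x) < d2 \<Longrightarrow> norm (g1 p - g1 x - g2 x (p - x)) \<le> \<eta> * norm (p - x)"
    using g1 \<eta> unfolding has_derivative_at_alt by blast
  define s0 where "s0 = min d1 d2 / (2 * k)"
  have s0: "s0 > 0" using d1 d2 k by (simp add: s0_def)
  show ?thesis
  proof (intro exI[of _ s0] conjI allI impI s0)
    fix s :: real assume s: "0 < s \<and> s \<le> s0"
    have near: "norm (a *\<^sub>R y + b *\<^sub>R z) \<le> s * k" if "0 \<le> a" "a \<le> s" "0 \<le> b" "b \<le> s" for a b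
    proof -
      have "norm (a *\<^sub>R y + b *\<^sub>R z) \<le> a * norm y + b * norm z"
        using norm_triangle_ineq[of "a *\<^sub>R y" "b *\<^sub>R z"] that by simp
      also have "\<dots> \<le> s * norm y + s * norm z" using that by (intro add_mono mult_right_mono) auto
      also have "\<dots> \<le> s * k" using s by (simp add: k_def algebra_simps)
      finally show ?thesis .
    qed
    have sk: "s * k < d1" "s * k < d2"
    proof -
      have "s * k \<le> s0 * k" using s k by (intro mult_right_mono) auto
      also have "s0 * k = min d1 d2 / 2" using k by (simp add: s0_def)
      finally show "s * k < d1" "s * k < d2" using d1 d2 by auto
    qed
    have inS: "x + a *\<^sub>R y + b *\<^sub>R z \<in> S" if "0 \<le> a" "a \<le> s" "0 \<le> b" "b \<le> s" for a b
    proof -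
      have "dist x (x + a *\<^sub>R y + b *\<^sub>R z) = norm (a *\<^sub>R y + b *\<^sub>R z)"
        by (metis add.assoc dist_add_cancel dist_0_norm add.right_neutral)
      then show ?thesis using near[OF that] sk d1 by auto
    qed
    have lin: "norm (g1 (x + a *\<^sub>R y + b *\<^sub>R z) - g1 x - g2 x (a *\<^sub>R y + b *\<^sub>R z)) \<le> \<eta> * (s * k)"
      if "0 \<le> a" "a \<le> s" "0 \<le> b" "b \<le> s" for a b
    proof -
      have "norm (g1 (x + (a *\<^sub>R y + b *\<^sub>R z)) - g1 x - g2 x (x + (a *\<^sub>R y + b *\<^sub>R z) - x)) \<le> \<eta> * norm (x + (a *\<^sub>R y + b *\<^sub>R z) - x)"
        using near[OF that] sk by (intro d2) auto
      also have "\<dots> \<le> \<eta> * (s * k)" using near[OF that] \<eta> by simp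
      finally show ?thesis by (simp add: add.assoc)
    qed
    define p where "p b = g (x + s *\<^sub>R y + b *\<^sub>R z) - g (x + b *\<^sub>R z) - (b * s) *\<^sub>R g2 x y z" for b
    define p' where "p' b = g1 (x + s *\<^sub>R y + b *\<^sub>R z) z - g1 (x + b *\<^sub>R z) z - s *\<^sub>R g2 x y z" for b
    have line: "((\<lambda>b. g (c + b *\<^sub>R z)) has_vector_derivative g1 (c + b *\<^sub>R z) z) (at b within {0..s})"
      if "c + b *\<^sub>R z \<in> S" for c b
    proof -
      have "((\<lambda>b. c + b *\<^sub>R z) has_derivative (\<lambda>h. h *\<^sub>R z)) (at b within {0..s})"
        by (auto intro!: derivative_eq_intros)
      from has_derivative_compose[OF this g[OF that]] show ?thesis
        by (simp add: has_vector_derivative_def blinfun.scaleR_right)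
    qed
    have "(p has_vector_derivative p' b) (at b within {0..s})" if "b \<in> {0..s}" for b
      unfolding p_def p'_def using inS[of s b] inS[of 0 b] that s
      by (intro has_vector_derivative_diff line) (auto intro!: derivative_eq_intros simp: has_vector_derivative_def)
    moreover have "norm (p' b) \<le> \<epsilon> * s" if "b \<in> {0..s}" for b
    proof -
      define X where "X = g1 (x + s *\<^sub>R y + b *\<^sub>R z) - g1 x - g2 x (s *\<^sub>R y + b *\<^sub>R z)"
      define Y where "Y = g1 (x + 0 *\<^sub>R y + b *\<^sub>R z) - g1 x - g2 x (0 *\<^sub>R y + b *\<^sub>R z)"
      have "p' b = blinfun_apply (X - Y) z"
        by (simp add: p'_def X_def Y_def blinfun.add_right blinfun.diff_left blinfun.scaleR_right blinfun.add_left blinfun.scaleR_left)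
      then have "norm (p' b) \<le> norm (X - Y) * norm z" by (simp add: norm_blinfun)
      also have "\<dots> \<le> (2 * \<eta> * (s * k)) * k"
      proof (intro mult_mono)
        have "norm X \<le> \<eta> * (s * k)" "norm Y \<le> \<eta> * (s * k)"
          unfolding X_def Y_def using lin[of s b] lin[of 0 b] that s by auto
        then show "norm (X - Y) \<le> 2 * \<eta> * (s * k)" using norm_triangle_ineq4[of X Y] by simp
      qed (use k \<eta> s in \<open>auto simp: k_def\<close>)
      also have "\<dots> = \<epsilon> * s" using k by (simp add: \<eta>_def field_simps)
      finally show ?thesis .
    qed
    ultimately have "norm (p s - p 0) \<le> \<epsilon> * s * (s - 0)"
      using s by (intro vector_derivative_norm_bound[where f'=p']) auto
    moreover have "p s - p 0 = g (x + s *\<^sub>R y + s *\<^sub>R z) - g (x + s *\<^sub>R y) - g (x + s *\<^sub>R z) + g x - s\<^sup>2 *\<^sub>R g2 x y z"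
      by (simp add: p_def power2_eq_square)
    ultimately show "norm (g (x + s *\<^sub>R y + s *\<^sub>R z) - g (x + s *\<^sub>R y) - g (x + s *\<^sub>R z) + g x - s\<^sup>2 *\<^sub>R g2 x y z) \<le> \<epsilon> * s\<^sup>2"
      by (simp add: power2_eq_square mult.assoc)
  qed
qed

lemma second_derivative_symmetric:
  fixes g :: "'a::real_normed_vector \<Rightarrow> 'b::real_normed_vector"
  assumes "open S" "x \<in> S" "\<And>p. p \<in> S \<Longrightarrow> (g has_derivative blinfun_apply (g1 p)) (at p)"
    and "(g1 has_derivative blinfun_apply (g2 x)) (at x)"
  shows "g2 x y z = g2 x z y"
proof (rule ccontr)
  assume "g2 x y z \<noteq> g2 x z y"
  define e where "e = norm (g2 x y z - g2 x z y) / 3"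
  have e: "e > 0" using \<open>g2 x y z \<noteq> g2 x z y\<close> by (simp add: e_def)
  let ?D = "\<lambda>y z s. g (x + s *\<^sub>R y + s *\<^sub>R z) - g (x + s *\<^sub>R y) - g (x + s *\<^sub>R z) + g x"
  obtain s1 where s1: "s1 > 0" "\<And>s. 0 < s \<and> s \<le> s1 \<Longrightarrow> norm (?D y z s - s\<^sup>2 *\<^sub>R g2 x y z) \<le> e * s\<^sup>2"
    using second_difference_approx[where g=g and ?g1.0=g1 and ?g2.0=g2, OF assms e] by blast
  obtain s2 where s2: "s2 > 0" "\<And>s. 0 < s \<and> s \<le> s2 \<Longrightarrow> norm (?D z y s - s\<^sup>2 *\<^sub>R g2 x z y) \<le> e * s\<^sup>2"
    using second_difference_approx[where g=g and ?g1.0=g1 and ?g2.0=g2, OF assms e] by blast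
  define s where "s = min s1 s2"
  have s: "s > 0" using s1 s2 by (simp add: s_def)
  have "?D y z s = ?D z y s" by (simp add: algebra_simps)
  then have "s\<^sup>2 *\<^sub>R (g2 x y z - g2 x z y) = (?D z y s - s\<^sup>2 *\<^sub>R g2 x z y) - (?D y z s - s\<^sup>2 *\<^sub>R g2 x y z)"
    by (simp add: scaleR_diff_right)
  then have "norm (s\<^sup>2 *\<^sub>R (g2 x y z - g2 x z y)) \<le> e * s\<^sup>2 + e * s\<^sup>2"
    using s1(2)[of s] s2(2)[of s] s norm_triangle_ineq4[of "?D z y s - s\<^sup>2 *\<^sub>R g2 x z y" "?D y z s - s\<^sup>2 *\<^sub>R g2 x y z"]
    by (simp add: s_def)
  then have "s\<^sup>2 * (3 * e) \<le> s\<^sup>2 * (2 * e)" by (simp add: e_def mult_ac)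
  then show False using s e by simp
qed

section \<open>Strongly continuous semigroups and \<open>\<phi>\<close>-functions\<close>

text \<open>
  A family that converges strongly at \<open>0\<close> is bounded in norm near \<open>0\<close>: otherwise a sequence \<open>z\<^sub>n \<rightarrow> 0\<close> with
  unbounded norms would contradict uniform boundedness.
\<close>

lemma norm_bounded_near_zero:
  fixes S :: "'c::real_normed_vector \<Rightarrow> 'a::banach \<Rightarrow>\<^sub>L 'b::real_normed_vector"
  assumes lim: "\<And>x. ((\<lambda>z. S z x) \<longlongrightarrow> L x) (at 0 within V)"
  obtains d C where "d > 0" "\<And>z. z \<in> V \<Longrightarrow> z \<noteq> 0 \<Longrightarrow> norm z < d \<Longrightarrow> norm (S z) \<le> C"
proof (rule ccontr)
  assume "\<not> thesis"
  then have *: "\<exists>z. z \<in> V \<and> z \<noteq> 0 \<and> norm z < inverse (real (Suc n)) \<and> norm (S z) > real n" for n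
    using that[of "inverse (real (Suc n))" "real n"] by (force simp: not_le)
  obtain z where z: "\<And>n. z n \<in> V \<and> z n \<noteq> 0 \<and> norm (z n) < inverse (real (Suc n)) \<and> norm (S (z n)) > real n"
    using * by metis
  have "z \<longlonglongrightarrow> 0"
    by (rule Lim_null_comparison[OF _ LIMSEQ_inverse_real_of_nat])
       (use z in \<open>auto intro!: always_eventually simp: less_imp_le\<close>)
  then have zlim: "filterlim z (at 0 within V) sequentially"
    using z by (auto simp: filterlim_at)
  have "\<exists>c. \<forall>f\<in>range (\<lambda>n. S (z n)). norm (blinfun_apply f x) \<le> c" for x
  proof -
    have "(\<lambda>n. S (z n) x) \<longlonglongrightarrow> L x" using filterlim_compose[OF lim zlim] .
    then have "Bseq (\<lambda>n. S (z n) x)" by (rule convergent_imp_Bseq[OF convergentI])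
    then show ?thesis by (auto simp: Bseq_def)
  qed
  from uniform_boundedness[of "range (\<lambda>n. S (z n))", OF this]
  obtain C where C: "\<And>n. norm (S (z n)) \<le> C" by auto
  obtain n where "C \<le> real n" using real_arch_simple by blast
  then show False using C[of n] z[of n] by auto
qed

lemma has_vector_derivative_within_alt:
  "(f has_vector_derivative f') (at x within S) \<longleftrightarrow>
     (\<forall>e>0. \<forall>\<^sub>F y in at x within S. norm (f y - f x - (y - x) *\<^sub>R f') \<le> e * \<bar>y - x\<bar>)"
  by (simp add: has_vector_derivative_def has_derivative_within_alt2 bounded_linear_scaleR_left)

lemma unit_interval_integral_bound:
  fixes f :: "real \<Rightarrow> 'b::real_normed_vector"
  assumes "(f has_integral i) {0..1}" "\<And>\<theta>. \<theta> \<in> {0..1} \<Longrightarrow> norm (f \<theta>) \<le> B"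
  shows "norm i \<le> B"
  using has_integral_bound[of B f i 0 1] assms order_trans[OF norm_ge_zero assms(2)[of 0]] by simp

locale c0_semigroup =
  fixes T :: "real \<Rightarrow> 'a::banach \<Rightarrow>\<^sub>L 'a"
  assumes T_zero: "T 0 = id_blinfun"
    and T_add: "0 \<le> s \<Longrightarrow> 0 \<le> t \<Longrightarrow> T (s + t) = T s o\<^sub>L T t"
    and T_right_cont: "((\<lambda>t. T t x) \<longlongrightarrow> x) (at_right 0)"
begin

lemma T_add_apply: "0 \<le> s \<Longrightarrow> 0 \<le> t \<Longrightarrow> T (s + t) x = T s (T t x)"
  by (simp add: T_add)

lemma T_locally_bounded:
  obtains C where "1 \<le> C" "\<And>t. 0 \<le> t \<Longrightarrow> t \<le> b \<Longrightarrow> norm (T t) \<le> C"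
proof -
  obtain d C0 where d: "d > 0" "\<And>z. z \<in> {0<..} \<Longrightarrow> z \<noteq> 0 \<Longrightarrow> norm z < d \<Longrightarrow> norm (T z) \<le> C0"
    using norm_bounded_near_zero[of T "\<lambda>x. x" "{0<..}"] T_right_cont by metis
  define C1 where "C1 = max 1 C0"
  have C1: "1 \<le> C1" "\<And>t. 0 \<le> t \<Longrightarrow> t < d \<Longrightarrow> norm (T t) \<le> C1"
  proof -
    fix t :: real assume "0 \<le> t" "t < d"
    then show "norm (T t) \<le> C1"
      using d(2)[of t] by (cases "t = 0") (auto simp: C1_def T_zero norm_blinfun_id_le le_max_iff_disj)
  qed (simp add: C1_def)
  have pow: "norm (T (real n * s)) \<le> C1 ^ n" if "0 \<le> s" "s < d" for n s
  proof (induction n)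
    case 0
    then show ?case by (simp add: T_zero norm_blinfun_id_le)
  next
    case (Suc n)
    have "norm (T (real (Suc n) * s)) = norm (T s o\<^sub>L T (real n * s))"
      using that T_add[of s "real n * s"] by (simp add: algebra_simps)
    also have "\<dots> \<le> norm (T s) * norm (T (real n * s))" by (rule norm_blinfun_compose)
    also have "\<dots> \<le> C1 * C1 ^ n" using Suc C1 that by (intro mult_mono) auto
    finally show ?case by simp
  qed
  obtain n where n: "b / d < real n" using reals_Archimedean2 by blast
  have "norm (T t) \<le> C1 ^ (Suc n)" if "0 \<le> t" "t \<le> b" for t
  proof -
    have "t / real (Suc n) < d"
    proof -
      have "t < d * real n" using n that d(1) by (simp add: field_simps)
      also have "\<dots> \<le> d * real (Suc n)" using d(1) by simp
      finally show ?thesis by (simp add: field_simps)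
    qed
    then have "norm (T (real (Suc n) * (t / real (Suc n)))) \<le> C1 ^ Suc n" using that by (intro pow) auto
    then show ?thesis by (simp del: of_nat_Suc)
  qed
  then show ?thesis using that[of "C1 ^ Suc n"] C1(1) by (meson one_le_power)
qed

lemma T_apply_bound:
  assumes "\<And>t. 0 \<le> t \<Longrightarrow> t \<le> b \<Longrightarrow> norm (T t) \<le> C" "0 \<le> t" "t \<le> b"
  shows "norm (T t x) \<le> C * norm x"
  by (metis assms mult_right_mono norm_blinfun norm_ge_zero order_trans)

lemma T_diff_bound:
  assumes C: "\<And>t. 0 \<le> t \<Longrightarrow> t \<le> b \<Longrightarrow> norm (T t) \<le> C" and st: "0 \<le> s" "s \<le> b" "0 \<le> t" "t \<le> b"
  shows "norm (T t x - T s x) \<le> C * norm (T \<bar>t - s\<bar> x - x)"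
proof -
  have *: "norm (T t x - T s x) \<le> C * norm (T (t - s) x - x)" if "0 \<le> s" "s \<le> t" "t \<le> b" for s t
  proof -
    have "T t x = T s (T (t - s) x)" using T_add_apply[of s "t - s"] that by simp
    then have "T t x - T s x = T s (T (t - s) x - x)" by (simp add: blinfun.diff_right)
    then show ?thesis using T_apply_bound[of b C s, OF C] that by simp
  qed
  show ?thesis
    using *[of s t] *[of t s] st by (cases "s \<le> t") (auto simp: norm_minus_commute)
qed

lemma T_continuous: "continuous_on {0..} (\<lambda>t. T t x)"
  unfolding continuous_on_iff
proof (intro ballI allI impI)
  fix t e :: real assume t: "t \<in> {0..}" and e: "0 < e"
  obtain C where C: "1 \<le> C" "\<And>s. 0 \<le> s \<Longrightarrow> s \<le> t + 1 \<Longrightarrow> norm (T s) \<le> C" using T_locally_bounded by blast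
  have "\<forall>\<^sub>F s in at_right 0. dist (T s x) x < e / C"
    using T_right_cont[of x] e C(1) by (intro tendstoD) auto
  then obtain d where d: "d > 0" "\<And>s. 0 < s \<Longrightarrow> s < d \<Longrightarrow> dist (T s x) x < e / C"
    unfolding eventually_at_right_field by auto
  have d': "norm (T s x - x) < e / C" if "0 \<le> s" "s < d" for s
    using d(2)[of s] that e C(1) by (cases "s = 0") (auto simp: T_zero dist_norm)
  show "\<exists>d>0. \<forall>s\<in>{0..}. dist s t < d \<longrightarrow> dist (T s x) (T t x) < e"
  proof (intro exI[of _ "min 1 d"] conjI ballI impI)
    fix s :: real assume s: "s \<in> {0..}" "dist s t < min 1 d"
    have "norm (T s x - T t x) \<le> C * norm (T \<bar>s - t\<bar> x - x)"
      using s t by (intro T_diff_bound[OF C(2)]) (auto simp: dist_real_def)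
    also have "\<dots> < C * (e / C)" using s C(1) by (intro mult_strict_left_mono d') (auto simp: dist_real_def)
    finally show "dist (T s x) (T t x) < e" using C(1) by (simp add: dist_norm)
  qed (use d in auto)
qed

lemma T_continuous_backward:
  assumes "0 \<le> \<tau>" shows "continuous_on {0..1} (\<lambda>\<theta>. T ((1 - \<theta>) * \<tau>) x)"
  by (rule continuous_on_compose2[OF T_continuous]) (use assms in \<open>auto intro!: continuous_intros\<close>)

lemma phi_op_has_integral:
  assumes "0 \<le> \<tau>"
  shows "((\<lambda>\<theta>. (\<theta> ^ (k - 1) / fact (k - 1)) *\<^sub>R T ((1 - \<theta>) * \<tau>) x) has_integral phi_op T k \<tau> x) {0..1}"
  unfolding phi_op_def
  by (intro integrable_integral integrable_continuous_real continuous_intros T_continuous_backward assms) auto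

lemma phi_op_add: "0 \<le> \<tau> \<Longrightarrow> phi_op T k \<tau> (x + y) = phi_op T k \<tau> x + phi_op T k \<tau> y"
  using has_integral_add[OF phi_op_has_integral phi_op_has_integral, of \<tau> \<tau> k x k y]
  by (intro has_integral_unique[OF phi_op_has_integral]) (simp_all add: blinfun.add_right scaleR_add_right)

lemma phi_op_scaleR: "0 \<le> \<tau> \<Longrightarrow> phi_op T k \<tau> (c *\<^sub>R x) = c *\<^sub>R phi_op T k \<tau> x"
  using has_integral_cmul[OF phi_op_has_integral, of \<tau> c k x]
  by (intro has_integral_unique[OF phi_op_has_integral]) (simp_all add: blinfun.scaleR_right mult.commute)

lemma phi_op_bound:
  assumes C: "\<And>t. 0 \<le> t \<Longrightarrow> t \<le> b \<Longrightarrow> norm (T t) \<le> C" and "0 \<le> \<tau>" "\<tau> \<le> b"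
  shows "norm (phi_op T k \<tau> x) \<le> C * norm x"
proof -
  show ?thesis
  proof (rule unit_interval_integral_bound[OF phi_op_has_integral[OF assms(2)]])
    fix \<theta> :: real assume th: "\<theta> \<in> {0..1}"
    have "0 \<le> (1 - \<theta>) * \<tau>" "(1 - \<theta>) * \<tau> \<le> b"
      using th assms(2,3) mult_left_le_one_le[of \<tau> "1 - \<theta>"] by auto
    then have "norm (T ((1 - \<theta>) * \<tau>) x) \<le> C * norm x"
      using T_apply_bound[OF C] by blast
    moreover have "\<bar>\<theta> ^ (k - 1) / fact (k - 1)\<bar> \<le> 1"
    proof -
      have "\<theta> ^ (k - 1) \<le> 1" using th by (intro power_le_one) auto
      also have "1 \<le> (fact (k - 1) :: real)" by (rule fact_ge_1)
      finally show ?thesis using th by (simp add: field_simps)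
    qed
    ultimately have "\<bar>\<theta> ^ (k - 1) / fact (k - 1)\<bar> * norm (T ((1 - \<theta>) * \<tau>) x) \<le> 1 * (C * norm x)"
      by (intro mult_mono) auto
    then show "norm ((\<theta> ^ (k - 1) / fact (k - 1)) *\<^sub>R T ((1 - \<theta>) * \<tau>) x) \<le> C * norm x" by simp
  qed
qed

lemma phi_op_bounded_linear:
  assumes "0 \<le> \<tau>" shows "bounded_linear (phi_op T k \<tau>)"
proof -
  obtain C where "1 \<le> C" "\<And>t. 0 \<le> t \<Longrightarrow> t \<le> \<tau> \<Longrightarrow> norm (T t) \<le> C" using T_locally_bounded by blast
  from phi_op_bound[OF this(2), of \<tau>] show ?thesis
    using assms by (intro bounded_linear_intro[of _ C]) (auto simp: phi_op_add phi_op_scaleR mult.commute)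
qed

lemma comb_op_bounded_linear:
  assumes "0 \<le> h" "\<And>w k r. (w, k, r) \<in> set p \<Longrightarrow> 0 \<le> r"
  shows "bounded_linear (comb_op T h p)"
  using assms
proof (induction p)
  case Nil
  then show ?case unfolding comb_op_def by simp
next
  case (Cons q p)
  obtain w k r where q: "q = (w, k, r)" by (cases q) auto
  have "0 \<le> r" using Cons.prems q by auto
  then have "bounded_linear (\<lambda>x. w *\<^sub>R phi_op T k (r * h) x)"
    using Cons.prems(1) by (intro bounded_linear_const_scaleR phi_op_bounded_linear) auto
  moreover have "bounded_linear (comb_op T h p)" using Cons by (intro Cons.IH) auto
  ultimately show ?case unfolding comb_op_def q
    by (simp add: bounded_linear_add)
qed

lemma comb_op_bound:
  assumes "\<And>w k r. (w, k, r) \<in> set p \<Longrightarrow> 0 \<le> r"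
  obtains C where "0 \<le> C" "\<And>h x. 0 \<le> h \<Longrightarrow> h \<le> 1 \<Longrightarrow> norm (comb_op T h p x) \<le> C * norm x"
proof -
  have "\<exists>C\<ge>0. \<forall>h x. 0 \<le> h \<longrightarrow> h \<le> 1 \<longrightarrow> norm (comb_op T h p x) \<le> C * norm x"
    using assms
  proof (induction p)
    case Nil
    then show ?case by (auto simp: comb_op_def)
  next
    case (Cons q p)
    obtain w k r where q: "q = (w, k, r)" by (cases q) auto
    have r: "0 \<le> r" using Cons.prems q by auto
    obtain C where C: "0 \<le> C" "\<And>h x. 0 \<le> h \<Longrightarrow> h \<le> 1 \<Longrightarrow> norm (comb_op T h p x) \<le> C * norm x"
      using Cons.IH Cons.prems by (metis list.set_intros(2))
    obtain E where E: "1 \<le> E" "\<And>t. 0 \<le> t \<Longrightarrow> t \<le> r \<Longrightarrow> norm (T t) \<le> E" using T_locally_bounded by blast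
    show ?case
    proof (intro exI[of _ "\<bar>w\<bar> * E + C"] conjI allI impI)
      fix h :: real and x assume h: "0 \<le> h" "h \<le> 1"
      have "r * h \<le> r" using r h by (simp add: mult_left_le)
      then have "norm (phi_op T k (r * h) x) \<le> E * norm x"
        using r h by (intro phi_op_bound[OF E(2)]) auto
      then have "\<bar>w\<bar> * norm (phi_op T k (r * h) x) \<le> \<bar>w\<bar> * (E * norm x)" by (rule mult_left_mono) simp
      then have "norm (w *\<^sub>R phi_op T k (r * h) x) \<le> \<bar>w\<bar> * E * norm x" by (simp add: mult.assoc)
      moreover have "comb_op T h (q # p) x = w *\<^sub>R phi_op T k (r * h) x + comb_op T h p x"
        by (simp add: comb_op_def q)
      ultimately show "norm (comb_op T h (q # p) x) \<le> (\<bar>w\<bar> * E + C) * norm x"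
        using C(2)[OF h, of x] norm_triangle_ineq[of "w *\<^sub>R phi_op T k (r * h) x" "comb_op T h p x"]
        by (simp add: algebra_simps)
    qed (use C E in auto)
  qed
  then show ?thesis using that by blast
qed

text \<open>
  Integrated form of "\<open>x\<close> is in the domain of the generator, which maps it to \<open>y\<close>". It only involves
  bounded operators, so it can be differentiated with respect to a parameter; this takes the place of the
  closedness of the generator.
\<close>

definition generator_graph :: "'a \<Rightarrow> 'a \<Rightarrow> bool" where
  "generator_graph x y \<longleftrightarrow> (\<forall>s\<ge>0. T s x - x = s *\<^sub>R phi_op T 1 s y)"

text \<open>
  The limit at \<open>0\<close> is a right derivative only; the left derivative at \<open>t\<close> comes from
  \<open>T b x - T a x = T a (T (b - a) x - x)\<close> with both \<open>a\<close> and \<open>b\<close> near \<open>t\<close>, and from strong continuity.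
\<close>

lemma orbit_derivative_of_limit:
  assumes lim: "((\<lambda>t. (T t x - x) /\<^sub>R t) \<longlongrightarrow> y) (at_right 0)" and t: "0 \<le> t"
  shows "((\<lambda>s. T s x) has_vector_derivative T t y) (at t within {0..})"
  unfolding has_vector_derivative_within_alt
proof (intro allI impI)
  fix e :: real assume e: "0 < e"
  obtain C where C: "1 \<le> C" "\<And>s. 0 \<le> s \<Longrightarrow> s \<le> t + 1 \<Longrightarrow> norm (T s) \<le> C" using T_locally_bounded by blast
  define \<eta> where "\<eta> = e / (2 * C)"
  have \<eta>: "\<eta> > 0" "C * \<eta> = e / 2" using e C(1) by (auto simp: \<eta>_def)
  have "\<forall>\<^sub>F s in at_right 0. dist ((T s x - x) /\<^sub>R s) y < \<eta>"
    using lim \<eta> by (intro tendstoD)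
  then obtain d1 where d1: "d1 > 0" "\<And>s. 0 < s \<Longrightarrow> s < d1 \<Longrightarrow> dist ((T s x - x) /\<^sub>R s) y < \<eta>"
    unfolding eventually_at_right_field by auto
  have d1': "norm (T s x - x - s *\<^sub>R y) \<le> \<eta> * s" if "0 \<le> s" "s < d1" for s
  proof (cases "s = 0")
    case False
    have "T s x - x - s *\<^sub>R y = s *\<^sub>R ((T s x - x) /\<^sub>R s - y)"
      using False by (simp add: scaleR_diff_right)
    then have "norm (T s x - x - s *\<^sub>R y) = s * norm ((T s x - x) /\<^sub>R s - y)"
      using that by simp
    also have "\<dots> \<le> s * \<eta>" using d1(2)[of s] that False by (intro mult_left_mono) (auto simp: dist_norm)
    finally show ?thesis by (simp add: mult.commute)
  qed (simp add: T_zero)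
  have "\<forall>e>0. \<exists>d>0. \<forall>s\<in>{0..}. dist s t < d \<longrightarrow> dist (T s y) (T t y) < e"
    using T_continuous[of y] t by (auto simp: continuous_on_iff)
  then obtain d2 where d2: "d2 > 0" "\<And>s. 0 \<le> s \<Longrightarrow> dist s t < d2 \<Longrightarrow> dist (T s y) (T t y) < e / 2"
    using half_gt_zero[OF e] by (metis atLeast_iff)
  have main: "norm (T b x - T a x - (b - a) *\<^sub>R T t y) \<le> e * (b - a)"
    if ab: "0 \<le> a" "a \<le> b" "b \<le> t + 1" "b - a < d1" "dist a t < d2" for a b
  proof -
    have "T b x = T a (T (b - a) x)" using T_add_apply[of a "b - a"] ab by simp
    then have "T b x - T a x - (b - a) *\<^sub>R T t y = T a (T (b - a) x - x - (b - a) *\<^sub>R y) + (b - a) *\<^sub>R (T a y - T t y)"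
      by (simp add: blinfun.diff_right blinfun.scaleR_right scaleR_diff_right)
    also have "norm \<dots> \<le> norm (T a (T (b - a) x - x - (b - a) *\<^sub>R y)) + norm ((b - a) *\<^sub>R (T a y - T t y))"
      by (rule norm_triangle_ineq)
    also have "\<dots> \<le> C * (\<eta> * (b - a)) + (b - a) * (e / 2)"
    proof (intro add_mono)
      have "norm (T a (T (b - a) x - x - (b - a) *\<^sub>R y)) \<le> C * norm (T (b - a) x - x - (b - a) *\<^sub>R y)"
        using ab by (intro T_apply_bound[OF C(2)]) auto
      also have "\<dots> \<le> C * (\<eta> * (b - a))" using d1' ab C(1) by (intro mult_left_mono) auto
      finally show "norm (T a (T (b - a) x - x - (b - a) *\<^sub>R y)) \<le> C * (\<eta> * (b - a))" .
      show "norm ((b - a) *\<^sub>R (T a y - T t y)) \<le> (b - a) * (e / 2)"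
      proof -
        have "norm (T a y - T t y) \<le> e / 2" using d2(2)[of a] ab by (simp add: dist_norm less_imp_le)
        from mult_left_mono[OF this, of "b - a"] show ?thesis using ab by simp
      qed
    qed
    also have "\<dots> = C * \<eta> * (b - a) + (b - a) * (e / 2)" by simp
    also have "\<dots> = e * (b - a)" unfolding \<eta>(2) by (simp add: field_simps)
    finally show ?thesis .
  qed
  show "\<forall>\<^sub>F s in at t within {0..}. norm (T s x - T t x - (s - t) *\<^sub>R T t y) \<le> e * \<bar>s - t\<bar>"
    unfolding eventually_at
  proof (intro exI[of _ "min 1 (min d1 d2)"] conjI ballI impI)
    fix s :: real assume s: "s \<in> {0..}" "s \<noteq> t \<and> dist s t < min 1 (min d1 d2)"
    show "norm (T s x - T t x - (s - t) *\<^sub>R T t y) \<le> e * \<bar>s - t\<bar>"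
    proof (cases "s \<le> t")
      case True
      have "norm (T t x - T s x - (t - s) *\<^sub>R T t y) \<le> e * (t - s)"
        using s True by (intro main) (auto simp: dist_real_def)
      moreover have "norm (T s x - T t x - (s - t) *\<^sub>R T t y) = norm (T t x - T s x - (t - s) *\<^sub>R T t y)"
        by (subst norm_minus_cancel[symmetric]) (simp add: algebra_simps)
      ultimately show ?thesis using True by simp
    next
      case False
      then show ?thesis using main[of t s] s t d2(1) by (auto simp: dist_real_def)
    qed
  qed (use d1 d2 in auto)
qed

lemma backward_orbit_derivative:
  assumes "\<And>t. 0 \<le> t \<Longrightarrow> ((\<lambda>s. T s x) has_vector_derivative T t y) (at t within {0..})"
    and "0 \<le> \<tau>" "\<theta> \<in> {0..1}"
  shows "((\<lambda>\<theta>. T ((1 - \<theta>) * \<tau>) x) has_vector_derivative - (\<tau> *\<^sub>R T ((1 - \<theta>) * \<tau>) y)) (at \<theta> within {0..1})"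
proof -
  have im: "(\<lambda>\<theta>. (1 - \<theta>) * \<tau>) ` {0..1} \<subseteq> {0..}" using assms(2) by auto
  have a: "((\<lambda>s. T s x) has_vector_derivative T ((1 - \<theta>) * \<tau>) y)
      (at ((1 - \<theta>) * \<tau>) within (\<lambda>\<theta>. (1 - \<theta>) * \<tau>) ` {0..1})"
    using assms by (intro has_vector_derivative_within_subset[OF _ im]) auto
  have b: "((\<lambda>\<theta>. (1 - \<theta>) * \<tau>) has_vector_derivative - \<tau>) (at \<theta> within {0..1})"
    by (auto intro!: derivative_eq_intros simp flip: has_real_derivative_iff_has_vector_derivative)
  show ?thesis using vector_diff_chain_within[OF b a] by (simp add: o_def)
qed

lemma generator_graph_of_limit:
  assumes lim: "((\<lambda>t. (T t x - x) /\<^sub>R t) \<longlongrightarrow> y) (at_right 0)"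
  shows "generator_graph x y"
  unfolding generator_graph_def
proof (intro allI impI)
  fix s :: real assume s: "0 \<le> s"
  have "((\<lambda>\<theta>. - (s *\<^sub>R T ((1 - \<theta>) * s) y)) has_integral T ((1 - 1) * s) x - T ((1 - 0) * s) x) {0..1}"
    using s by (intro fundamental_theorem_of_calculus backward_orbit_derivative orbit_derivative_of_limit[OF lim]) auto
  moreover have "((\<lambda>\<theta>. - (s *\<^sub>R T ((1 - \<theta>) * s) y)) has_integral - (s *\<^sub>R phi_op T 1 s y)) {0..1}"
    using has_integral_neg[OF has_integral_cmul[OF phi_op_has_integral[OF s, of 1 y], of s]] by simp
  ultimately have "T ((1 - 1) * s) x - T ((1 - 0) * s) x = - (s *\<^sub>R phi_op T 1 s y)"
    by (rule has_integral_unique)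
  then show "T s x - x = s *\<^sub>R phi_op T 1 s y" by (simp add: T_zero algebra_simps)
qed

lemma phi1_tendsto: "((\<lambda>s. phi_op T 1 s y) \<longlongrightarrow> y) (at_right 0)"
proof (rule tendstoI)
  fix e :: real assume e: "0 < e"
  have "\<forall>\<^sub>F s in at_right 0. dist (T s y) y < e / 2"
    using T_right_cont[of y] e by (intro tendstoD) auto
  then obtain d where d: "d > 0" "\<And>s. 0 < s \<Longrightarrow> s < d \<Longrightarrow> dist (T s y) y < e / 2"
    unfolding eventually_at_right_field by auto
  have d': "norm (T s y - y) \<le> e / 2" if "0 \<le> s" "s < d" for s
    using d(2)[of s] that e by (cases "s = 0") (auto simp: T_zero dist_norm less_imp_le)
  show "\<forall>\<^sub>F s in at_right 0. dist (phi_op T 1 s y) y < e"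
    unfolding eventually_at_right_field
  proof (intro exI[of _ d] conjI allI impI d(1))
    fix s :: real assume s: "0 < s" "s < d"
    have 1: "((\<lambda>\<theta>. T ((1 - \<theta>) * s) y - y) has_integral phi_op T 1 s y - y) {0..1}"
      using has_integral_diff[OF phi_op_has_integral[of s 1 y] has_integral_const_real[of y 0 1]] s by simp
    have "norm (phi_op T 1 s y - y) \<le> e / 2"
    proof (rule unit_interval_integral_bound[OF 1])
      fix \<theta> :: real assume "\<theta> \<in> {0..1}"
      then have "0 \<le> (1 - \<theta>) * s" "(1 - \<theta>) * s \<le> s"
        using s by (auto intro!: mult_left_le_one_le)
      then have "0 \<le> (1 - \<theta>) * s" "(1 - \<theta>) * s < d" using s by (simp_all only: order_le_less_trans)
      then show "norm (T ((1 - \<theta>) * s) y - y) \<le> e / 2" by (rule d')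
    qed
    then show "dist (phi_op T 1 s y) y < e" using e by (simp add: dist_norm)
  qed
qed

lemma orbit_derivative:
  assumes "generator_graph x y" "0 \<le> t"
  shows "((\<lambda>s. T s x) has_vector_derivative T t y) (at t within {0..})"
proof (rule orbit_derivative_of_limit[OF _ assms(2)])
  show "((\<lambda>t. (T t x - x) /\<^sub>R t) \<longlongrightarrow> y) (at_right 0)"
    by (rule Lim_transform_eventually[OF phi1_tendsto[of y]])
       (use assms(1) in \<open>auto simp: generator_graph_def eventually_at_right_field intro!: exI[of _ 1]\<close>)
qed

text \<open>
  \<open>\<phi>\<^sub>q(z) = 1/q! + z \<phi>\<^sub>q\<^sub>+\<^sub>1(z)\<close> at \<open>z = \<tau>A\<close>, by integration by parts.
\<close>

lemma phi_op_recursion: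
  assumes "generator_graph x y" "0 \<le> \<tau>" "1 \<le> q"
  shows "phi_op T q \<tau> x = (1 / fact q) *\<^sub>R x + \<tau> *\<^sub>R phi_op T (Suc q) \<tau> y"
proof -
  define H where "H \<theta> = (\<theta> ^ q / fact q) *\<^sub>R T ((1 - \<theta>) * \<tau>) x" for \<theta> :: real
  define H' where "H' \<theta> = (\<theta> ^ (q - 1) / fact (q - 1)) *\<^sub>R T ((1 - \<theta>) * \<tau>) x
      - \<tau> *\<^sub>R ((\<theta> ^ q / fact q) *\<^sub>R T ((1 - \<theta>) * \<tau>) y)" for \<theta> :: real
  have "(H' has_integral H 1 - H 0) {0..1}"
  proof (rule fundamental_theorem_of_calculus)
    fix \<theta> :: real assume th: "\<theta> \<in> {0..1}"
    obtain p where p: "q = Suc p" using assms(3) by (cases q) auto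
    have a: "((\<lambda>\<theta>. \<theta> ^ q / fact q) has_real_derivative \<theta> ^ (q - 1) / fact (q - 1)) (at \<theta> within {0..1})"
    proof -
      have "((\<lambda>\<theta>. \<theta> ^ Suc p / fact (Suc p)) has_real_derivative real (Suc p) * \<theta> ^ p / fact (Suc p)) (at \<theta> within {0..1})"
        by (auto intro!: derivative_eq_intros simp del: power_Suc fact_Suc)
      moreover have "real (Suc p) * \<theta> ^ p / fact (Suc p) = \<theta> ^ p / fact p" by (simp del: of_nat_Suc)
      ultimately show ?thesis by (simp add: p)
    qed
    have b: "((\<lambda>\<theta>. T ((1 - \<theta>) * \<tau>) x) has_vector_derivative - (\<tau> *\<^sub>R T ((1 - \<theta>) * \<tau>) y)) (at \<theta> within {0..1})"
      using assms th by (intro backward_orbit_derivative orbit_derivative)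
    from has_vector_derivative_scaleR[OF a b]
    show "(H has_vector_derivative H' \<theta>) (at \<theta> within {0..1})"
      unfolding H_def H'_def by (simp add: mult.commute)
  qed simp
  moreover have "(H' has_integral phi_op T q \<tau> x - \<tau> *\<^sub>R phi_op T (Suc q) \<tau> y) {0..1}"
    unfolding H'_def using phi_op_has_integral[OF assms(2), of "Suc q" y]
    by (intro has_integral_diff has_integral_cmul phi_op_has_integral[OF assms(2)]) simp
  ultimately have "H 1 - H 0 = phi_op T q \<tau> x - \<tau> *\<^sub>R phi_op T (Suc q) \<tau> y" by (rule has_integral_unique)
  then show ?thesis using assms(3) by (simp add: H_def T_zero algebra_simps)
qed

lemma generator_graph_of_generator:
  assumes "infinitesimal_generator T D A" "x \<in> D"
  shows "generator_graph x (A x)"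
  using assms by (intro generator_graph_of_limit) (auto simp: infinitesimal_generator_def)

text \<open>
  Both branches agree because \<open>z \<phi>\<^sub>1(z) = e\<^sup>z - 1\<close>. In this form the method is defined on the whole
  space and depends on the initial value only through bounded operators and \<open>g\<close>.
\<close>

lemma exp_euler_eq:
  assumes "infinitesimal_generator T D A" "0 \<le> \<tau>"
  shows "exp_euler T D A g \<tau> x = T \<tau> x + \<tau> *\<^sub>R phi_op T 1 \<tau> (g x)"
proof (cases "x \<in> D")
  case True
  then have "T \<tau> x - x = \<tau> *\<^sub>R phi_op T 1 \<tau> (A x)"
    using generator_graph_of_generator[OF assms(1)] assms(2) by (simp add: generator_graph_def)
  then show ?thesis using True assms(2)
    by (simp add: exp_euler_def phi_op_add scaleR_add_right algebra_simps)
qed (simp add: exp_euler_def)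

text \<open>
  The integrand is the derivative of \<open>\<theta> \<mapsto> T ((1 - \<theta>) h) (v \<theta>)\<close>. As \<open>T\<close> is only strongly
  differentiable, the product rule is proved by hand from three error terms.
\<close>

lemma variation_of_constants:
  assumes v: "\<And>\<theta>. \<theta> \<in> {0..1} \<Longrightarrow> (v has_vector_derivative v' \<theta>) (at \<theta> within {0..1})"
    and gr: "\<And>\<theta>. \<theta> \<in> {0..1} \<Longrightarrow> generator_graph (v \<theta>) (y \<theta>)" and h: "0 \<le> h"
  shows "((\<lambda>\<theta>. T ((1 - \<theta>) * h) (v' \<theta> - h *\<^sub>R y \<theta>)) has_integral v 1 - T h (v 0)) {0..1}"
proof -
  obtain C where C: "1 \<le> C" "\<And>s. 0 \<le> s \<Longrightarrow> s \<le> h \<Longrightarrow> norm (T s) \<le> C" using T_locally_bounded by blast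
  have "((\<lambda>\<theta>. T ((1 - \<theta>) * h) (v \<theta>)) has_vector_derivative T ((1 - \<theta>) * h) (v' \<theta> - h *\<^sub>R y \<theta>)) (at \<theta> within {0..1})"
    if th: "\<theta> \<in> {0..1}" for \<theta>
    unfolding has_vector_derivative_within_alt
  proof (intro allI impI)
    fix e :: real assume e: "0 < e"
    define \<eta> where "\<eta> = e / (3 * C)"
    have \<eta>: "\<eta> > 0" "C * \<eta> = e / 3" using e C(1) by (auto simp: \<eta>_def)
    have e3: "e / 3 > 0" using e by simp
    have ev1: "\<forall>\<^sub>F s in at \<theta> within {0..1}. norm (v s - v \<theta> - (s - \<theta>) *\<^sub>R v' \<theta>) \<le> \<eta> * \<bar>s - \<theta>\<bar>"
      using v[OF th] \<eta>(1) unfolding has_vector_derivative_within_alt by blast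
    have "((\<lambda>s. T ((1 - s) * h) (v \<theta>)) has_vector_derivative - (h *\<^sub>R T ((1 - \<theta>) * h) (y \<theta>))) (at \<theta> within {0..1})"
      using gr[OF th] h th by (intro backward_orbit_derivative orbit_derivative)
    then have ev2: "\<forall>\<^sub>F s in at \<theta> within {0..1}. norm (T ((1 - s) * h) (v \<theta>) - T ((1 - \<theta>) * h) (v \<theta>)
        - (s - \<theta>) *\<^sub>R (- (h *\<^sub>R T ((1 - \<theta>) * h) (y \<theta>)))) \<le> (e / 3) * \<bar>s - \<theta>\<bar>"
      using e3 unfolding has_vector_derivative_within_alt by blast
    have "((\<lambda>s. T ((1 - s) * h) (v' \<theta>)) \<longlongrightarrow> T ((1 - \<theta>) * h) (v' \<theta>)) (at \<theta> within {0..1})"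
      using T_continuous_backward[OF h] th by (auto simp: continuous_on_def)
    then have ev3: "\<forall>\<^sub>F s in at \<theta> within {0..1}. dist (T ((1 - s) * h) (v' \<theta>)) (T ((1 - \<theta>) * h) (v' \<theta>)) < e / 3"
      using e3 by (rule tendstoD)
    have ev4: "\<forall>\<^sub>F s in at \<theta> within {0..1}. s \<in> {0..1}" by (simp add: eventually_at_filter)
    show "\<forall>\<^sub>F s in at \<theta> within {0..1}. norm (T ((1 - s) * h) (v s) - T ((1 - \<theta>) * h) (v \<theta>)
        - (s - \<theta>) *\<^sub>R T ((1 - \<theta>) * h) (v' \<theta> - h *\<^sub>R y \<theta>)) \<le> e * \<bar>s - \<theta>\<bar>"
      using ev1 ev2 ev3 ev4
    proof eventually_elim
      case (elim s)
      define a where "a = T ((1 - s) * h) (v s - v \<theta> - (s - \<theta>) *\<^sub>R v' \<theta>)"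
      define b where "b = T ((1 - s) * h) (v \<theta>) - T ((1 - \<theta>) * h) (v \<theta>)
        - (s - \<theta>) *\<^sub>R (- (h *\<^sub>R T ((1 - \<theta>) * h) (y \<theta>)))"
      define c where "c = (s - \<theta>) *\<^sub>R (T ((1 - s) * h) (v' \<theta>) - T ((1 - \<theta>) * h) (v' \<theta>))"
      have "T ((1 - s) * h) (v s) - T ((1 - \<theta>) * h) (v \<theta>)
        - (s - \<theta>) *\<^sub>R T ((1 - \<theta>) * h) (v' \<theta> - h *\<^sub>R y \<theta>) = a + b + c"
        by (simp add: a_def b_def c_def blinfun.diff_right blinfun.scaleR_right scaleR_diff_right)
      moreover have "norm a \<le> e / 3 * \<bar>s - \<theta>\<bar>"
      proof -
        have "(1 - s) * h \<le> h" "0 \<le> (1 - s) * h" using elim(4) h mult_left_le_one_le[of h "1 - s"] by auto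
        then have "norm a \<le> C * norm (v s - v \<theta> - (s - \<theta>) *\<^sub>R v' \<theta>)"
          unfolding a_def by (intro T_apply_bound[OF C(2)])
        also have "\<dots> \<le> C * (\<eta> * \<bar>s - \<theta>\<bar>)" using elim(1) C(1) by (intro mult_left_mono) auto
        also have "\<dots> = (C * \<eta>) * \<bar>s - \<theta>\<bar>" by simp
        finally show ?thesis unfolding \<eta>(2) .
      qed
      moreover have "norm b \<le> e / 3 * \<bar>s - \<theta>\<bar>" using elim(2) by (simp add: b_def)
      moreover have "norm c \<le> e / 3 * \<bar>s - \<theta>\<bar>"
      proof -
        have "norm (T ((1 - s) * h) (v' \<theta>) - T ((1 - \<theta>) * h) (v' \<theta>)) \<le> e / 3"
          using elim(3) by (simp add: dist_norm less_imp_le)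
        from mult_left_mono[OF this, of "\<bar>s - \<theta>\<bar>"] show ?thesis by (simp add: c_def mult.commute)
      qed
      ultimately show ?case
        using norm_triangle_ineq[of "a + b" c] norm_triangle_ineq[of a b] by simp
    qed
  qed
  from fundamental_theorem_of_calculus[OF _ this]
  show ?thesis by (simp add: T_zero)
qed

end

section \<open>Smoothing of analytic semigroups\<close>

text \<open>
  The Cauchy estimate for functions with values in a Banach space, where multiplication by \<open>\<i>\<close> is the
  operator \<open>\<iota>\<close>. With \<open>G(s)\<close> the integral of \<open>e\<^sup>-\<^sup>i\<^sup>\<theta> f(c + s e\<^sup>i\<^sup>\<theta>)\<close> over a period and \<open>H(s)\<close> that of
  \<open>f'(c + s e\<^sup>i\<^sup>\<theta>)\<close>, differentiation in \<open>s\<close> gives \<open>G' = H\<close>, and the vanishing integral of a \<open>\<theta>\<close>-derivative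
  gives \<open>G(s) = s H(s)\<close>. Hence \<open>G\<close> is linear in \<open>s\<close>, and \<open>G(\<rho>) = 2\<pi>\<rho> f'(c)\<close> carries the bound.
\<close>

lemma cauchy_derivative_estimate:
  fixes f :: "complex \<Rightarrow> 'b::banach" and \<iota> :: "'b \<Rightarrow> 'b"
  assumes \<iota>: "bounded_linear \<iota>" "\<And>x. \<iota> (\<iota> x) = - x" and \<rho>: "0 < \<rho>"
    and der: "\<And>z. z \<in> cball c \<rho> \<Longrightarrow> (f has_derivative (\<lambda>w. Re w *\<^sub>R D z + Im w *\<^sub>R \<iota> (D z))) (at z)"
    and contD: "continuous_on (cball c \<rho>) D"
    and bd: "\<And>z. z \<in> cball c \<rho> \<Longrightarrow> norm (f z) \<le> K"
  shows "norm (D c) \<le> (1 + onorm \<iota>) * K / \<rho>"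
proof -
  interpret \<iota>: bounded_linear \<iota> by fact
  define rot where "rot \<theta> x = cos \<theta> *\<^sub>R x - sin \<theta> *\<^sub>R \<iota> x" for \<theta> x
  define pt where "pt s \<theta> = c + of_real s * cis \<theta>" for s \<theta>
  have pt_in: "pt s \<theta> \<in> cball c \<rho>" if "s \<in> {0..\<rho>}" for s \<theta>
    using that by (simp add: pt_def dist_norm norm_mult)
  have contf: "continuous_on (cball c \<rho>) f"
    using der by (meson continuous_at_imp_continuous_on has_derivative_continuous)
  have cont_pt: "continuous_on X (\<lambda>p. pt (a p) (b p))" if "continuous_on X a" "continuous_on X b"
    for X :: "'z::topological_space set" and a b
    unfolding pt_def cis_conv_exp using that by (intro continuous_intros)
  define G where "G s = integral (cbox 0 (2 * pi)) (\<lambda>\<theta>. rot \<theta> (f (pt s \<theta>)))" for s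
  define H where "H s = integral (cbox 0 (2 * pi)) (\<lambda>\<theta>. D (pt s \<theta>))" for s
  have rotf_cont: "continuous_on (cbox 0 (2 * pi)) (\<lambda>\<theta>. rot \<theta> (f (pt s \<theta>)))" if "s \<in> {0..\<rho>}" for s
    unfolding rot_def
    by (intro continuous_intros \<iota>.continuous_on continuous_on_compose2[OF contf] cont_pt) (use pt_in that in auto)
  have D_cont: "continuous_on (cbox 0 (2 * pi)) (\<lambda>\<theta>. D (pt s \<theta>))" if "s \<in> {0..\<rho>}" for s
    by (intro continuous_on_compose2[OF contD] cont_pt continuous_intros) (use pt_in that in auto)
  have G_int: "((\<lambda>\<theta>. rot \<theta> (f (pt s \<theta>))) has_integral G s) (cbox 0 (2 * pi))"
    and H_int: "((\<lambda>\<theta>. D (pt s \<theta>)) has_integral H s) (cbox 0 (2 * pi))" if "s \<in> {0..\<rho>}" for s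
    unfolding G_def H_def using rotf_cont[OF that] D_cont[OF that] integrable_continuous by blast+
  \<comment> \<open>Differentiation under the integral, where \<open>e\<^sup>-\<^sup>i\<^sup>\<theta>\<close> cancels the direction \<open>e\<^sup>i\<^sup>\<theta>\<close> of the radius.\<close>
  have radial: "(G has_vector_derivative H s) (at s within {0..\<rho>})" if s: "s \<in> {0..\<rho>}" for s
    unfolding G_def H_def
  proof (rule leibniz_rule_vector_derivative)
    fix s \<theta> :: real assume s: "s \<in> {0..\<rho>}"
    have "((\<lambda>s. pt s \<theta>) has_derivative (\<lambda>h. of_real h * cis \<theta>)) (at s within {0..\<rho>})"
      unfolding pt_def by (auto intro!: derivative_eq_intros)
    from has_derivative_compose[OF this der[OF pt_in[OF s]]]
    have "((\<lambda>s. f (pt s \<theta>)) has_vector_derivative cos \<theta> *\<^sub>R D (pt s \<theta>) + sin \<theta> *\<^sub>R \<iota> (D (pt s \<theta>))) (at s within {0..\<rho>})"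
      by (simp add: has_vector_derivative_def scaleR_add_right)
    moreover have "bounded_linear (rot \<theta>)"
      unfolding rot_def by (intro bounded_linear_sub bounded_linear_const_scaleR bounded_linear_ident \<iota>(1))
    ultimately have "((\<lambda>s. rot \<theta> (f (pt s \<theta>))) has_vector_derivative
        rot \<theta> (cos \<theta> *\<^sub>R D (pt s \<theta>) + sin \<theta> *\<^sub>R \<iota> (D (pt s \<theta>)))) (at s within {0..\<rho>})"
      by (rule bounded_linear.has_vector_derivative[rotated])
    moreover have "rot \<theta> (cos \<theta> *\<^sub>R x + sin \<theta> *\<^sub>R \<iota> x) = x" for x
    proof -
      have "rot \<theta> (cos \<theta> *\<^sub>R x + sin \<theta> *\<^sub>R \<iota> x) = (cos \<theta> * cos \<theta>) *\<^sub>R x + (sin \<theta> * sin \<theta>) *\<^sub>R x"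
        by (simp add: rot_def \<iota>.add \<iota>.scaleR \<iota>(2) algebra_simps)
      also have "\<dots> = (cos \<theta> * cos \<theta> + sin \<theta> * sin \<theta>) *\<^sub>R x"
        by (simp only: scaleR_left_distrib)
      also have "\<dots> = x" by (simp only: sin_cos_squared_add3 scaleR_one)
      finally show ?thesis .
    qed
    ultimately show "((\<lambda>s. rot \<theta> (f (pt s \<theta>))) has_vector_derivative D (pt s \<theta>)) (at s within {0..\<rho>})" by simp
  next
    show "continuous_on ({0..\<rho>} \<times> cbox 0 (2 * pi)) (\<lambda>(s, \<theta>). D (pt s \<theta>))"
      unfolding split_beta
      by (intro continuous_on_compose2[OF contD] cont_pt continuous_intros) (use pt_in in auto)
  qed (use s G_int in auto)
  \<comment> \<open>The integral of the \<open>\<theta>\<close>-derivative of \<open>e\<^sup>-\<^sup>i\<^sup>\<theta> f(c + s e\<^sup>i\<^sup>\<theta>)\<close> over a period vanishes.\<close>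
  have angular: "G s = s *\<^sub>R H s" if s: "s \<in> {0..\<rho>}" for s
  proof -
    have "((\<lambda>\<theta>. \<iota> (s *\<^sub>R D (pt s \<theta>) - rot \<theta> (f (pt s \<theta>)))) has_integral
        rot (2 * pi) (f (pt s (2 * pi))) - rot 0 (f (pt s 0))) {0..2 * pi}"
    proof (rule fundamental_theorem_of_calculus)
      fix \<theta> :: real assume "\<theta> \<in> {0..2 * pi}"
      have "((\<lambda>\<theta>. pt s \<theta>) has_derivative (\<lambda>h. of_real s * (h *\<^sub>R (\<i> * cis \<theta>)))) (at \<theta> within {0..2*pi})"
        unfolding pt_def by (auto intro!: derivative_eq_intros)
      from has_derivative_compose[OF this der[OF pt_in[OF s]]]
      have f': "((\<lambda>\<theta>. f (pt s \<theta>)) has_vector_derivative s *\<^sub>R (- sin \<theta> *\<^sub>R D (pt s \<theta>) + cos \<theta> *\<^sub>R \<iota> (D (pt s \<theta>)))) (at \<theta> within {0..2*pi})"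
        by (simp add: has_vector_derivative_def algebra_simps)
      have \<iota>_tangent: "\<iota> (s *\<^sub>R (- sin \<theta> *\<^sub>R d + cos \<theta> *\<^sub>R \<iota> d)) = s *\<^sub>R (- sin \<theta> *\<^sub>R \<iota> d - cos \<theta> *\<^sub>R d)" for d
        by (simp add: \<iota>.add \<iota>.diff \<iota>.scaleR \<iota>.neg \<iota>(2))
      from \<iota>.has_vector_derivative[OF f']
      have \<iota>f': "((\<lambda>\<theta>. \<iota> (f (pt s \<theta>))) has_vector_derivative s *\<^sub>R (- sin \<theta> *\<^sub>R \<iota> (D (pt s \<theta>)) - cos \<theta> *\<^sub>R D (pt s \<theta>))) (at \<theta> within {0..2*pi})"
        unfolding \<iota>_tangent .
      have c': "(cos has_real_derivative - sin \<theta>) (at \<theta> within {0..2*pi})"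
        and s': "(sin has_real_derivative cos \<theta>) (at \<theta> within {0..2*pi})"
        by (auto intro!: derivative_eq_intros)
      have "((\<lambda>\<theta>. rot \<theta> (f (pt s \<theta>))) has_vector_derivative
        (cos \<theta> *\<^sub>R (s *\<^sub>R (- sin \<theta> *\<^sub>R D (pt s \<theta>) + cos \<theta> *\<^sub>R \<iota> (D (pt s \<theta>)))) + (- sin \<theta>) *\<^sub>R f (pt s \<theta>))
        - (sin \<theta> *\<^sub>R (s *\<^sub>R (- sin \<theta> *\<^sub>R \<iota> (D (pt s \<theta>)) - cos \<theta> *\<^sub>R D (pt s \<theta>))) + cos \<theta> *\<^sub>R \<iota> (f (pt s \<theta>)))) (at \<theta> within {0..2*pi})"
        unfolding rot_def
        by (intro has_vector_derivative_diff has_vector_derivative_scaleR c' s' f' \<iota>f')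
      moreover have "(cos \<theta> *\<^sub>R (s *\<^sub>R (- sin \<theta> *\<^sub>R d + cos \<theta> *\<^sub>R \<iota> d)) + (- sin \<theta>) *\<^sub>R x)
        - (sin \<theta> *\<^sub>R (s *\<^sub>R (- sin \<theta> *\<^sub>R \<iota> d - cos \<theta> *\<^sub>R d)) + cos \<theta> *\<^sub>R \<iota> x) = \<iota> (s *\<^sub>R d - rot \<theta> x)" for d x
      proof -
        have "(cos \<theta> *\<^sub>R (s *\<^sub>R (- sin \<theta> *\<^sub>R d + cos \<theta> *\<^sub>R \<iota> d)) + (- sin \<theta>) *\<^sub>R x)
          - (sin \<theta> *\<^sub>R (s *\<^sub>R (- sin \<theta> *\<^sub>R \<iota> d - cos \<theta> *\<^sub>R d)) + cos \<theta> *\<^sub>R \<iota> x)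
          = (s * (cos \<theta> * cos \<theta>)) *\<^sub>R \<iota> d + (s * (sin \<theta> * sin \<theta>)) *\<^sub>R \<iota> d - (cos \<theta> *\<^sub>R \<iota> x + sin \<theta> *\<^sub>R x)"
          by (simp add: algebra_simps)
        also have "\<dots> = (s * (cos \<theta> * cos \<theta> + sin \<theta> * sin \<theta>)) *\<^sub>R \<iota> d - (cos \<theta> *\<^sub>R \<iota> x + sin \<theta> *\<^sub>R x)"
          by (simp only: distrib_left scaleR_left_distrib)
        also have "\<dots> = s *\<^sub>R \<iota> d - (cos \<theta> *\<^sub>R \<iota> x + sin \<theta> *\<^sub>R x)"
          by (simp only: sin_cos_squared_add3 mult_1_right)
        also have "\<dots> = \<iota> (s *\<^sub>R d - rot \<theta> x)" by (simp add: rot_def \<iota>.diff \<iota>.scaleR \<iota>(2))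
        finally show ?thesis .
      qed
      ultimately show "((\<lambda>\<theta>. rot \<theta> (f (pt s \<theta>))) has_vector_derivative \<iota> (s *\<^sub>R D (pt s \<theta>) - rot \<theta> (f (pt s \<theta>)))) (at \<theta> within {0..2*pi})"
        by simp
    qed simp
    moreover have "rot (2 * pi) (f (pt s (2 * pi))) - rot 0 (f (pt s 0)) = 0"
      by (simp add: rot_def pt_def)
    moreover have "((\<lambda>\<theta>. \<iota> (s *\<^sub>R D (pt s \<theta>) - rot \<theta> (f (pt s \<theta>)))) has_integral \<iota> (s *\<^sub>R H s - G s)) {0..2 * pi}"
      using has_integral_linear[OF has_integral_diff[OF has_integral_cmul[OF H_int[OF s], of s] G_int[OF s]] \<iota>(1)]
      by (simp add: o_def)
    ultimately have "\<iota> (s *\<^sub>R H s - G s) = 0" using has_integral_unique by metis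
    then have "\<iota> (\<iota> (s *\<^sub>R H s - G s)) = 0" by (simp add: \<iota>.zero)
    then show ?thesis by (simp add: \<iota>(2))
  qed
  \<comment> \<open>\<open>G(s)/s\<close> is constant; its value is the derivative of \<open>G\<close> at \<open>0\<close>.\<close>
  have "\<exists>E. \<forall>s\<in>{0<..\<rho>}. inverse s *\<^sub>R G s = E"
  proof (rule has_derivative_zero_constant)
    fix s :: real assume s: "s \<in> {0<..\<rho>}"
    have 1: "(G has_vector_derivative H s) (at s within {0<..\<rho>})"
      using s by (intro has_vector_derivative_within_subset[OF radial]) auto
    have 2: "(inverse has_real_derivative - (inverse s * inverse s)) (at s within {0<..\<rho>})"
      using s by (auto intro!: derivative_eq_intros)
    have "((\<lambda>s. inverse s *\<^sub>R G s) has_vector_derivative inverse s *\<^sub>R H s + (- (inverse s * inverse s)) *\<^sub>R G s) (at s within {0<..\<rho>})"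
      by (rule has_vector_derivative_scaleR[OF 2 1])
    moreover have "inverse s *\<^sub>R H s + (- (inverse s * inverse s)) *\<^sub>R G s = 0"
      using s angular[of s] by simp
    ultimately show "((\<lambda>s. inverse s *\<^sub>R G s) has_derivative (\<lambda>h. 0)) (at s within {0<..\<rho>})"
      by (simp add: has_vector_derivative_def)
  qed simp
  then obtain E where E: "\<And>s. s \<in> {0<..\<rho>} \<Longrightarrow> inverse s *\<^sub>R G s = E" by blast
  have GE: "G s = s *\<^sub>R E" if "s \<in> {0..\<rho>}" for s
    using E[of s] angular[of s] that by (cases "s = 0") auto
  have "((\<lambda>s. s *\<^sub>R E) has_vector_derivative E) (at 0 within {0..\<rho>})"
    by (auto intro!: derivative_eq_intros simp: has_vector_derivative_def)
  then have "(G has_vector_derivative E) (at 0 within {0..\<rho>})"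
    by (rule has_vector_derivative_transform[rotated 2]) (use \<rho> GE in auto)
  then have "E = H 0"
    using radial[of 0] \<rho> vector_derivative_unique_within_closed_interval[of 0 \<rho> 0 G E "H 0"] by auto
  also have "H 0 = (2 * pi) *\<^sub>R D c"
    using H_int[of 0] \<rho> has_integral_unique[OF _ has_integral_const[of "D c" 0 "2 * pi"]] by (simp add: pt_def)
  finally have E2: "E = (2 * pi) *\<^sub>R D c" .
  have "norm (G \<rho>) \<le> ((1 + onorm \<iota>) * K) * measure lborel (cbox 0 (2 * pi))"
  proof (rule has_integral_bound[OF _ G_int])
    have "0 \<le> K" using bd[of c] \<rho> norm_ge_zero order_trans by (metis centre_in_cball less_imp_le)
    then show "0 \<le> (1 + onorm \<iota>) * K" using onorm_pos_le[OF \<iota>(1)] by simp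
    fix \<theta> :: real
    let ?x = "f (pt \<rho> \<theta>)"
    have "norm (rot \<theta> ?x) \<le> \<bar>cos \<theta>\<bar> * norm ?x + \<bar>sin \<theta>\<bar> * norm (\<iota> ?x)"
      unfolding rot_def using norm_triangle_ineq4[of "cos \<theta> *\<^sub>R ?x" "sin \<theta> *\<^sub>R \<iota> ?x"] by simp
    also have "\<dots> \<le> 1 * norm ?x + 1 * (onorm \<iota> * norm ?x)"
      using onorm[OF \<iota>(1), of ?x] by (intro add_mono mult_mono) auto
    also have "\<dots> = (1 + onorm \<iota>) * norm ?x" by (simp add: algebra_simps)
    also have "\<dots> \<le> (1 + onorm \<iota>) * K"
      using bd[OF pt_in[of \<rho> \<theta>]] \<rho> onorm_pos_le[OF \<iota>(1)] by (intro mult_left_mono) auto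
    finally show "norm (rot \<theta> ?x) \<le> (1 + onorm \<iota>) * K" .
  qed (use \<rho> in auto)
  then have "(2 * pi) * (norm (D c) * \<rho>) \<le> (2 * pi) * ((1 + onorm \<iota>) * K)"
    using GE[of \<rho>] \<rho> E2 by (simp add: mult_ac)
  then have "norm (D c) * \<rho> \<le> (1 + onorm \<iota>) * K" by simp
  then show ?thesis using \<rho> by (simp add: field_simps)
qed

text \<open>
  A disc of radius proportional to \<open>t\<close> around \<open>t\<close> lies in the sector, where the extension is bounded near
  \<open>0\<close>; the Cauchy estimate on it yields the factor \<open>1/t\<close>. The continuity of the derivative that the estimate
  asks for comes from \<open>S'(z) = S'(t/2) S(z - t/2)\<close>.
\<close>

lemma sector_smoothing:
  fixes \<iota> :: "'b::banach \<Rightarrow> 'b"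
  assumes \<iota>: "bounded_linear \<iota>" "\<And>x. \<iota> (\<iota> x) = - x" and ext: "extends_to_sector \<iota> E"
  obtains \<delta> C V where "0 < \<delta>"
    "\<And>t x. 0 < t \<Longrightarrow> t < \<delta> \<Longrightarrow> ((\<lambda>s. E s x) has_vector_derivative V t x) (at t)"
    "\<And>t x. 0 < t \<Longrightarrow> t < \<delta> \<Longrightarrow> norm (V t x) \<le> C / t * norm x"
proof -
  obtain \<alpha> and S :: "complex \<Rightarrow> 'b \<Rightarrow>\<^sub>L 'b" where body: "0 < \<alpha> \<and> \<alpha> \<le> pi / 2 \<and>
        (\<forall>t\<ge>0. \<forall>x. blinfun_apply (S (of_real t)) x = E t x) \<and>
        (\<forall>z\<in>open_sector \<alpha>. \<forall>x. blinfun_apply (S z) (\<iota> x) = \<iota> (blinfun_apply (S z) x)) \<and>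
        (\<forall>z\<in>open_sector \<alpha>. \<forall>w\<in>open_sector \<alpha>. S (z + w) = S z o\<^sub>L S w) \<and>
        (\<forall>z\<in>open_sector \<alpha>. \<exists>S' :: complex \<Rightarrow> 'b \<Rightarrow>\<^sub>L 'b. (S has_derivative S') (at z) \<and>
            (\<forall>w x. blinfun_apply (S' (\<i> * w)) x = \<iota> (blinfun_apply (S' w) x))) \<and>
        (\<forall>x. ((\<lambda>z. blinfun_apply (S z) x) \<longlongrightarrow> x) (at 0 within open_sector \<alpha>))"
    using ext unfolding extends_to_sector_def by (elim exE) (rule that)
  note \<alpha> = conjunct1[OF body]
  note body = conjunct2[OF conjunct2[OF body]]
  note SE = conjunct1[OF body, rule_format]
  note body = conjunct2[OF conjunct2[OF body]]
  note Sadd = conjunct1[OF body, rule_format]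
  note Sder = conjunct1[OF conjunct2[OF body]]
  note Slim = conjunct2[OF conjunct2[OF body], rule_format]
  obtain S' where S': "\<And>z. z \<in> open_sector \<alpha> \<Longrightarrow> (S has_derivative S' z) (at z)"
    "\<And>z w x. z \<in> open_sector \<alpha> \<Longrightarrow> S' z (\<i> * w) x = \<iota> (S' z w x)"
    using bchoice[OF Sder] by blast
  define D where "D z = S' z 1" for z
  have der: "((\<lambda>z. S z x) has_derivative (\<lambda>w. Re w *\<^sub>R D z x + Im w *\<^sub>R \<iota> (D z x))) (at z)"
    if z: "z \<in> open_sector \<alpha>" for z x
  proof -
    interpret bounded_linear "S' z" using S'(1)[OF z] by (rule has_derivative_bounded_linear)
    have "((\<lambda>z. S z x) has_derivative (\<lambda>w. S' z w x)) (at z)"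
      by (rule bounded_linear.has_derivative[OF blinfun.bounded_linear_left S'(1)[OF z]])
    moreover have "S' z w x = Re w *\<^sub>R D z x + Im w *\<^sub>R \<iota> (D z x)" for w
    proof -
      have "w = Re w *\<^sub>R 1 + Im w *\<^sub>R (\<i> * 1)" by (simp add: complex_eq_iff)
      then have "S' z w = S' z (Re w *\<^sub>R 1 + Im w *\<^sub>R (\<i> * 1))" by (rule arg_cong)
      also have "\<dots> = Re w *\<^sub>R S' z 1 + Im w *\<^sub>R S' z (\<i> * 1)" by (simp only: add scaleR)
      finally have "S' z w = Re w *\<^sub>R S' z 1 + Im w *\<^sub>R S' z (\<i> * 1)" .
      then show ?thesis using S'(2)[OF z, of 1 x] by (simp add: D_def blinfun.add_left blinfun.scaleR_left)
    qed
    ultimately show ?thesis by simp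
  qed
  have real_der: "((\<lambda>s. S (of_real s + w) x) has_vector_derivative D (of_real t + w) x) (at t)"
    if "of_real t + w \<in> open_sector \<alpha>" for t :: real and w x
  proof -
    have "((\<lambda>s. of_real s + w) has_derivative (\<lambda>h. of_real h)) (at t)"
      by (auto intro!: derivative_eq_intros)
    from has_derivative_compose[OF this der[OF that]] show ?thesis
      by (simp add: has_vector_derivative_def)
  qed
  have pos_in: "of_real t \<in> open_sector \<alpha>" if "t > 0" for t :: real
    using that \<alpha> by (simp add: open_sector_def Arg_of_real)
  \<comment> \<open>The half-opening of the sector determines \<open>\<kappa>\<close>; scaling by \<open>\<tau>\<close> does not change arguments.\<close>
  obtain \<kappa> where \<kappa>: "0 < \<kappa>" "\<kappa> < 1" "\<And>\<tau> z. 0 < \<tau> \<Longrightarrow> norm (z - of_real \<tau>) \<le> \<kappa> * \<tau> \<Longrightarrow> z \<in> open_sector \<alpha>"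
  proof -
    have "isCont Arg 1" by (intro continuous_at_Arg) auto
    then have "\<exists>d>0. \<forall>z. dist z 1 < d \<longrightarrow> dist (Arg z) (Arg 1) < \<alpha>"
      using \<alpha> unfolding continuous_at_eps_delta by blast
    then obtain d where d: "d > 0" "\<And>z. dist z 1 < d \<Longrightarrow> \<bar>Arg z\<bar> < \<alpha>" by (auto simp: dist_real_def)
    show ?thesis
    proof (rule that[of "min d 1 / 2"])
      fix \<tau> :: real and z :: complex assume \<tau>: "0 < \<tau>" "norm (z - of_real \<tau>) \<le> min d 1 / 2 * \<tau>"
      have "z / of_real \<tau> - 1 = (z - of_real \<tau>) / of_real \<tau>" using \<tau>(1) by (simp add: field_simps)
      then have "norm (z / of_real \<tau> - 1) = norm (z - of_real \<tau>) / \<tau>"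
        using \<tau>(1) by (simp add: norm_divide)
      also have "\<dots> \<le> min d 1 / 2" using \<tau> by (simp only: pos_divide_le_eq)
      finally have *: "norm (z / of_real \<tau> - 1) \<le> min d 1 / 2" .
      then have "\<bar>Arg (z / of_real \<tau>)\<bar> < \<alpha>" using d(1) by (intro d(2)) (auto simp: dist_norm)
      moreover have "Arg (z / of_real \<tau>) = Arg z" using \<tau>(1) by simp
      moreover have "z \<noteq> 0" using * by auto
      ultimately show "z \<in> open_sector \<alpha>" by (simp add: open_sector_def)
    qed (use d in auto)
  qed
  obtain \<delta> C where \<delta>: "\<delta> > 0" "\<And>z. z \<in> open_sector \<alpha> \<Longrightarrow> z \<noteq> 0 \<Longrightarrow> norm z < \<delta> \<Longrightarrow> norm (S z) \<le> C"
    using norm_bounded_near_zero[of S "\<lambda>x. x" "open_sector \<alpha>", OF Slim] by blast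
  show ?thesis
  proof (rule that[of "\<delta> / 2" "\<lambda>t. D (of_real t)" "(1 + onorm \<iota>) * C / (\<kappa> / 2)"])
    fix t :: real and x assume t: "0 < t" "t < \<delta> / 2"
    show "((\<lambda>s. E s x) has_vector_derivative D (of_real t) x) (at t)"
    proof (rule has_vector_derivative_transform_within_open)
      show "((\<lambda>s. S (of_real s) x) has_vector_derivative D (of_real t) x) (at t)"
        using real_der[of t 0 x] pos_in[OF t(1)] by simp
      show "open {0::real<..}" by simp
    qed (use t SE in auto)
    \<comment> \<open>With half of the admissible radius, \<open>z - t/2\<close> also stays in the sector for \<open>z\<close> in the disc.\<close>
    define \<rho> where "\<rho> = \<kappa> / 2 * t"
    have \<rho>: "0 < \<rho>" using \<kappa> t by (simp add: \<rho>_def)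
    have in1: "z \<in> open_sector \<alpha>" and in2: "z - of_real (t / 2) \<in> open_sector \<alpha>"
      if "z \<in> cball (of_real t) \<rho>" for z
    proof -
      have n: "norm (z - of_real t) \<le> \<kappa> / 2 * t" using that by (simp add: \<rho>_def dist_norm norm_minus_commute)
      also have "\<dots> \<le> \<kappa> * t" using \<kappa> t by simp
      finally show "z \<in> open_sector \<alpha>" using t by (intro \<kappa>(3))
      have "complex_of_real t = of_real (t / 2) + of_real (t / 2)" by (simp only: of_real_add[symmetric]) simp
      then have eq: "z - of_real (t / 2) - of_real (t / 2) = z - of_real t" by (simp only: diff_diff_eq)
      show "z - of_real (t / 2) \<in> open_sector \<alpha>"
      proof (rule \<kappa>(3))
        show "norm (z - of_real (t / 2) - of_real (t / 2)) \<le> \<kappa> * (t / 2)" unfolding eq using n by simp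
      qed (use t in simp)
    qed
    have Dshift: "D z x = D (of_real (t / 2)) (S (z - of_real (t / 2)) x)" if z: "z \<in> cball (of_real t) \<rho>" for z
    proof -
      define w where "w = z - of_real (t / 2)"
      have z': "of_real (t / 2) + w = z" by (simp add: w_def)
      have 1: "((\<lambda>s. S (of_real s + w) x) has_vector_derivative D z x) (at (t / 2))"
        using real_der[of "t / 2" w x] in1[OF z] unfolding z' by blast
      have 2: "((\<lambda>s. S (of_real s) (S w x)) has_vector_derivative D (of_real (t / 2)) (S w x)) (at (t / 2))"
        using real_der[of "t / 2" 0 "S w x"] pos_in[of "t / 2"] t by simp
      have "((\<lambda>s. S (of_real s + w) x) has_vector_derivative D (of_real (t / 2)) (S w x)) (at (t / 2))"
      proof (rule has_vector_derivative_transform_within_open[OF 2])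
        show "open {0::real<..}" by simp
        show "S (of_real s) (S w x) = S (of_real s + w) x" if "s \<in> {0<..}" for s
          using Sadd[OF pos_in[of s] in2[OF z]] that by (simp add: w_def)
      qed (use t in simp)
      from vector_derivative_unique_at[OF 1 this] show ?thesis by (simp add: w_def)
    qed
    have "norm (D (of_real t) x) \<le> (1 + onorm \<iota>) * (C * norm x) / \<rho>"
    proof (rule cauchy_derivative_estimate[OF \<iota> \<rho>, of "of_real t" "\<lambda>z. S z x" "\<lambda>z. D z x"])
      have "continuous_on (open_sector \<alpha>) (\<lambda>z. S z x)"
        using der by (meson continuous_at_imp_continuous_on has_derivative_continuous)
      then have "continuous_on (cball (of_real t) \<rho>) (\<lambda>z. D (of_real (t / 2)) (S (z - of_real (t / 2)) x))"
      proof -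
        assume c: "continuous_on (open_sector \<alpha>) (\<lambda>z. S z x)"
        have "continuous_on (cball (of_real t) \<rho>) (\<lambda>z. S (z - of_real (t / 2)) x)"
          by (rule continuous_on_compose2[OF c]) (use in2 in \<open>auto intro!: continuous_intros\<close>)
        then show ?thesis by (rule bounded_linear.continuous_on[OF blinfun.bounded_linear_right])
      qed
      then show "continuous_on (cball (of_real t) \<rho>) (\<lambda>z. D z x)"
        by (rule continuous_on_eq) (use Dshift in auto)
      fix z assume z: "z \<in> cball (complex_of_real t) \<rho>"
      show "((\<lambda>z. S z x) has_derivative (\<lambda>w. Re w *\<^sub>R D z x + Im w *\<^sub>R \<iota> (D z x))) (at z)"
        by (intro der in1 z)
      have "norm z \<le> norm (of_real t :: complex) + norm (z - of_real t)"
        using norm_triangle_ineq[of "of_real t" "z - of_real t"] by simp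
      also have "\<dots> \<le> t + \<kappa> / 2 * t" using z t by (simp add: \<rho>_def dist_norm norm_minus_commute)
      also have "\<dots> \<le> t + 1 * t" using \<kappa> t by (intro add_mono mult_right_mono) auto
      also have "\<dots> < \<delta>" using t by simp
      finally have "norm z < \<delta>" .
      moreover have "z \<noteq> 0" using in1[OF z] by (simp add: open_sector_def)
      ultimately have "norm (S z) \<le> C" using in1[OF z] \<delta>(2) by blast
      then show "norm (S z x) \<le> C * norm x"
        by (meson mult_right_mono norm_blinfun norm_ge_zero order_trans)
    qed
    then show "norm (D (of_real t) x) \<le> (1 + onorm \<iota>) * C / (\<kappa> / 2) / t * norm x"
      by (simp add: \<rho>_def mult_ac)
  qed (use \<delta> in simp)
qed

lemma sum_inverse_squares_le: "(\<Sum>l<n. 1 / (real (Suc l))\<^sup>2) \<le> 2"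
proof -
  have "(\<Sum>l<n. 1 / (real (Suc l))\<^sup>2) \<le> 2 - 1 / real n"
  proof (induction n)
    case (Suc n)
    have "1 / (real (Suc n))\<^sup>2 \<le> 1 / real n - 1 / real (Suc n)" if "n > 0"
    proof -
      have "1 / (real (Suc n))\<^sup>2 \<le> 1 / (real n * real (Suc n))"
        using that by (intro frac_le) (auto simp: power2_eq_square)
      also have "\<dots> = 1 / real n - 1 / real (Suc n)" using that by (simp add: field_simps)
      finally show ?thesis .
    qed
    then show ?case using Suc by (cases "n = 0") auto
  qed simp
  then show ?thesis by (smt (verit) divide_nonneg_nonneg of_nat_0_le_iff)
qed

context c0_semigroup begin

text \<open>
  Times beyond \<open>\<delta>\<close> are reached by composing the derivative at \<open>\<delta>/2\<close> with the semigroup.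
\<close>

lemma smoothing_bounded_interval:
  assumes \<delta>: "0 < \<delta>"
    and d0: "\<And>t x. 0 < t \<Longrightarrow> t < \<delta> \<Longrightarrow> ((\<lambda>s. T s x) has_vector_derivative V0 t x) (at t)"
    and b0: "\<And>t x. 0 < t \<Longrightarrow> t < \<delta> \<Longrightarrow> norm (V0 t x) \<le> C0 / t * norm x"
  obtains C V where "0 \<le> C"
    "\<And>t x. 0 < t \<Longrightarrow> t \<le> b \<Longrightarrow> ((\<lambda>s. T s x) has_vector_derivative V t x) (at t)"
    "\<And>t x. 0 < t \<Longrightarrow> t \<le> b \<Longrightarrow> norm (V t x) \<le> C / t * norm x"
proof -
  obtain E where E: "1 \<le> E" "\<And>t. 0 \<le> t \<Longrightarrow> t \<le> b \<Longrightarrow> norm (T t) \<le> E" using T_locally_bounded by blast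
  define V where "V t x = (if t < \<delta> then V0 t x else T (t - \<delta> / 2) (V0 (\<delta> / 2) x))" for t x
  define C where "C = max 0 C0 * (1 + E * (\<bar>b\<bar> / (\<delta> / 2)))"
  have "1 \<le> 1 + E * (\<bar>b\<bar> / (\<delta> / 2))" using E(1) \<delta> by (auto intro!: divide_nonneg_pos mult_nonneg_nonneg)
  then have C1: "C0 \<le> C" "0 \<le> C"
    using mult_left_mono[of 1 "1 + E * (\<bar>b\<bar> / (\<delta> / 2))" "max 0 C0"] by (auto simp: C_def)
  have C2: "max 0 C0 * (E * (b / (\<delta> / 2))) \<le> C"
  proof -
    have "E * (b / (\<delta> / 2)) \<le> 1 + E * (\<bar>b\<bar> / (\<delta> / 2))"
      using E(1) \<delta> by (intro add_increasing mult_left_mono divide_right_mono) auto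
    then show ?thesis unfolding C_def by (intro mult_left_mono) auto
  qed
  show ?thesis
  proof (rule that[OF C1(2)])
    fix t :: real and x assume t: "0 < t" "t \<le> b"
    show "((\<lambda>s. T s x) has_vector_derivative V t x) (at t)"
    proof (cases "t < \<delta>")
      case True
      then show ?thesis using d0 t by (simp add: V_def)
    next
      case False
      define a where "a = t - \<delta> / 2"
      have ta: "t - a = \<delta> / 2" "a > 0" using False \<delta> by (auto simp: a_def)
      have "((\<lambda>s. T s x) has_vector_derivative V0 (\<delta> / 2) x) (at (t - a))"
        unfolding ta(1) using \<delta> by (intro d0) auto
      then have "(((\<lambda>s. T s x) \<circ> (\<lambda>s. s - a)) has_vector_derivative 1 *\<^sub>R V0 (\<delta> / 2) x) (at t)"
        by (intro vector_diff_chain_at) (auto intro!: derivative_eq_intros)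
      then have "((\<lambda>s. T a (T (s - a) x)) has_vector_derivative T a (V0 (\<delta> / 2) x)) (at t)"
        using bounded_linear.has_vector_derivative[OF blinfun.bounded_linear_right, of _ _ _ "T a"] by (simp add: o_def)
      then have "((\<lambda>s. T s x) has_vector_derivative T a (V0 (\<delta> / 2) x)) (at t)"
      proof (rule has_vector_derivative_transform_within_open)
        show "open {a<..}" by simp
        show "T a (T (s - a) x) = T s x" if "s \<in> {a<..}" for s
          using T_add_apply[of a "s - a" x] that ta by simp
      qed (use ta \<delta> in auto)
      then show ?thesis using False by (simp add: V_def a_def)
    qed
    show "norm (V t x) \<le> C / t * norm x"
    proof (cases "t < \<delta>")
      case True
      have "norm (V t x) \<le> C0 / t * norm x" using b0 t True by (simp add: V_def)
      also have "\<dots> \<le> C / t * norm x" using C1 t by (intro mult_right_mono divide_right_mono) auto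
      finally show ?thesis .
    next
      case False
      have "norm (V t x) \<le> E * norm (V0 (\<delta> / 2) x)"
        using False \<delta> t by (auto simp: V_def intro!: T_apply_bound[OF E(2)])
      also have "norm (V0 (\<delta> / 2) x) \<le> C0 / (\<delta> / 2) * norm x" using \<delta> by (intro b0) auto
      also have "\<dots> \<le> max 0 C0 / (\<delta> / 2) * norm x" using \<delta> by (intro mult_right_mono divide_right_mono) auto
      finally have "norm (V t x) \<le> (max 0 C0 * (E * (t / (\<delta> / 2)))) / t * norm x"
        using E(1) t by (simp add: field_simps)
      also have "max 0 C0 * (E * (t / (\<delta> / 2))) \<le> max 0 C0 * (E * (b / (\<delta> / 2)))"
        using t E(1) \<delta> by (intro mult_left_mono divide_right_mono) auto
      also have "\<dots> \<le> C" by (rule C2)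
      finally show ?thesis using t by (simp add: divide_right_mono mult_right_mono)
    qed
  qed
qed

end

section \<open>Semigroup sums over the time grid\<close>

context c0_semigroup begin

text \<open>
  In terms of the generator, the bound is \<open>\<parallel>A\<^sup>2 e\<^sup>t\<^sup>A\<parallel> = O(t\<^sup>-\<^sup>2)\<close>. It follows from the first-order bound
  alone by splitting \<open>e\<^sup>t\<^sup>A\<close> into two equal factors, one for each power of \<open>A\<close>.
\<close>

lemma second_order_increment:
  assumes C: "0 \<le> C"
    and der: "\<And>t x. 0 < t \<Longrightarrow> t \<le> b \<Longrightarrow> ((\<lambda>s. T s x) has_vector_derivative V t x) (at t)"
    and V: "\<And>t x. 0 < t \<Longrightarrow> t \<le> b \<Longrightarrow> norm (V t x) \<le> C / t * norm x"
    and t: "0 < t" and S: "0 \<le> S" "t + S \<le> b"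
  shows "norm (T (t + S) x - T t x - S *\<^sub>R V t x) \<le> 4 * C\<^sup>2 * (S / t)\<^sup>2 * norm x"
proof -
  \<comment> \<open>\<open>A e\<^sup>(\<^sup>t\<^sup>+\<^sup>s\<^sup>)\<^sup>A = A e\<^sup>t\<^sup>A\<^sup>/\<^sup>2 e\<^sup>(\<^sup>t\<^sup>/\<^sup>2\<^sup>+\<^sup>s\<^sup>)\<^sup>A\<close>, by uniqueness of the derivative.\<close>
  have V_shift: "V (t + s) x = V (t / 2) (T (t / 2 + s) x)" if s: "0 \<le> s" "s \<le> S" for s
  proof -
    have "((\<lambda>r. T r (T (t / 2 + s) x)) has_vector_derivative V (t / 2) (T (t / 2 + s) x)) (at ((t + s) - (t / 2 + s)))"
      using der[of "t / 2" "T (t / 2 + s) x"] t S s by (simp add: field_simps)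
    then have "(((\<lambda>r. T r (T (t / 2 + s) x)) \<circ> (\<lambda>r. r - (t / 2 + s))) has_vector_derivative 1 *\<^sub>R V (t / 2) (T (t / 2 + s) x)) (at (t + s))"
      by (intro vector_diff_chain_at) (auto intro!: derivative_eq_intros)
    then have "((\<lambda>r. T (r - (t / 2 + s)) (T (t / 2 + s) x)) has_vector_derivative V (t / 2) (T (t / 2 + s) x)) (at (t + s))"
      by (simp add: o_def)
    then have "((\<lambda>r. T r x) has_vector_derivative V (t / 2) (T (t / 2 + s) x)) (at (t + s))"
    proof (rule has_vector_derivative_transform_within_open)
      show "open {t / 2 + s<..}" by simp
      show "T (r - (t / 2 + s)) (T (t / 2 + s) x) = T r x" if "r \<in> {t / 2 + s<..}" for r
        using T_add_apply[of "r - (t / 2 + s)" "t / 2 + s" x] that s t by simp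
    qed (use t in simp)
    from vector_derivative_unique_at[OF _ this] der[of "t + s" x] t s S show ?thesis by simp
  qed
  have incr: "norm (T (t / 2 + s) x - T (t / 2 + 0) x) \<le> C / (t / 2) * norm x * (s - 0)" if s: "0 \<le> s" "s \<le> S" for s
  proof -
    have "norm (T (t / 2 + s) x - T (t / 2) x) \<le> C / (t / 2) * norm x * ((t / 2 + s) - t / 2)"
    proof (rule vector_derivative_norm_bound)
      fix r assume r: "r \<in> {t / 2..t / 2 + s}"
      have r0: "0 < r" "r \<le> b" using r t s S by auto
      show "((\<lambda>s. T s x) has_vector_derivative V r x) (at r within {t / 2..t / 2 + s})"
        using der[OF r0] by (rule has_vector_derivative_at_within)
      have "norm (V r x) \<le> C / r * norm x" using V[OF r0] .
      also have "\<dots> \<le> C / (t / 2) * norm x"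
        using r t C by (intro mult_right_mono divide_left_mono mult_pos_pos) auto
      finally show "norm (V r x) \<le> C / (t / 2) * norm x" .
    qed (use s in simp)
    then show ?thesis by simp
  qed
  define p where "p s = T (t + s) x - s *\<^sub>R V t x" for s
  have "norm (p S - p 0) \<le> 4 * C\<^sup>2 * S / t\<^sup>2 * norm x * (S - 0)"
  proof (rule vector_derivative_norm_bound)
    fix s assume s: "s \<in> {0..S}"
    have "((\<lambda>r. T r x) has_vector_derivative V (t + s) x) (at (t + s))"
      using der s t S by auto
    then have "(((\<lambda>r. T r x) \<circ> (\<lambda>s. t + s)) has_vector_derivative 1 *\<^sub>R V (t + s) x) (at s)"
      by (intro vector_diff_chain_at) (auto intro!: derivative_eq_intros)
    then have "(p has_vector_derivative V (t + s) x - V t x) (at s)"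
      unfolding p_def o_def
      by (intro has_vector_derivative_diff) (auto intro!: derivative_eq_intros simp: has_vector_derivative_def)
    then show "(p has_vector_derivative V (t + s) x - V t x) (at s within {0..S})"
      by (rule has_vector_derivative_at_within)
    have half: "norm (V (t / 2) y) \<le> C / (t / 2) * norm y" for y using t S by (intro V) auto
    have "V (t + s) x - V t x = V (t / 2) (T (t / 2 + s) x) - V (t / 2) (T (t / 2 + 0) x)"
      using V_shift[of s] V_shift[of 0] s S by simp
    also have "\<dots> = V (t / 2) (T (t / 2 + s) x - T (t / 2 + 0) x)"
    proof -
      have "((\<lambda>r. T r y - T r z) has_vector_derivative V (t / 2) y - V (t / 2) z) (at (t / 2))" for y z
        using t S by (intro has_vector_derivative_diff der) auto
      moreover have "((\<lambda>r. T r y - T r z) has_vector_derivative V (t / 2) (y - z)) (at (t / 2))" for y z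
        using der[of "t / 2" "y - z"] t S by (simp add: blinfun.diff_right)
      ultimately show ?thesis by (rule vector_derivative_unique_at)
    qed
    finally have "norm (V (t + s) x - V t x) \<le> C / (t / 2) * norm (T (t / 2 + s) x - T (t / 2 + 0) x)"
      using half by simp
    also have "\<dots> \<le> C / (t / 2) * (C / (t / 2) * norm x * (s - 0))"
      using s C t by (intro mult_left_mono incr) auto
    also have "\<dots> \<le> C / (t / 2) * (C / (t / 2) * norm x * S)"
      using s C t by (intro mult_left_mono) auto
    also have "\<dots> = 4 * C\<^sup>2 * S / t\<^sup>2 * norm x" by (simp add: power2_eq_square)
    finally show "norm (V (t + s) x - V t x) \<le> 4 * C\<^sup>2 * S / t\<^sup>2 * norm x" .
  qed (use S in simp)
  then show ?thesis by (simp add: p_def power2_eq_square algebra_simps)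
qed

text \<open>
  The derivative \<open>V t\<close> is \<open>A e\<^sup>t\<^sup>A\<close>, so this is the bound \<open>\<parallel>A e\<^sup>t\<^sup>A\<parallel> \<le> C/t\<close> for small \<open>t\<close>.
\<close>

definition smoothing :: bool where
  "smoothing \<longleftrightarrow> (\<exists>\<delta> C V. 0 < \<delta> \<and> (\<forall>t x. 0 < t \<and> t < \<delta> \<longrightarrow>
     ((\<lambda>s. T s x) has_vector_derivative V t x) (at t) \<and> norm (V t x) \<le> C / t * norm x))"

text \<open>
  For \<open>\<sigma> = 1\<close> the sum telescopes. In general the summand with index \<open>l \<ge> 1\<close> is \<open>\<sigma>\<close> times the
  telescoping one plus a second difference of the semigroup at time \<open>l h\<close> with increments \<open>O(h)\<close>, which is
  \<open>O(1/l\<^sup>2)\<close> by smoothing and therefore summable uniformly in \<open>h\<close>.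
\<close>

lemma shifted_grid_sum_bound:
  assumes smoothing and R: "0 \<le> R"
  obtains K where "\<And>m h \<sigma> x. 0 < h \<Longrightarrow> h \<le> 1 \<Longrightarrow> real m * h \<le> b \<Longrightarrow> 0 \<le> \<sigma> \<Longrightarrow> \<sigma> \<le> R \<Longrightarrow>
    norm (\<Sum>l<m. T (real l * h) (T (\<sigma> * h) x - x)) \<le> K * norm x"
proof -
  \<comment> \<open>The arguments \<open>l h + \<sigma> h\<close> and \<open>l h + h\<close> exceed \<open>b\<close> by at most \<open>R + 1\<close>.\<close>
  define b' where "b' = \<bar>b\<bar> + R + 1"
  obtain \<delta> C0 V0 where s0: "0 < \<delta>" "\<And>t x. 0 < t \<Longrightarrow> t < \<delta> \<Longrightarrow> ((\<lambda>s. T s x) has_vector_derivative V0 t x) (at t)"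
    "\<And>t x. 0 < t \<Longrightarrow> t < \<delta> \<Longrightarrow> norm (V0 t x) \<le> C0 / t * norm x"
    using assms(1) unfolding smoothing_def by blast
  obtain C V where C: "0 \<le> C" and der: "\<And>t x. 0 < t \<Longrightarrow> t \<le> b' \<Longrightarrow> ((\<lambda>s. T s x) has_vector_derivative V t x) (at t)"
    and V: "\<And>t x. 0 < t \<Longrightarrow> t \<le> b' \<Longrightarrow> norm (V t x) \<le> C / t * norm x"
    using smoothing_bounded_interval[OF s0] by blast
  obtain E where E: "1 \<le> E" "\<And>t. 0 \<le> t \<Longrightarrow> t \<le> b' \<Longrightarrow> norm (T t) \<le> E" using T_locally_bounded by blast
  define k where "k = 4 * C\<^sup>2 * (R\<^sup>2 + R)"
  have k: "0 \<le> k" using R by (simp add: k_def)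
  define K where "K = 2 * E + 2 * k + R * (2 * E)"
  show ?thesis
  proof (rule that[of K])
    fix m :: nat and h \<sigma> :: real and x
    assume h: "0 < h" "h \<le> 1" and mh: "real m * h \<le> b" and \<sigma>: "0 \<le> \<sigma>" "\<sigma> \<le> R"
    have K0: "0 \<le> K" using E(1) R k by (simp add: K_def)
    show "norm (\<Sum>l<m. T (real l * h) (T (\<sigma> * h) x - x)) \<le> K * norm x"
    proof (cases m)
      case 0
      then show ?thesis using K0 by simp
    next
      case (Suc n)
      have \<sigma>h: "0 \<le> \<sigma> * h" "\<sigma> * h \<le> R" using \<sigma> h mult_mono[of \<sigma> R h 1] by auto
      have grid: "real l * h + h \<le> b" if "l \<le> n" for l
      proof -
        have "real l * h + h = real (Suc l) * h" by (simp add: algebra_simps)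
        also have "\<dots> \<le> real m * h" using that Suc h by (intro mult_right_mono) auto
        finally show ?thesis using mh by simp
      qed
      have Tb: "norm (T t x) \<le> E * norm x" if "0 \<le> t" "t \<le> b'" for t
        using T_apply_bound[of b' E t, OF E(2)] that by blast
      define q where "q l = T (real (Suc l) * h) x" for l
      define err where "err l = T (real (Suc l) * h + \<sigma> * h) x - T (real (Suc l) * h) x
          - \<sigma> *\<^sub>R (T (real (Suc l) * h + h) x - T (real (Suc l) * h) x)" for l
      have err: "norm (err l) \<le> k * norm x * (1 / (real (Suc l))\<^sup>2)" if l: "l < n" for l
      proof -
        let ?t = "real (Suc l) * h"
        have t: "0 < ?t" "?t + \<sigma> * h \<le> b'" "?t + h \<le> b'"
          using h grid[of "Suc l"] l \<sigma>h R unfolding b'_def by (auto simp del: of_nat_Suc)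
        have "norm (T (?t + \<sigma> * h) x - T ?t x - (\<sigma> * h) *\<^sub>R V ?t x) \<le> 4 * C\<^sup>2 * (\<sigma> * h / ?t)\<^sup>2 * norm x"
          using t \<sigma>h h by (intro second_order_increment[OF C der V]) auto
        moreover have "norm (\<sigma> *\<^sub>R (T (?t + h) x - T ?t x - h *\<^sub>R V ?t x)) \<le> \<sigma> * (4 * C\<^sup>2 * (h / ?t)\<^sup>2 * norm x)"
        proof -
          have "norm (T (?t + h) x - T ?t x - h *\<^sub>R V ?t x) \<le> 4 * C\<^sup>2 * (h / ?t)\<^sup>2 * norm x"
            using t h by (intro second_order_increment[OF C der V]) auto
          from mult_left_mono[OF this \<sigma>(1)] show ?thesis using \<sigma>(1) by (simp only: norm_scaleR abs_of_nonneg)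
        qed
        moreover have err_eq: "err l = (T (?t + \<sigma> * h) x - T ?t x - (\<sigma> * h) *\<^sub>R V ?t x)
            - \<sigma> *\<^sub>R (T (?t + h) x - T ?t x - h *\<^sub>R V ?t x)"
          by (simp add: err_def scaleR_diff_right del: of_nat_Suc)
        ultimately have "norm (err l) \<le> 4 * C\<^sup>2 * (\<sigma> * h / ?t)\<^sup>2 * norm x + \<sigma> * (4 * C\<^sup>2 * (h / ?t)\<^sup>2 * norm x)"
          by (simp only: err_eq, intro order_trans[OF norm_triangle_ineq4 add_mono])
        also have "\<dots> = 4 * C\<^sup>2 * (\<sigma>\<^sup>2 + \<sigma>) * norm x * (1 / (real (Suc l))\<^sup>2)"
        proof -
          have "\<sigma> * h / ?t = \<sigma> / real (Suc l)" "h / ?t = 1 / real (Suc l)" using h by (auto simp del: of_nat_Suc)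
          then show ?thesis by (simp add: power_divide algebra_simps add_divide_distrib del: of_nat_Suc)
        qed
        also have "\<dots> \<le> k * norm x * (1 / (real (Suc l))\<^sup>2)"
          unfolding k_def using \<sigma> R C by (intro mult_right_mono mult_left_mono add_mono power_mono) auto
        finally show ?thesis .
      qed
      have summand: "T (real (Suc l) * h) (T (\<sigma> * h) x - x) = err l + \<sigma> *\<^sub>R (q (Suc l) - q l)" for l
      proof -
        have "T (real (Suc l) * h + \<sigma> * h) x = T (real (Suc l) * h) (T (\<sigma> * h) x)"
          using h \<sigma>h by (intro T_add_apply) auto
        moreover have "real (Suc (Suc l)) * h = real (Suc l) * h + h" by (simp add: algebra_simps)
        ultimately show ?thesis by (simp add: err_def q_def blinfun.diff_right del: of_nat_Suc)
      qed
      have "(\<Sum>l<m. T (real l * h) (T (\<sigma> * h) x - x)) =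
          (T (\<sigma> * h) x - x) + (\<Sum>l<n. T (real (Suc l) * h) (T (\<sigma> * h) x - x))"
        unfolding Suc sum.lessThan_Suc_shift by (simp add: T_zero)
      also have "(\<Sum>l<n. T (real (Suc l) * h) (T (\<sigma> * h) x - x)) = (\<Sum>l<n. err l) + \<sigma> *\<^sub>R (q n - q 0)"
        unfolding summand by (simp add: sum.distrib sum_lessThan_telescope flip: scaleR_sum_right)
      finally have eq: "(\<Sum>l<m. T (real l * h) (T (\<sigma> * h) x - x)) =
          (T (\<sigma> * h) x - x) + ((\<Sum>l<n. err l) + \<sigma> *\<^sub>R (q n - q 0))" .
      have n1: "norm (T (\<sigma> * h) x - x) \<le> 2 * E * norm x"
      proof -
        have "norm (T (\<sigma> * h) x - x) \<le> norm (T (\<sigma> * h) x) + norm x" by (rule norm_triangle_ineq4)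
        also have "\<dots> \<le> E * norm x + E * norm x"
          using Tb[of "\<sigma> * h"] \<sigma>h E(1) mult_right_mono[of 1 E "norm x"] by (intro add_mono) (auto simp: b'_def)
        finally show ?thesis by simp
      qed
      have n2: "norm (\<Sum>l<n. err l) \<le> 2 * k * norm x"
      proof -
        have "norm (\<Sum>l<n. err l) \<le> (\<Sum>l<n. k * norm x * (1 / (real (Suc l))\<^sup>2))"
          by (rule sum_norm_le) (use err in auto)
        also have "\<dots> = k * norm x * (\<Sum>l<n. 1 / (real (Suc l))\<^sup>2)" by (rule sum_distrib_left[symmetric])
        also have "\<dots> \<le> k * norm x * 2" using k by (intro mult_left_mono sum_inverse_squares_le) auto
        finally show ?thesis by simp
      qed
      have n3: "norm (\<sigma> *\<^sub>R (q n - q 0)) \<le> R * (2 * E) * norm x"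
      proof -
        have "norm (q l) \<le> E * norm x" if "l \<le> n" for l
          unfolding q_def using grid[OF that] R h
          by (intro Tb) (auto simp: b'_def algebra_simps)
        then have "norm (q n) \<le> E * norm x" "norm (q 0) \<le> E * norm x" by auto
        then have "norm (q n - q 0) \<le> E * norm x + E * norm x"
          by (rule order_trans[OF norm_triangle_ineq4 add_mono])
        then have "\<sigma> * norm (q n - q 0) \<le> R * (2 * E * norm x)"
          using \<sigma> by (intro mult_mono) auto
        then show ?thesis using \<sigma> by simp
      qed
      have "norm (\<Sum>l<m. T (real l * h) (T (\<sigma> * h) x - x)) \<le> 2 * E * norm x + (2 * k * norm x + R * (2 * E) * norm x)"
        unfolding eq by (intro order_trans[OF norm_triangle_ineq] add_mono n1 n2 n3)
      then show ?thesis by (simp add: K_def algebra_simps)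
    qed
  qed
qed

lemma phi_zero_has_integral: "((\<lambda>\<theta>. \<theta> ^ (k - 1) / fact (k - 1)) has_integral phi k 0) {0..1}"
  unfolding phi_def
  by (rule integrable_integral[THEN has_integral_eq[rotated]])
     (auto intro!: integrable_continuous_real continuous_intros)

text \<open>
  \<open>\<phi>\<^sub>k(r h A) - \<phi>\<^sub>k(0)\<close> is an average of \<open>e\<^sup>\<sigma>\<^sup>h\<^sup>A - I\<close> over \<open>\<sigma> \<in> [0, r]\<close> with weights of modulus at most one.
\<close>

lemma phi_grid_sum_bound:
  assumes smoothing and r: "0 \<le> r"
  obtains K where "\<And>m h x. 0 < h \<Longrightarrow> h \<le> 1 \<Longrightarrow> real m * h \<le> b \<Longrightarrow>
    norm (\<Sum>l<m. T (real l * h) (phi_op T k (r * h) x - phi k 0 *\<^sub>R x)) \<le> K * norm x"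
proof -
  obtain K where K: "\<And>m h \<sigma> x. 0 < h \<Longrightarrow> h \<le> 1 \<Longrightarrow> real m * h \<le> b \<Longrightarrow> 0 \<le> \<sigma> \<Longrightarrow> \<sigma> \<le> r \<Longrightarrow>
    norm (\<Sum>l<m. T (real l * h) (T (\<sigma> * h) x - x)) \<le> K * norm x"
    using shifted_grid_sum_bound[OF assms] by blast
  show ?thesis
  proof (rule that[of K])
    fix m :: nat and h :: real and x assume h: "0 < h" "h \<le> 1" and mh: "real m * h \<le> b"
    define w where "w \<theta> = \<theta> ^ (k - 1) / fact (k - 1)" for \<theta> :: real
    have "((\<lambda>\<theta>. w \<theta> *\<^sub>R (T ((1 - \<theta>) * (r * h)) x - x)) has_integral phi_op T k (r * h) x - phi k 0 *\<^sub>R x) {0..1}"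
      unfolding scaleR_diff_right w_def
      by (intro has_integral_diff phi_op_has_integral has_integral_scaleR_left phi_zero_has_integral) (use r h in auto)
    note step = has_integral_linear[OF this, OF blinfun.bounded_linear_right]
    have int: "((\<lambda>\<theta>. \<Sum>l<m. T (real l * h) (w \<theta> *\<^sub>R (T ((1 - \<theta>) * (r * h)) x - x))) has_integral
        (\<Sum>l<m. T (real l * h) (phi_op T k (r * h) x - phi k 0 *\<^sub>R x))) {0..1}"
      using step by (intro has_integral_sum) (auto simp: o_def)
    show "norm (\<Sum>l<m. T (real l * h) (phi_op T k (r * h) x - phi k 0 *\<^sub>R x)) \<le> K * norm x"
    proof (rule unit_interval_integral_bound[OF int])
      fix \<theta> :: real assume th: "\<theta> \<in> {0..1}"
      have "(\<Sum>l<m. T (real l * h) (w \<theta> *\<^sub>R (T ((1 - \<theta>) * (r * h)) x - x)))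
          = w \<theta> *\<^sub>R (\<Sum>l<m. T (real l * h) (T (((1 - \<theta>) * r) * h) x - x))"
        by (simp add: blinfun.scaleR_right scaleR_sum_right mult.assoc)
      moreover have "norm (\<Sum>l<m. T (real l * h) (T (((1 - \<theta>) * r) * h) x - x)) \<le> K * norm x"
        using th r by (intro K h mh) (auto intro!: mult_left_le_one_le)
      moreover have "\<bar>w \<theta>\<bar> \<le> 1"
      proof -
        have "\<theta> ^ (k - 1) \<le> 1" using th by (intro power_le_one) auto
        also have "1 \<le> (fact (k - 1) :: real)" by (rule fact_ge_1)
        finally show ?thesis using th by (simp add: w_def field_simps)
      qed
      ultimately show "norm (\<Sum>l<m. T (real l * h) (w \<theta> *\<^sub>R (T ((1 - \<theta>) * (r * h)) x - x))) \<le> K * norm x"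
        using mult_mono[of "\<bar>w \<theta>\<bar>" 1 "norm (\<Sum>l<m. T (real l * h) (T (((1 - \<theta>) * r) * h) x - x))" "K * norm x"]
        by simp
    qed
  qed
qed

lemma comb_grid_sum_bound:
  assumes smoothing and "\<And>w k r. (w, k, r) \<in> set p \<Longrightarrow> 0 \<le> r"
  shows "\<exists>K. \<forall>m h x. 0 < h \<longrightarrow> h \<le> 1 \<longrightarrow> real m * h \<le> b \<longrightarrow>
    norm (\<Sum>l<m. T (real l * h) (comb_op T h p x - comb_val p 0 *\<^sub>R x)) \<le> K * norm x"
  using assms(2)
proof (induction p)
  case Nil
  then show ?case by (intro exI[of _ 0]) (simp add: comb_op_def comb_val_def)
next
  case (Cons q p)
  obtain w k r where q: "q = (w, k, r)" by (cases q) auto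
  have r: "0 \<le> r" using Cons.prems q by auto
  obtain K1 where K1: "\<And>m h x. 0 < h \<Longrightarrow> h \<le> 1 \<Longrightarrow> real m * h \<le> b \<Longrightarrow>
    norm (\<Sum>l<m. T (real l * h) (phi_op T k (r * h) x - phi k 0 *\<^sub>R x)) \<le> K1 * norm x"
    using phi_grid_sum_bound[OF assms(1) r] by blast
  obtain K2 where K2: "\<And>m h x. 0 < h \<Longrightarrow> h \<le> 1 \<Longrightarrow> real m * h \<le> b \<Longrightarrow>
    norm (\<Sum>l<m. T (real l * h) (comb_op T h p x - comb_val p 0 *\<^sub>R x)) \<le> K2 * norm x"
    using Cons.IH Cons.prems by (metis list.set_intros(2))
  show ?case
  proof (intro exI[of _ "\<bar>w\<bar> * K1 + K2"] allI impI)
    fix m :: nat and h :: real and x assume h: "0 < h" "h \<le> 1" "real m * h \<le> b"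
    have "comb_op T h (q # p) x - comb_val (q # p) 0 *\<^sub>R x =
        w *\<^sub>R (phi_op T k (r * h) x - phi k 0 *\<^sub>R x) + (comb_op T h p x - comb_val p 0 *\<^sub>R x)"
      by (simp add: q comb_op_def comb_val_def algebra_simps)
    then have "(\<Sum>l<m. T (real l * h) (comb_op T h (q # p) x - comb_val (q # p) 0 *\<^sub>R x)) =
        w *\<^sub>R (\<Sum>l<m. T (real l * h) (phi_op T k (r * h) x - phi k 0 *\<^sub>R x))
        + (\<Sum>l<m. T (real l * h) (comb_op T h p x - comb_val p 0 *\<^sub>R x))"
      by (simp only: blinfun.add_right blinfun.scaleR_right sum.distrib scaleR_sum_right)
    also have "norm \<dots> \<le> \<bar>w\<bar> * (K1 * norm x) + K2 * norm x"
      using mult_left_mono[OF K1[OF h, of x], of "\<bar>w\<bar>"] K2[OF h, of x]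
      by (intro order_trans[OF norm_triangle_ineq] add_mono) auto
    finally show "norm (\<Sum>l<m. T (real l * h) (comb_op T h (q # p) x - comb_val (q # p) 0 *\<^sub>R x)) \<le> (\<bar>w\<bar> * K1 + K2) * norm x"
      by (simp add: algebra_simps)
  qed
qed

text \<open>
  The weak condition says that the values at \<open>0\<close> cancel, so they may be subtracted from each term.
\<close>

lemma weak_quadrature_grid_sum_bound:
  assumes smoothing and I: "finite I" and r: "\<And>i w k r. i \<in> I \<Longrightarrow> (w, k, r) \<in> set (p i) \<Longrightarrow> 0 \<le> r"
    and weak: "(\<Sum>i\<in>I. comb_val (p i) 0 * c i) = phi q 0"
  obtains K where "\<And>m h x. 0 < h \<Longrightarrow> h \<le> 1 \<Longrightarrow> real m * h \<le> b \<Longrightarrow>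
    norm (\<Sum>l<m. T (real l * h) ((\<Sum>i\<in>I. c i *\<^sub>R comb_op T h (p i) x) - phi_op T q h x)) \<le> K * norm x"
proof -
  have "\<forall>i\<in>I. \<exists>K. \<forall>m h x. 0 < h \<longrightarrow> h \<le> 1 \<longrightarrow> real m * h \<le> b \<longrightarrow>
    norm (\<Sum>l<m. T (real l * h) (comb_op T h (p i) x - comb_val (p i) 0 *\<^sub>R x)) \<le> K * norm x"
  proof
    fix i assume "i \<in> I"
    from r[OF this] show "\<exists>K. \<forall>m h x. 0 < h \<longrightarrow> h \<le> 1 \<longrightarrow> real m * h \<le> b \<longrightarrow>
      norm (\<Sum>l<m. T (real l * h) (comb_op T h (p i) x - comb_val (p i) 0 *\<^sub>R x)) \<le> K * norm x"
      by (rule comb_grid_sum_bound[OF assms(1)])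
  qed
  from bchoice[OF this] obtain K where K: "\<And>i m h x. i \<in> I \<Longrightarrow> 0 < h \<Longrightarrow> h \<le> 1 \<Longrightarrow> real m * h \<le> b \<Longrightarrow>
    norm (\<Sum>l<m. T (real l * h) (comb_op T h (p i) x - comb_val (p i) 0 *\<^sub>R x)) \<le> K i * norm x"
    by blast
  obtain K' where K': "\<And>m h x. 0 < h \<Longrightarrow> h \<le> 1 \<Longrightarrow> real m * h \<le> b \<Longrightarrow>
    norm (\<Sum>l<m. T (real l * h) (phi_op T q h x - phi q 0 *\<^sub>R x)) \<le> K' * norm x"
    using phi_grid_sum_bound[OF assms(1), of 1 b q] by auto
  show ?thesis
  proof (rule that[of "(\<Sum>i\<in>I. \<bar>c i\<bar> * K i) + K'"])
    fix m :: nat and h :: real and x assume h: "0 < h" "h \<le> 1" "real m * h \<le> b"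
    have "(\<Sum>i\<in>I. c i *\<^sub>R comb_op T h (p i) x) - phi_op T q h x =
      (\<Sum>i\<in>I. c i *\<^sub>R (comb_op T h (p i) x - comb_val (p i) 0 *\<^sub>R x)) - (phi_op T q h x - phi q 0 *\<^sub>R x)"
      unfolding weak[symmetric]
      by (simp add: scaleR_diff_right sum_subtractf scaleR_sum_left mult.commute)
    then have "(\<Sum>l<m. T (real l * h) ((\<Sum>i\<in>I. c i *\<^sub>R comb_op T h (p i) x) - phi_op T q h x)) =
      (\<Sum>l<m. \<Sum>i\<in>I. c i *\<^sub>R T (real l * h) (comb_op T h (p i) x - comb_val (p i) 0 *\<^sub>R x))
       - (\<Sum>l<m. T (real l * h) (phi_op T q h x - phi q 0 *\<^sub>R x))"
      by (simp only: blinfun.diff_right[of "T _" "sum _ _"] blinfun.sum_right blinfun.scaleR_right sum_subtractf)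
    also have "(\<Sum>l<m. \<Sum>i\<in>I. c i *\<^sub>R T (real l * h) (comb_op T h (p i) x - comb_val (p i) 0 *\<^sub>R x)) =
       (\<Sum>i\<in>I. c i *\<^sub>R (\<Sum>l<m. T (real l * h) (comb_op T h (p i) x - comb_val (p i) 0 *\<^sub>R x)))"
      by (subst sum.swap) (simp only: scaleR_sum_right)
    also have "norm (\<dots> - (\<Sum>l<m. T (real l * h) (phi_op T q h x - phi q 0 *\<^sub>R x)))
       \<le> (\<Sum>i\<in>I. \<bar>c i\<bar> * (K i * norm x)) + K' * norm x"
    proof (intro order_trans[OF norm_triangle_ineq4] add_mono sum_norm_le)
      fix i assume "i \<in> I"
      then show "norm (c i *\<^sub>R (\<Sum>l<m. T (real l * h) (comb_op T h (p i) x - comb_val (p i) 0 *\<^sub>R x))) \<le> \<bar>c i\<bar> * (K i * norm x)"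
        using mult_left_mono[OF K[OF _ h, of i x], of "\<bar>c i\<bar>"] by simp
    qed (use K' h in auto)
    finally show "norm (\<Sum>l<m. T (real l * h) ((\<Sum>i\<in>I. c i *\<^sub>R comb_op T h (p i) x) - phi_op T q h x))
       \<le> ((\<Sum>i\<in>I. \<bar>c i\<bar> * K i) + K') * norm x"
      by (simp add: sum_distrib_right mult.assoc distrib_right)
  qed
qed

end

lemma analytic_semigroup_c0:
  assumes "analytic_semigroup \<K> T" shows "c0_semigroup T"
  using assms by (auto simp: analytic_semigroup_def strongly_continuous_semigroup_def c0_semigroup_def)

text \<open>
  Over the reals, the estimate for the complexification is applied to the vectors \<open>(x, 0)\<close>.
\<close>

lemma analytic_semigroup_smoothing:
  fixes T :: "real \<Rightarrow> 'a::banach \<Rightarrow>\<^sub>L 'a"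
  assumes "banach_over \<K>" "analytic_semigroup \<K> T"
  shows "c0_semigroup.smoothing T"
proof -
  interpret c0_semigroup T using assms(2) by (rule analytic_semigroup_c0)
  have ext: "extends_analytically \<K> T" using assms(2) by (simp add: analytic_semigroup_def)
  show ?thesis
  proof (cases \<K>)
    case (Complex_Scalars \<iota>)
    have i: "bounded_linear \<iota>" "\<And>x. \<iota> (\<iota> x) = - x"
      using assms(1) Complex_Scalars by (auto simp: complex_structure_def)
    have "extends_to_sector \<iota> (\<lambda>t x. T t x)" using ext Complex_Scalars by simp
    then obtain \<delta> C V where "0 < \<delta>"
      "\<And>t x. 0 < t \<Longrightarrow> t < \<delta> \<Longrightarrow> ((\<lambda>s. T s x) has_vector_derivative V t x) (at t)"
      "\<And>t x. 0 < t \<Longrightarrow> t < \<delta> \<Longrightarrow> norm (V t x) \<le> C / t * norm x"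
      by (rule sector_smoothing[OF i]) (rule that)
    then show ?thesis unfolding smoothing_def by blast
  next
    case Real_Scalars
    let ?\<iota> = "\<lambda>(x, y). (- y, x) :: 'a \<times> 'a"
    have "bounded_linear (\<lambda>p :: 'a \<times> 'a. (- snd p, fst p))"
      by (intro bounded_linear_Pair bounded_linear_minus bounded_linear_fst bounded_linear_snd)
    then have i: "bounded_linear ?\<iota>" by (simp only: case_prod_beta')
    have ii: "?\<iota> (?\<iota> p) = - p" for p by (cases p) simp
    have "extends_to_sector ?\<iota> (\<lambda>t (x, y). (T t x, T t y))" using ext Real_Scalars by simp
    then obtain \<delta> C V where d: "0 < \<delta>"
      "\<And>t x. 0 < t \<Longrightarrow> t < \<delta> \<Longrightarrow> ((\<lambda>s. (\<lambda>(x, y). (T s x, T s y)) x) has_vector_derivative V t x) (at t)"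
      "\<And>t x. 0 < t \<Longrightarrow> t < \<delta> \<Longrightarrow> norm (V t x) \<le> C / t * norm x"
      by (rule sector_smoothing[OF i ii]) (rule that)
    show ?thesis unfolding smoothing_def
    proof (rule exI[of _ \<delta>], rule exI[of _ C], rule exI[of _ "\<lambda>t x. fst (V t (x, 0))"], intro conjI allI impI d(1))
      fix t x assume t: "0 < t \<and> t < \<delta>"
      show "((\<lambda>s. T s x) has_vector_derivative fst (V t (x, 0))) (at t)"
        using bounded_linear.has_vector_derivative[OF bounded_linear_fst d(2)[of t "(x, 0)"]] t by simp
      have "norm (fst (V t (x, 0))) \<le> norm (V t (x, 0))" by (metis norm_fst_le prod.collapse)
      also have "\<dots> \<le> C / t * norm x" using d(3)[of t "(x, 0)"] t by (simp add: norm_Pair)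
      finally show "norm (fst (V t (x, 0))) \<le> C / t * norm x" .
    qed
  qed
qed

section \<open>Orders that hold uniformly in time\<close>

text \<open>
  \<open>X t h = O(h\<^sup>k)\<close> as \<open>h\<close> tends to \<open>0\<close> from above, uniformly in the parameter \<open>t \<in> I\<close>. The parameter is mostly
  the time, and in the stability estimate a pair of a time and a perturbed value.
\<close>

definition uO :: "'t set \<Rightarrow> nat \<Rightarrow> ('t \<Rightarrow> real \<Rightarrow> 'b::real_normed_vector) \<Rightarrow> bool" where
  "uO I k X \<longleftrightarrow> (\<exists>C. \<forall>\<^sub>F h in at_right 0. \<forall>t\<in>I. norm (X t h) \<le> C * h ^ k)"

lemma eventually_small: "0 < (c::real) \<Longrightarrow> \<forall>\<^sub>F h in at_right 0. 0 < h \<and> h \<le> c"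
  unfolding eventually_at_right_field by (intro exI[of _ c]) auto

lemma uO_D:
  assumes "uO I k X"
  obtains C where "0 \<le> C" "\<forall>\<^sub>F h in at_right 0. 0 < h \<and> h \<le> 1 \<and> (\<forall>t\<in>I. norm (X t h) \<le> C * h ^ k)"
proof -
  obtain C where C: "\<forall>\<^sub>F h in at_right 0. \<forall>t\<in>I. norm (X t h) \<le> C * h ^ k"
    using assms unfolding uO_def by blast
  have "\<forall>\<^sub>F h in at_right 0. 0 < h \<and> h \<le> 1 \<and> (\<forall>t\<in>I. norm (X t h) \<le> max C 0 * h ^ k)"
    using C eventually_small[of 1, simplified]
  proof eventually_elim
    case (elim h)
    have "C * h ^ k \<le> max C 0 * h ^ k" using elim by (intro mult_right_mono) auto
    then show ?case using elim by (auto intro: order_trans)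
  qed
  then show ?thesis using that[of "max C 0"] by simp
qed

lemma uO_norm_le:
  assumes "\<forall>\<^sub>F h in at_right 0. \<forall>t\<in>I. norm (X t h) \<le> K * norm (Y t h)" "uO I k Y"
  shows "uO I k X"
proof -
  obtain C where C: "0 \<le> C" "\<forall>\<^sub>F h in at_right 0. 0 < h \<and> h \<le> 1 \<and> (\<forall>t\<in>I. norm (Y t h) \<le> C * h ^ k)"
    using uO_D[OF assms(2)] by blast
  show ?thesis unfolding uO_def
  proof (intro exI[of _ "\<bar>K\<bar> * C"])
    show "\<forall>\<^sub>F h in at_right 0. \<forall>t\<in>I. norm (X t h) \<le> \<bar>K\<bar> * C * h ^ k"
      using assms(1) C(2)
    proof eventually_elim
      case (elim h)
      show ?case
      proof
        fix t assume t: "t \<in> I"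
        have "norm (X t h) \<le> K * norm (Y t h)" using elim t by blast
        also have "\<dots> \<le> \<bar>K\<bar> * norm (Y t h)" by (intro mult_right_mono) auto
        also have "\<dots> \<le> \<bar>K\<bar> * (C * h ^ k)" using elim t by (intro mult_left_mono) auto
        finally show "norm (X t h) \<le> \<bar>K\<bar> * C * h ^ k" by (simp add: mult.assoc)
      qed
    qed
  qed
qed

lemma uO_mult_norm_le:
  assumes "\<forall>\<^sub>F h in at_right 0. \<forall>t\<in>I. norm (X t h) \<le> K * (norm (Y t h) * norm (Z t h))" "uO I k Y" "uO I l Z"
  shows "uO I (k + l) X"
proof -
  obtain C where C: "0 \<le> C" "\<forall>\<^sub>F h in at_right 0. 0 < h \<and> h \<le> 1 \<and> (\<forall>t\<in>I. norm (Y t h) \<le> C * h ^ k)"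
    using uO_D[OF assms(2)] by blast
  obtain E where E: "0 \<le> E" "\<forall>\<^sub>F h in at_right 0. 0 < h \<and> h \<le> 1 \<and> (\<forall>t\<in>I. norm (Z t h) \<le> E * h ^ l)"
    using uO_D[OF assms(3)] by blast
  show ?thesis unfolding uO_def
  proof (intro exI[of _ "\<bar>K\<bar> * (C * E)"])
    show "\<forall>\<^sub>F h in at_right 0. \<forall>t\<in>I. norm (X t h) \<le> \<bar>K\<bar> * (C * E) * h ^ (k + l)"
      using assms(1) C(2) E(2)
    proof eventually_elim
      case (elim h)
      show ?case
      proof
        fix t assume t: "t \<in> I"
        have "norm (X t h) \<le> K * (norm (Y t h) * norm (Z t h))" using elim t by blast
        also have "\<dots> \<le> \<bar>K\<bar> * (norm (Y t h) * norm (Z t h))" by (intro mult_right_mono) auto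
        also have "\<dots> \<le> \<bar>K\<bar> * ((C * h ^ k) * (E * h ^ l))"
          using elim t C(1) by (intro mult_left_mono mult_mono) auto
        finally show "norm (X t h) \<le> \<bar>K\<bar> * (C * E) * h ^ (k + l)" by (simp add: power_add mult_ac)
      qed
    qed
  qed
qed

lemma uO_cong:
  assumes "uO I k Y" "\<forall>\<^sub>F h in at_right 0. \<forall>t\<in>I. X t h = Y t h"
  shows "uO I k X"
  by (rule uO_norm_le[where K=1, OF _ assms(1)]) (use assms(2) in \<open>auto elim!: eventually_mono\<close>)

text \<open>
  The usual way to use the calculus: exhibit \<open>X\<close> as an expression whose order is evident.
\<close>

lemma uO_eq:
  assumes "uO I k Y" "\<And>t h. t \<in> I \<Longrightarrow> 0 < h \<Longrightarrow> h \<le> 1 \<Longrightarrow> X t h = Y t h"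
  shows "uO I k X"
  by (rule uO_cong[OF assms(1)])
     (use eventually_small[of 1, simplified] assms(2) in \<open>auto elim!: eventually_mono\<close>)

lemma uO_mono: "uO I k X \<Longrightarrow> l \<le> k \<Longrightarrow> uO I l X"
proof -
  assume a: "uO I k X" "l \<le> k"
  obtain C where C: "0 \<le> C" "\<forall>\<^sub>F h in at_right 0. 0 < h \<and> h \<le> 1 \<and> (\<forall>t\<in>I. norm (X t h) \<le> C * h ^ k)"
    using uO_D[OF a(1)] by blast
  from C(2) have "\<forall>\<^sub>F h in at_right 0. \<forall>t\<in>I. norm (X t h) \<le> C * h ^ l"
  proof eventually_elim
    case (elim h)
    have "C * h ^ k \<le> C * h ^ l" using elim C(1) a(2) by (intro mult_left_mono power_decreasing) auto
    then show ?case using elim by (auto intro: order_trans)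
  qed
  then show ?thesis unfolding uO_def by blast
qed

lemma uO_zero: "uO I k (\<lambda>t h. 0)"
  unfolding uO_def by (intro exI[of _ 0]) auto

lemma uO_add:
  assumes "uO I k X" "uO I k Y" shows "uO I k (\<lambda>t h. X t h + Y t h)"
proof -
  obtain C where C: "0 \<le> C" "\<forall>\<^sub>F h in at_right 0. 0 < h \<and> h \<le> 1 \<and> (\<forall>t\<in>I. norm (X t h) \<le> C * h ^ k)"
    using uO_D[OF assms(1)] by blast
  obtain E where E: "0 \<le> E" "\<forall>\<^sub>F h in at_right 0. 0 < h \<and> h \<le> 1 \<and> (\<forall>t\<in>I. norm (Y t h) \<le> E * h ^ k)"
    using uO_D[OF assms(2)] by blast
  have "\<forall>\<^sub>F h in at_right 0. \<forall>t\<in>I. norm (X t h + Y t h) \<le> (C + E) * h ^ k"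
    using C(2) E(2)
  proof eventually_elim
    case (elim h)
    then show ?case by (auto simp: distrib_right intro!: norm_triangle_mono)
  qed
  then show ?thesis unfolding uO_def by blast
qed

lemma uO_scaleR: "uO I k X \<Longrightarrow> uO I k (\<lambda>t h. (c::real) *\<^sub>R X t h)"
  by (rule uO_norm_le[where K="\<bar>c\<bar>"]) auto

lemma uO_minus: "uO I k X \<Longrightarrow> uO I k (\<lambda>t h. - X t h)"
  by (rule uO_norm_le[where K=1]) auto

lemma uO_diff: "uO I k X \<Longrightarrow> uO I k Y \<Longrightarrow> uO I k (\<lambda>t h. X t h - Y t h)"
  using uO_add[OF _ uO_minus, of I k X Y] by simp

lemma uO_sum: "(\<And>i. i \<in> A \<Longrightarrow> uO I k (X i)) \<Longrightarrow> uO I k (\<lambda>t h. \<Sum>i\<in>A. X i t h)"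
proof (induction A rule: infinite_finite_induct)
  case (insert x F)
  then show ?case by (simp add: uO_add)
qed (simp_all add: uO_zero)

lemma uO_power:
  assumes "uO I k X" shows "uO I (m + k) (\<lambda>t h. h ^ m *\<^sub>R X t h)"
proof -
  have "uO I m (\<lambda>t h. h ^ m)"
    unfolding uO_def using eventually_small[of 1, simplified]
    by (intro exI[of _ 1]) (auto elim!: eventually_mono)
  from uO_mult_norm_le[OF _ this assms, of "\<lambda>t h. h ^ m *\<^sub>R X t h" 1] show ?thesis by simp
qed

lemma uO_h:
  assumes "uO I k X" shows "uO I (Suc k) (\<lambda>t h. h *\<^sub>R X t h)"
  using uO_power[OF assms, of 1] by simp

lemma uO_const:
  assumes "bounded (X ` I)" shows "uO I 0 (\<lambda>t h. X t)"
proof -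
  obtain C where "\<And>t. t \<in> I \<Longrightarrow> norm (X t) \<le> C" using assms by (auto simp: bounded_iff)
  then show ?thesis unfolding uO_def by (intro exI[of _ C]) auto
qed

lemma uO_blinfun:
  fixes L :: "'t \<Rightarrow> 'a::real_normed_vector \<Rightarrow>\<^sub>L 'b::real_normed_vector"
  assumes "bounded (L ` I)" "uO I k X" shows "uO I k (\<lambda>t h. L t (X t h))"
proof -
  obtain C where C: "\<And>t. t \<in> I \<Longrightarrow> norm (L t) \<le> C" using assms(1) by (auto simp: bounded_iff)
  have "norm (L t (X t h)) \<le> C * norm (X t h)" if "t \<in> I" for t h
    using C[OF that] by (meson mult_right_mono norm_blinfun norm_ge_zero order_trans)
  then show ?thesis by (intro uO_norm_le[OF _ assms(2), of _ C]) auto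
qed

lemma uO_blinfun2:
  fixes L :: "'t \<Rightarrow> 'a::real_normed_vector \<Rightarrow>\<^sub>L 'b::real_normed_vector \<Rightarrow>\<^sub>L 'c::real_normed_vector"
  assumes "bounded (L ` I)" "uO I k X" "uO I l Y" shows "uO I (k + l) (\<lambda>t h. L t (X t h) (Y t h))"
proof (rule uO_mult_norm_le[OF _ uO_blinfun[OF assms(1,2)] assms(3), of _ 1])
  show "\<forall>\<^sub>F h in at_right 0. \<forall>t\<in>I. norm (L t (X t h) (Y t h)) \<le> 1 * (norm (L t (X t h)) * norm (Y t h))"
    by (simp add: norm_blinfun)
qed

section \<open>Order conditions and stage expansions\<close>

text \<open>
  All coefficient operators are then bounded and linear, also for indices that the method never uses.
\<close>

definition nonneg_scalings :: "exprk \<Rightarrow> bool" where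
  "nonneg_scalings M \<longleftrightarrow> (\<forall>i. 0 \<le> node M i) \<and> (\<forall>i j w k r. (w, k, r) \<in> set (acoef M i j) \<longrightarrow> 0 \<le> r) \<and>
     (\<forall>i w k r. (w, k, r) \<in> set (bcoef M i) \<longrightarrow> 0 \<le> r)"

text \<open>
  Bilinearity over the scalar field for derivatives, which come as nested bounded linear functions.
\<close>

definition blin_over :: "('a::banach) scalars \<Rightarrow> ('a \<Rightarrow>\<^sub>L 'a \<Rightarrow>\<^sub>L 'a) \<Rightarrow> bool" where
  "blin_over \<K> B \<longleftrightarrow> bounded_bilinear_over \<K> (\<lambda>x y. B x y)"

lemma blin_over_flip: "blin_over \<K> B \<Longrightarrow> bounded_bilinear_over \<K> (\<lambda>x y. B y x)"
  unfolding blin_over_def bounded_bilinear_over_def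
  using bounded_bilinear.flip[OF bounded_bilinear_blinfun_apply] bounded_bilinear.flip by blast

context c0_semigroup begin

abbreviation aop :: "exprk \<Rightarrow> real \<Rightarrow> nat \<Rightarrow> nat \<Rightarrow> 'a \<Rightarrow> 'a" where
  "aop M h i j \<equiv> comb_op T h (acoef M i j)"

abbreviation bop :: "exprk \<Rightarrow> real \<Rightarrow> nat \<Rightarrow> 'a \<Rightarrow> 'a" where
  "bop M h i \<equiv> comb_op T h (bcoef M i)"

text \<open>
  \<open>stage_coef\<close> and \<open>nonlin_coef\<close> with index \<open>m\<close> are the coefficients of \<open>h\<^sup>m\<close> in the error of stage \<open>i\<close> and in
  the resulting error of its \<open>g\<close>-value. They are obtained by inserting the power series into
  \<open>E\<^sub>i = \<Sum> h\<^sup>q \<psi>\<^sub>q\<^sub>,\<^sub>i f\<^sub>q\<^sub>-\<^sub>1 + h \<Sum> a\<^sub>i\<^sub>j \<Delta>\<^sub>j\<close> and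
  \<open>\<Delta>\<^sub>i = \<Sum> (c\<^sub>i h)\<^sup>m J\<^sub>m E\<^sub>i + (B\<^sub>0 + c\<^sub>i h B\<^sub>1)(E\<^sub>i, E\<^sub>i)\<close> and sorting by powers of \<open>h\<close>. The coefficients
  depend on \<open>h\<close> through the operators \<open>\<psi>\<^sub>q\<^sub>,\<^sub>i(hA)\<close> and \<open>a\<^sub>i\<^sub>j(hA)\<close>, which remain bounded.
\<close>

definition stage_coef2 where "stage_coef2 M h f i = psi_op T M h 2 i (f (1::nat))"
definition nonlin_coef2 where "nonlin_coef2 M h f J i = blinfun_apply (J (0::nat)) (stage_coef2 M h f i)"
definition stage_coef3 where "stage_coef3 M h f J i = psi_op T M h 3 i (f (2::nat)) + (\<Sum>j=2..<i. aop M h i j (nonlin_coef2 M h f J j))"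
definition nonlin_coef3 where "nonlin_coef3 M h f J i = blinfun_apply (J (0::nat)) (stage_coef3 M h f J i) + node M i *\<^sub>R blinfun_apply (J (1::nat)) (stage_coef2 M h f i)"
definition stage_coef4 where "stage_coef4 M h f J i = psi_op T M h 4 i (f (3::nat)) + (\<Sum>j=2..<i. aop M h i j (nonlin_coef3 M h f J j))"
definition nonlin_coef4 where "nonlin_coef4 M h f J B i = blinfun_apply (J (0::nat)) (stage_coef4 M h f J i) + node M i *\<^sub>R blinfun_apply (J (1::nat)) (stage_coef3 M h f J i)
  + (node M i)\<^sup>2 *\<^sub>R blinfun_apply (J (2::nat)) (stage_coef2 M h f i) + blinfun_apply (blinfun_apply (B (0::nat)) (stage_coef2 M h f i)) (stage_coef2 M h f i)"
definition stage_coef5 where "stage_coef5 M h f J B i = psi_op T M h 5 i (f (4::nat)) + (\<Sum>j=2..<i. aop M h i j (nonlin_coef4 M h f J B j))"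
definition nonlin_coef5 where "nonlin_coef5 M h f J B i = blinfun_apply (J (0::nat)) (stage_coef5 M h f J B i) + node M i *\<^sub>R blinfun_apply (J (1::nat)) (stage_coef4 M h f J i)
  + (node M i)\<^sup>2 *\<^sub>R blinfun_apply (J (2::nat)) (stage_coef3 M h f J i) + (node M i)^3 *\<^sub>R blinfun_apply (J (3::nat)) (stage_coef2 M h f i)
  + blinfun_apply (blinfun_apply (B (0::nat)) (stage_coef2 M h f i)) (stage_coef3 M h f J i) + blinfun_apply (blinfun_apply (B (0::nat)) (stage_coef3 M h f J i)) (stage_coef2 M h f i)
  + node M i *\<^sub>R blinfun_apply (blinfun_apply (B (1::nat)) (stage_coef2 M h f i)) (stage_coef2 M h f i)"

lemma comb_op_linear:
  assumes "nonneg_scalings M" "0 \<le> h"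
  shows aop_add: "aop M h i j (x + y) = aop M h i j x + aop M h i j y"
    and aop_scaleR: "aop M h i j (c *\<^sub>R x) = c *\<^sub>R aop M h i j x"
    and bop_add: "bop M h i (x + y) = bop M h i x + bop M h i y"
    and bop_scaleR: "bop M h i (c *\<^sub>R x) = c *\<^sub>R bop M h i x"
proof -
  have "bounded_linear (aop M h i j)" using assms by (intro comb_op_bounded_linear) (auto simp: nonneg_scalings_def)
  then interpret a: bounded_linear "aop M h i j" .
  have "bounded_linear (bop M h i)" using assms by (intro comb_op_bounded_linear) (auto simp: nonneg_scalings_def)
  then interpret b: bounded_linear "bop M h i" .
  show "aop M h i j (x + y) = aop M h i j x + aop M h i j y" by (rule a.add)
  show "aop M h i j (c *\<^sub>R x) = c *\<^sub>R aop M h i j x" by (rule a.scaleR)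
  show "bop M h i (x + y) = bop M h i x + bop M h i y" by (rule b.add)
  show "bop M h i (c *\<^sub>R x) = c *\<^sub>R bop M h i x" by (rule b.scaleR)
qed

text \<open>
  Multiplying out, each coefficient becomes a sum of expressions from the list of conditions, with
  \<open>J = J\<^sub>0\<close>, \<open>K = J\<^sub>1\<close>, \<open>L \<in> {J\<^sub>2, J\<^sub>3}\<close> and \<open>B \<in> {B\<^sub>0, B\<^sub>1}\<close>. The mixed term in which the arguments of
  \<open>B\<^sub>0\<close> appear in the opposite order is covered by the condition for the flipped bilinear map.
\<close>

lemma order_conditions_cancel:
  fixes J :: "nat \<Rightarrow> 'a \<Rightarrow>\<^sub>L 'a" and B :: "nat \<Rightarrow> 'a \<Rightarrow>\<^sub>L 'a \<Rightarrow>\<^sub>L 'a"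
  assumes nn: "nonneg_scalings M" and h: "0 < h"
    and cond: "stiff_conditions_except_quadrature6 \<K> T M h"
    and J: "\<And>m. m \<le> 3 \<Longrightarrow> bounded_linear_over \<K> (J m)" and B: "\<And>m. m \<le> 1 \<Longrightarrow> blin_over \<K> (B m)"
  shows "(\<Sum>i=2..stages M. bop M h i (nonlin_coef2 M h f J i)) = 0"
    and "(\<Sum>i=2..stages M. bop M h i (nonlin_coef3 M h f J i)) = 0"
    and "(\<Sum>i=2..stages M. bop M h i (nonlin_coef4 M h f J B i)) = 0"
    and "(\<Sum>i=2..stages M. bop M h i (nonlin_coef5 M h f J B i)) = 0"
proof -
  have h0: "0 \<le> h" using h by simp
  note lin = comb_op_linear[OF nn h0]
  note c = cond[unfolded stiff_conditions_except_quadrature6_def Let_def, THEN conjunct2, THEN conjunct2, THEN conjunct2, THEN conjunct2, rule_format]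
  have Js: "bounded_linear_over \<K> (J 0)" "bounded_linear_over \<K> (J 1)" "bounded_linear_over \<K> (J 2)" "bounded_linear_over \<K> (J 3)"
    using J by auto
  have B0: "bounded_bilinear_over \<K> (\<lambda>x y. B 0 x y)" "bounded_bilinear_over \<K> (\<lambda>x y. B 1 x y)" "bounded_bilinear_over \<K> (\<lambda>x y. B 0 y x)"
    using B[of 0] B[of 1] blin_over_flip[of \<K> "B 0"] by (auto simp: blin_over_def)
  note c1 = c[OF conjI[OF Js(1) conjI[OF Js(2) conjI[OF Js(3) B0(1)]]]]
  note c2 = c[OF conjI[OF Js(1) conjI[OF Js(2) conjI[OF Js(4) B0(2)]]], of "f 1" "f 1"]
  note c3 = c[OF conjI[OF Js(1) conjI[OF Js(2) conjI[OF Js(3) B0(3)]]], of "f 1" "f 2"]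
  note c4 = c[OF conjI[OF Js(1) conjI[OF Js(2) conjI[OF Js(3) B0(3)]]], of "f 1" "f 1"]
  note conds = c1[of "f 1" "f 1"] c1[of "f 1" "f 2"] c1[of "f 2" "f 1"] c1[of "f 3" "f 1"] c1[of "f 4" "f 1"] c2 c3 c4
  note defs = stage_coef2_def stage_coef3_def stage_coef4_def stage_coef5_def nonlin_coef2_def nonlin_coef3_def nonlin_coef4_def nonlin_coef5_def
  note expand = lin blinfun.add_right blinfun.scaleR_right blinfun.add_left blinfun.scaleR_left sum.distrib scaleR_add_right
  show "(\<Sum>i=2..stages M. bop M h i (nonlin_coef2 M h f J i)) = 0"
    unfolding defs by (simp only: expand conds add_0_right)
  show "(\<Sum>i=2..stages M. bop M h i (nonlin_coef3 M h f J i)) = 0"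
    unfolding defs by (simp only: expand conds add_0_right)
  show "(\<Sum>i=2..stages M. bop M h i (nonlin_coef4 M h f J B i)) = 0"
    unfolding defs by (simp only: expand conds add_0_right)
  show "(\<Sum>i=2..stages M. bop M h i (nonlin_coef5 M h f J B i)) = 0"
    unfolding defs by (simp only: expand conds add_0_right)
qed

end

context c0_semigroup begin

lemma uO_comb_op:
  assumes "\<And>w k r. (w, k, r) \<in> set p \<Longrightarrow> 0 \<le> r" "uO I m X"
  shows "uO I m (\<lambda>t h. comb_op T h p (X t h))"
proof -
  obtain C where "0 \<le> C" "\<And>h x. 0 \<le> h \<Longrightarrow> h \<le> 1 \<Longrightarrow> norm (comb_op T h p x) \<le> C * norm x"
    using comb_op_bound assms(1) by blast
  then have "\<forall>\<^sub>F h in at_right 0. \<forall>t\<in>I. norm (comb_op T h p (X t h)) \<le> C * norm (X t h)"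
    using eventually_small[of 1, simplified] by (auto elim!: eventually_mono)
  from uO_norm_le[OF this assms(2)] show ?thesis .
qed

lemma uO_phi_op:
  assumes "0 \<le> r" "uO I m X"
  shows "uO I m (\<lambda>t h. phi_op T k (r * h) (X t h))"
proof -
  have "uO I m (\<lambda>t h. comb_op T h [(1, k, r)] (X t h))"
    using assms by (intro uO_comb_op) auto
  then show ?thesis by (simp add: comb_op_def)
qed

lemma uO_T:
  assumes "0 \<le> r" "uO I m X"
  shows "uO I m (\<lambda>t h. T (r * h) (X t h))"
proof -
  obtain C where C: "1 \<le> C" "\<And>t. 0 \<le> t \<Longrightarrow> t \<le> r \<Longrightarrow> norm (T t) \<le> C" using T_locally_bounded by blast
  have "norm (T (r * h) (X t h)) \<le> C * norm (X t h)" if "0 < h" "h \<le> 1" for t h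
    using that assms(1) by (intro T_apply_bound[OF C(2)]) (auto simp: mult_left_le)
  then have "\<forall>\<^sub>F h in at_right 0. \<forall>t\<in>I. norm (T (r * h) (X t h)) \<le> C * norm (X t h)"
    using eventually_small[of 1, simplified] by (auto elim!: eventually_mono)
  from uO_norm_le[OF this assms(2)] show ?thesis .
qed

lemma uO_aop: "nonneg_scalings M \<Longrightarrow> uO I m X \<Longrightarrow> uO I m (\<lambda>t h. aop M h i j (X t h))"
  by (rule uO_comb_op) (auto simp: nonneg_scalings_def)

lemma uO_bop: "nonneg_scalings M \<Longrightarrow> uO I m X \<Longrightarrow> uO I m (\<lambda>t h. bop M h i (X t h))"
  by (rule uO_comb_op) (auto simp: nonneg_scalings_def)

lemma uO_psi_op:
  assumes "nonneg_scalings M" "uO I m X"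
  shows "uO I m (\<lambda>t h. psi_op T M h q i (X t h))"
  unfolding psi_op_def using assms
  by (intro uO_diff uO_sum uO_scaleR uO_aop uO_phi_op) (auto simp: nonneg_scalings_def)

lemma aop_diff: "nonneg_scalings M \<Longrightarrow> 0 \<le> h \<Longrightarrow> aop M h i j (x - y) = aop M h i j x - aop M h i j y"
  using aop_add[of M h i j x "- 1 *\<^sub>R y"] aop_scaleR[of M h i j "- 1" y] by simp

lemma bop_diff: "nonneg_scalings M \<Longrightarrow> 0 \<le> h \<Longrightarrow> bop M h i (x - y) = bop M h i x - bop M h i y"
  using bop_add[of M h i x "- 1 *\<^sub>R y"] bop_scaleR[of M h i "- 1" y] by simp

text \<open>
  By induction on the stage, the errors agree with their truncated series up to \<open>O(h\<^sup>6)\<close>; since \<open>E\<^sub>i\<close>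
  starts with \<open>h\<^sup>2\<close>, the terms kept in the expansion of \<open>\<Delta>\<^sub>i\<close> account for everything below \<open>h\<^sup>6\<close>. The
  weighted sum of the truncated series vanishes by the order conditions.
\<close>

lemma stage_expansion:
  fixes I :: "'t set" and f :: "nat \<Rightarrow> 't \<Rightarrow> 'a" and J :: "nat \<Rightarrow> 't \<Rightarrow> 'a \<Rightarrow>\<^sub>L 'a"
    and B :: "nat \<Rightarrow> 't \<Rightarrow> 'a \<Rightarrow>\<^sub>L 'a \<Rightarrow>\<^sub>L 'a" and E \<Delta> :: "nat \<Rightarrow> 't \<Rightarrow> real \<Rightarrow> 'a"
  assumes nn: "nonneg_scalings M"
    and cond: "\<And>h. 0 < h \<Longrightarrow> stiff_conditions_except_quadrature6 \<K> T M h"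
    and fb: "\<And>q. q \<le> 5 \<Longrightarrow> bounded (f q ` I)"
    and Jb: "\<And>m. m \<le> 3 \<Longrightarrow> bounded (J m ` I)" and Bb: "\<And>m. m \<le> 1 \<Longrightarrow> bounded (B m ` I)"
    and J: "\<And>m t. m \<le> 3 \<Longrightarrow> t \<in> I \<Longrightarrow> bounded_linear_over \<K> (J m t)"
    and B: "\<And>m t. m \<le> 1 \<Longrightarrow> t \<in> I \<Longrightarrow> blin_over \<K> (B m t)"
    and E: "\<And>i. i \<in> {2..stages M} \<Longrightarrow> uO I 6 (\<lambda>t h. E i t h -
        (h ^ 2 *\<^sub>R psi_op T M h 2 i (f 1 t) + h ^ 3 *\<^sub>R psi_op T M h 3 i (f 2 t)
         + h ^ 4 *\<^sub>R psi_op T M h 4 i (f 3 t) + h ^ 5 *\<^sub>R psi_op T M h 5 i (f 4 t)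
         + h *\<^sub>R (\<Sum>j=2..<i. aop M h i j (\<Delta> j t h))))"
    and \<Delta>: "\<And>i. i \<in> {2..stages M} \<Longrightarrow> uO I 2 (E i) \<Longrightarrow> uO I 6 (\<lambda>t h. \<Delta> i t h -
        (J 0 t (E i t h) + (node M i * h) *\<^sub>R J 1 t (E i t h) + (node M i * h)\<^sup>2 *\<^sub>R J 2 t (E i t h)
         + (node M i * h) ^ 3 *\<^sub>R J 3 t (E i t h)
         + B 0 t (E i t h) (E i t h) + (node M i * h) *\<^sub>R B 1 t (E i t h) (E i t h)))"
  shows "uO I 7 (\<lambda>t h. h *\<^sub>R (\<Sum>i=2..stages M. bop M h i (\<Delta> i t h)))"
proof -
  define e2 where "e2 i t h = stage_coef2 M h (\<lambda>q. f q t) i" for i t h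
  define e3 where "e3 i t h = stage_coef3 M h (\<lambda>q. f q t) (\<lambda>m. J m t) i" for i t h
  define e4 where "e4 i t h = stage_coef4 M h (\<lambda>q. f q t) (\<lambda>m. J m t) i" for i t h
  define e5 where "e5 i t h = stage_coef5 M h (\<lambda>q. f q t) (\<lambda>m. J m t) (\<lambda>m. B m t) i" for i t h
  define d2 where "d2 i t h = nonlin_coef2 M h (\<lambda>q. f q t) (\<lambda>m. J m t) i" for i t h
  define d3 where "d3 i t h = nonlin_coef3 M h (\<lambda>q. f q t) (\<lambda>m. J m t) i" for i t h
  define d4 where "d4 i t h = nonlin_coef4 M h (\<lambda>q. f q t) (\<lambda>m. J m t) (\<lambda>m. B m t) i" for i t h
  define d5 where "d5 i t h = nonlin_coef5 M h (\<lambda>q. f q t) (\<lambda>m. J m t) (\<lambda>m. B m t) i" for i t h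
  let ?c = "node M"
  have e2: "e2 i t h = psi_op T M h 2 i (f 1 t)" for i t h by (simp add: e2_def stage_coef2_def)
  have d2: "d2 i t h = J 0 t (e2 i t h)" for i t h by (simp add: d2_def nonlin_coef2_def e2_def)
  have e3: "e3 i t h = psi_op T M h 3 i (f 2 t) + (\<Sum>j=2..<i. aop M h i j (d2 j t h))" for i t h
    by (simp add: e3_def stage_coef3_def d2_def)
  have d3: "d3 i t h = J 0 t (e3 i t h) + ?c i *\<^sub>R J 1 t (e2 i t h)" for i t h
    by (simp add: d3_def nonlin_coef3_def e2_def e3_def)
  have e4: "e4 i t h = psi_op T M h 4 i (f 3 t) + (\<Sum>j=2..<i. aop M h i j (d3 j t h))" for i t h
    by (simp add: e4_def stage_coef4_def d3_def)
  have d4: "d4 i t h = J 0 t (e4 i t h) + ?c i *\<^sub>R J 1 t (e3 i t h) + (?c i)\<^sup>2 *\<^sub>R J 2 t (e2 i t h)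
      + B 0 t (e2 i t h) (e2 i t h)" for i t h
    by (simp add: d4_def nonlin_coef4_def e2_def e3_def e4_def)
  have e5: "e5 i t h = psi_op T M h 5 i (f 4 t) + (\<Sum>j=2..<i. aop M h i j (d4 j t h))" for i t h
    by (simp add: e5_def stage_coef5_def d4_def)
  have d5: "d5 i t h = J 0 t (e5 i t h) + ?c i *\<^sub>R J 1 t (e4 i t h) + (?c i)\<^sup>2 *\<^sub>R J 2 t (e3 i t h)
      + (?c i) ^ 3 *\<^sub>R J 3 t (e2 i t h) + B 0 t (e2 i t h) (e3 i t h) + B 0 t (e3 i t h) (e2 i t h)
      + ?c i *\<^sub>R B 1 t (e2 i t h) (e2 i t h)" for i t h
    by (simp add: d5_def nonlin_coef5_def e2_def e3_def e4_def e5_def)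
  have JO: "uO I k (\<lambda>t h. J 0 t (X t h))" "uO I k (\<lambda>t h. J 1 t (X t h))"
    "uO I k (\<lambda>t h. J 2 t (X t h))" "uO I k (\<lambda>t h. J 3 t (X t h))" if "uO I k X" for k X
    using that Jb by (auto intro!: uO_blinfun)
  have BO: "uO I (k + l) (\<lambda>t h. B 0 t (X t h) (Y t h))" "uO I (k + l) (\<lambda>t h. B 1 t (X t h) (Y t h))"
    if "uO I k X" "uO I l Y" for k l X Y
    using that Bb by (auto intro!: uO_blinfun2)
  have BO0: "uO I 0 (\<lambda>t h. B 0 t (X t h) (Y t h))" "uO I 0 (\<lambda>t h. B 1 t (X t h) (Y t h))"
    if "uO I 0 X" "uO I 0 Y" for X Y
    using BO[OF that] by auto
  have fO: "uO I 0 (\<lambda>t h. psi_op T M h q i (f p t))" if "p \<le> 5" for q i p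
    using fb[OF that] by (intro uO_psi_op nn uO_const)
  have O2: "uO I 0 (e2 i)" "uO I 0 (d2 i)" for i
  proof -
    show a: "uO I 0 (e2 i)" for i unfolding e2[abs_def] by (intro fO) auto
    show "uO I 0 (d2 i)" unfolding d2[abs_def] by (intro JO a)
  qed
  have O3: "uO I 0 (e3 i)" "uO I 0 (d3 i)" for i
  proof -
    show a: "uO I 0 (e3 i)" for i unfolding e3[abs_def] by (intro uO_add uO_sum uO_aop nn fO O2) auto
    show "uO I 0 (d3 i)" unfolding d3[abs_def] by (intro uO_add uO_scaleR JO a O2)
  qed
  have O4: "uO I 0 (e4 i)" "uO I 0 (d4 i)" for i
  proof -
    show a: "uO I 0 (e4 i)" for i unfolding e4[abs_def] by (intro uO_add uO_sum uO_aop nn fO O3) auto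
    show "uO I 0 (d4 i)" unfolding d4[abs_def] by (intro uO_add uO_scaleR JO BO0 a O2 O3)
  qed
  have O5: "uO I 0 (e5 i)" "uO I 0 (d5 i)" for i
  proof -
    show a: "uO I 0 (e5 i)" for i unfolding e5[abs_def] by (intro uO_add uO_sum uO_aop nn fO O4) auto
    show "uO I 0 (d5 i)" unfolding d5[abs_def] by (intro uO_add uO_scaleR JO BO0 a O2 O3 O4)
  qed
  define Eh where "Eh i t h = h ^ 2 *\<^sub>R e2 i t h + h ^ 3 *\<^sub>R e3 i t h + h ^ 4 *\<^sub>R e4 i t h + h ^ 5 *\<^sub>R e5 i t h" for i t h
  define Dh where "Dh i t h = h ^ 2 *\<^sub>R d2 i t h + h ^ 3 *\<^sub>R d3 i t h + h ^ 4 *\<^sub>R d4 i t h + h ^ 5 *\<^sub>R d5 i t h" for i t h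
  have pw: "uO I (m + n) (\<lambda>t h. h ^ m *\<^sub>R X t h)" if "uO I n X" for m n X
    using uO_power[OF that] .
  have pwm: "uO I k (\<lambda>t h. h ^ m *\<^sub>R X t h)" if "uO I 0 X" "k \<le> m" for k m X
    using uO_mono[OF uO_power[OF that(1), of m]] that(2) by simp
  have Eh2: "uO I 2 (Eh i)" for i
    unfolding Eh_def[abs_def] by (intro uO_add pwm O2 O3 O4 O5) auto
  have main: "uO I 6 (\<lambda>t h. \<Delta> i t h - Dh i t h)" if "i \<in> {2..stages M}" for i
    using that
  proof (induction i rule: less_induct)
    case (less i)
    have IH: "uO I 6 (\<lambda>t h. \<Delta> j t h - Dh j t h)" if "j \<in> {2..<i}" for j
      using less that by auto
    define R where "R t h = E i t h - Eh i t h" for t h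
    have R: "uO I 6 R"
    proof (rule uO_eq)
      show "uO I 6 (\<lambda>t h. (E i t h -
        (h ^ 2 *\<^sub>R psi_op T M h 2 i (f 1 t) + h ^ 3 *\<^sub>R psi_op T M h 3 i (f 2 t)
         + h ^ 4 *\<^sub>R psi_op T M h 4 i (f 3 t) + h ^ 5 *\<^sub>R psi_op T M h 5 i (f 4 t)
         + h *\<^sub>R (\<Sum>j=2..<i. aop M h i j (\<Delta> j t h))))
         + (h *\<^sub>R (\<Sum>j=2..<i. aop M h i j (\<Delta> j t h - Dh j t h)) + h ^ 6 *\<^sub>R (\<Sum>j=2..<i. aop M h i j (d5 j t h))))"
      proof (intro uO_add E less)
        show "uO I 6 (\<lambda>t h. h *\<^sub>R (\<Sum>j=2..<i. aop M h i j (\<Delta> j t h - Dh j t h)))"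
          by (intro uO_mono[OF uO_h[where k=6]] uO_sum uO_aop nn IH) auto
        show "uO I 6 (\<lambda>t h. h ^ 6 *\<^sub>R (\<Sum>j=2..<i. aop M h i j (d5 j t h)))"
          by (intro pwm uO_sum uO_aop nn O5) auto
      qed
      fix t h :: "_" assume "t \<in> I" and h: "0 < h" "h \<le> (1::real)"
      have h0: "0 \<le> h" using h by simp
      have "(\<Sum>j=2..<i. aop M h i j (\<Delta> j t h - Dh j t h)) = (\<Sum>j=2..<i. aop M h i j (\<Delta> j t h))
        - (h ^ 2 *\<^sub>R (\<Sum>j=2..<i. aop M h i j (d2 j t h)) + h ^ 3 *\<^sub>R (\<Sum>j=2..<i. aop M h i j (d3 j t h))
          + h ^ 4 *\<^sub>R (\<Sum>j=2..<i. aop M h i j (d4 j t h)) + h ^ 5 *\<^sub>R (\<Sum>j=2..<i. aop M h i j (d5 j t h)))"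
        unfolding Dh_def
        by (simp only: aop_diff[OF nn h0] aop_add[OF nn h0] aop_scaleR[OF nn h0] sum.distrib sum_subtractf scaleR_sum_right)
      note S = this
      have "h *\<^sub>R (\<Sum>j=2..<i. aop M h i j (\<Delta> j t h - Dh j t h)) = h *\<^sub>R (\<Sum>j=2..<i. aop M h i j (\<Delta> j t h))
        - (h ^ 3 *\<^sub>R (\<Sum>j=2..<i. aop M h i j (d2 j t h)) + h ^ 4 *\<^sub>R (\<Sum>j=2..<i. aop M h i j (d3 j t h))
          + h ^ 5 *\<^sub>R (\<Sum>j=2..<i. aop M h i j (d4 j t h)) + h ^ 6 *\<^sub>R (\<Sum>j=2..<i. aop M h i j (d5 j t h)))"
        unfolding S by (simp add: scaleR_diff_right scaleR_add_right power_numeral_reduce)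
      then show "R t h = (E i t h -
        (h ^ 2 *\<^sub>R psi_op T M h 2 i (f 1 t) + h ^ 3 *\<^sub>R psi_op T M h 3 i (f 2 t)
         + h ^ 4 *\<^sub>R psi_op T M h 4 i (f 3 t) + h ^ 5 *\<^sub>R psi_op T M h 5 i (f 4 t)
         + h *\<^sub>R (\<Sum>j=2..<i. aop M h i j (\<Delta> j t h))))
         + (h *\<^sub>R (\<Sum>j=2..<i. aop M h i j (\<Delta> j t h - Dh j t h)) + h ^ 6 *\<^sub>R (\<Sum>j=2..<i. aop M h i j (d5 j t h)))"
        unfolding R_def Eh_def e2[of i] e3[of i] e4[of i] e5[of i] by (simp add: scaleR_add_right)
    qed
    have Eeq: "E i t h = Eh i t h + R t h" for t h by (simp add: R_def)
    have E2: "uO I 2 (E i)"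
      unfolding Eeq[abs_def] by (intro uO_add Eh2 uO_mono[OF R]) simp
    note \<Delta>6 = \<Delta>[OF less.prems E2]
    have r0: "uO I 6 (\<lambda>t h. J 0 t (E i t h)
        - (h^2 *\<^sub>R J 0 t (e2 i t h) + h^3 *\<^sub>R J 0 t (e3 i t h) + h^4 *\<^sub>R J 0 t (e4 i t h) + h^5 *\<^sub>R J 0 t (e5 i t h)))"
    proof (rule uO_eq)
      show "uO I 6 (\<lambda>t h. J 0 t (R t h))" by (intro JO R)
    qed (simp add: Eeq Eh_def blinfun.add_right blinfun.scaleR_right)
    have r1: "uO I 6 (\<lambda>t h. (?c i * h) *\<^sub>R J 1 t (E i t h)
        - (h^3 *\<^sub>R (?c i *\<^sub>R J 1 t (e2 i t h)) + h^4 *\<^sub>R (?c i *\<^sub>R J 1 t (e3 i t h)) + h^5 *\<^sub>R (?c i *\<^sub>R J 1 t (e4 i t h))))"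
    proof (rule uO_eq)
      show "uO I 6 (\<lambda>t h. ?c i *\<^sub>R (h ^ 6 *\<^sub>R J 1 t (e5 i t h) + h *\<^sub>R J 1 t (R t h)))"
        by (intro uO_scaleR uO_add pwm JO O5 uO_mono[OF uO_h[OF JO(2)[OF R]]]) auto
    qed (simp add: Eeq Eh_def blinfun.add_right blinfun.scaleR_right scaleR_add_right power_numeral_reduce mult_ac)
    have r2: "uO I 6 (\<lambda>t h. (?c i * h)\<^sup>2 *\<^sub>R J 2 t (E i t h)
        - (h^4 *\<^sub>R ((?c i)\<^sup>2 *\<^sub>R J 2 t (e2 i t h)) + h^5 *\<^sub>R ((?c i)\<^sup>2 *\<^sub>R J 2 t (e3 i t h))))"
    proof (rule uO_eq)
      show "uO I 6 (\<lambda>t h. (?c i)\<^sup>2 *\<^sub>R (h ^ 6 *\<^sub>R J 2 t (e4 i t h) + (h ^ 7 *\<^sub>R J 2 t (e5 i t h) + h ^ 2 *\<^sub>R J 2 t (R t h))))"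
        by (intro uO_scaleR uO_add pwm JO O4 O5 uO_mono[OF pw[OF JO(3)[OF R]]]) auto
    qed (simp add: Eeq Eh_def blinfun.add_right blinfun.scaleR_right scaleR_add_right power_numeral_reduce mult_ac)
    have r3: "uO I 6 (\<lambda>t h. (?c i * h) ^ 3 *\<^sub>R J 3 t (E i t h) - h^5 *\<^sub>R ((?c i) ^ 3 *\<^sub>R J 3 t (e2 i t h)))"
    proof (rule uO_eq)
      show "uO I 6 (\<lambda>t h. (?c i) ^ 3 *\<^sub>R (h ^ 6 *\<^sub>R J 3 t (e3 i t h) + (h ^ 7 *\<^sub>R J 3 t (e4 i t h)
          + (h ^ 8 *\<^sub>R J 3 t (e5 i t h) + h ^ 3 *\<^sub>R J 3 t (R t h)))))"
        by (intro uO_scaleR uO_add pwm JO O3 O4 O5 uO_mono[OF pw[OF JO(4)[OF R]]]) auto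
    qed (simp add: Eeq Eh_def blinfun.add_right blinfun.scaleR_right scaleR_add_right power_numeral_reduce mult_ac)
    \<comment> \<open>For the two bilinear terms the series is cut after \<open>h\<^sup>3\<close> and \<open>h\<^sup>2\<close>, respectively.\<close>
    define P where "P t h = h^2 *\<^sub>R e2 i t h + h^3 *\<^sub>R e3 i t h" for t h
    define Q where "Q t h = h^4 *\<^sub>R e4 i t h + (h^5 *\<^sub>R e5 i t h + R t h)" for t h
    have EPQ: "E i t h = P t h + Q t h" for t h by (simp add: Eeq Eh_def P_def Q_def)
    have P2: "uO I 2 P" unfolding P_def[abs_def] by (intro uO_add pwm O2 O3) auto
    have Q4: "uO I 4 Q" unfolding Q_def[abs_def] by (intro uO_add pwm O4 O5 uO_mono[OF R]) auto
    have rB0: "uO I 6 (\<lambda>t h. B 0 t (E i t h) (E i t h)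
        - (h^4 *\<^sub>R B 0 t (e2 i t h) (e2 i t h) + h^5 *\<^sub>R B 0 t (e2 i t h) (e3 i t h) + h^5 *\<^sub>R B 0 t (e3 i t h) (e2 i t h)))"
    proof (rule uO_eq)
      show "uO I 6 (\<lambda>t h. h ^ 6 *\<^sub>R B 0 t (e3 i t h) (e3 i t h) + (B 0 t (P t h) (Q t h) + B 0 t (Q t h) (E i t h)))"
        using BO(1)[OF P2 Q4] BO(1)[OF Q4 E2]
        by (intro uO_add pwm BO0 O3) auto
      fix t h
      have "B 0 t (E i t h) (E i t h) = B 0 t (P t h) (P t h) + (B 0 t (P t h) (Q t h) + B 0 t (Q t h) (E i t h))"
        by (simp add: EPQ blinfun.add_left blinfun.add_right)
      then show "B 0 t (E i t h) (E i t h)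
        - (h^4 *\<^sub>R B 0 t (e2 i t h) (e2 i t h) + h^5 *\<^sub>R B 0 t (e2 i t h) (e3 i t h) + h^5 *\<^sub>R B 0 t (e3 i t h) (e2 i t h))
        = h ^ 6 *\<^sub>R B 0 t (e3 i t h) (e3 i t h) + (B 0 t (P t h) (Q t h) + B 0 t (Q t h) (E i t h))"
        by (simp add: P_def blinfun.add_left blinfun.add_right blinfun.scaleR_left blinfun.scaleR_right
             scaleR_add_right power_numeral_reduce mult_ac)
    qed
    define P' where "P' t h = h^2 *\<^sub>R e2 i t h" for t h
    define Q' where "Q' t h = h^3 *\<^sub>R e3 i t h + (h^4 *\<^sub>R e4 i t h + (h^5 *\<^sub>R e5 i t h + R t h))" for t h
    have EPQ': "E i t h = P' t h + Q' t h" for t h by (simp add: Eeq Eh_def P'_def Q'_def)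
    have P2': "uO I 2 P'" unfolding P'_def[abs_def] by (intro pwm O2) auto
    have Q3': "uO I 3 Q'" unfolding Q'_def[abs_def] by (intro uO_add pwm O3 O4 O5 uO_mono[OF R]) auto
    have rB1: "uO I 6 (\<lambda>t h. (?c i * h) *\<^sub>R B 1 t (E i t h) (E i t h) - h^5 *\<^sub>R (?c i *\<^sub>R B 1 t (e2 i t h) (e2 i t h)))"
    proof (rule uO_eq)
      show "uO I 6 (\<lambda>t h. ?c i *\<^sub>R (h *\<^sub>R (B 1 t (P' t h) (Q' t h) + B 1 t (Q' t h) (E i t h))))"
        using uO_h[OF uO_add[OF BO(2)[OF P2' Q3'] BO(2)[OF Q3' E2, simplified add.commute[of 3 2]]]]
        by (intro uO_scaleR) simp
      fix t h
      have "B 1 t (E i t h) (E i t h) = B 1 t (P' t h) (P' t h) + (B 1 t (P' t h) (Q' t h) + B 1 t (Q' t h) (E i t h))"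
        by (simp add: EPQ' blinfun.add_left blinfun.add_right)
      then show "(?c i * h) *\<^sub>R B 1 t (E i t h) (E i t h) - h^5 *\<^sub>R (?c i *\<^sub>R B 1 t (e2 i t h) (e2 i t h))
        = ?c i *\<^sub>R (h *\<^sub>R (B 1 t (P' t h) (Q' t h) + B 1 t (Q' t h) (E i t h)))"
        by (simp add: P'_def blinfun.scaleR_left blinfun.scaleR_right
             scaleR_add_right power_numeral_reduce mult_ac)
    qed
    note total = uO_add[OF \<Delta>6 uO_add[OF r0 uO_add[OF r1 uO_add[OF r2 uO_add[OF r3 uO_add[OF rB0 rB1]]]]]]
    show ?case
      by (rule uO_eq[OF total]) (simp add: Dh_def d2 d3 d4 d5 scaleR_add_right)
  qed
  show ?thesis
  proof (rule uO_eq)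
    show "uO I 7 (\<lambda>t h. h *\<^sub>R (\<Sum>i=2..stages M. bop M h i (\<Delta> i t h - Dh i t h)))"
      using uO_h[OF uO_sum[of "{2..stages M}" I 6 "\<lambda>i t h. bop M h i (\<Delta> i t h - Dh i t h)", OF uO_bop[OF nn main]]]
      by simp
    fix t h assume t: "t \<in> I" and h: "0 < h" "h \<le> (1::real)"
    have h0: "0 \<le> h" using h by simp
    have Jt: "\<And>m. m \<le> 3 \<Longrightarrow> bounded_linear_over \<K> (J m t)" and Bt: "\<And>m. m \<le> 1 \<Longrightarrow> blin_over \<K> (B m t)"
      using J B t by auto
    note oc = order_conditions_cancel[where J="\<lambda>m. J m t" and B="\<lambda>m. B m t" and f="\<lambda>q. f q t",
      OF nn h(1) cond[OF h(1)] Jt Bt, folded d2_def d3_def d4_def d5_def]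
    have "(\<Sum>i=2..stages M. bop M h i (Dh i t h)) = h ^ 2 *\<^sub>R (\<Sum>i=2..stages M. bop M h i (d2 i t h)) + h ^ 3 *\<^sub>R (\<Sum>i=2..stages M. bop M h i (d3 i t h))
          + h ^ 4 *\<^sub>R (\<Sum>i=2..stages M. bop M h i (d4 i t h)) + h ^ 5 *\<^sub>R (\<Sum>i=2..stages M. bop M h i (d5 i t h))"
      unfolding Dh_def
      by (simp only: bop_add[OF nn h0] bop_scaleR[OF nn h0] sum.distrib scaleR_sum_right)
    also have "\<dots> = 0" by (simp add: oc)
    finally show "h *\<^sub>R (\<Sum>i=2..stages M. bop M h i (\<Delta> i t h)) = h *\<^sub>R (\<Sum>i=2..stages M. bop M h i (\<Delta> i t h - Dh i t h))"
      by (simp add: bop_diff[OF nn h0] sum_subtractf)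
  qed
qed

end

section \<open>Smooth data along an extended solution\<close>

lemma boundedly_differentiable_mono: "boundedly_differentiable n I F \<Longrightarrow> m \<le> n \<Longrightarrow> boundedly_differentiable m I F"
proof (induction n)
  case (Suc n)
  then show ?case using boundedly_differentiable_SucD by (cases "m = Suc n") auto
qed simp

text \<open>
  The derivative of \<open>G \<circ> u\<close> is the bilinear expression \<open>G'(u) u'\<close>, so the smoothness of \<open>G' \<circ> u\<close> and \<open>u\<close>
  carries over with one order more. Boundedness of \<open>G \<circ> u\<close> itself is due to compactness of the interval.
\<close>

lemma boundedly_differentiable_compose:
  fixes G :: "'a::real_normed_vector \<Rightarrow> 'b::real_normed_vector"
  assumes u: "boundedly_differentiable (Suc n) {a..b} u"
    and G: "\<And>t. t \<in> {a..b} \<Longrightarrow> (G has_derivative blinfun_apply (G1 (u t))) (at (u t))"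
    and G1: "boundedly_differentiable n {a..b} (\<lambda>t. G1 (u t))"
  shows "boundedly_differentiable (Suc n) {a..b} (\<lambda>t. G (u t))"
proof -
  from u obtain u' where "\<forall>t\<in>{a..b}. (u has_vector_derivative u' t) (at t within {a..b})" "boundedly_differentiable n {a..b} u'"
    by auto
  then have u': "\<And>t. t \<in> {a..b} \<Longrightarrow> (u has_vector_derivative u' t) (at t within {a..b})" "boundedly_differentiable n {a..b} u'"
    by blast+
  have der: "((\<lambda>t. G (u t)) has_vector_derivative G1 (u t) (u' t)) (at t within {a..b})" if t: "t \<in> {a..b}" for t
    using has_derivative_compose[OF u'(1)[OF t, unfolded has_vector_derivative_def] G[OF t]]
    by (simp add: has_vector_derivative_def blinfun.scaleR_right)
  then have "continuous_on {a..b} (\<lambda>t. G (u t))"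
    by (meson continuous_on_eq_continuous_within has_vector_derivative_continuous)
  then have "bounded ((\<lambda>t. G (u t)) ` {a..b})"
    by (intro compact_imp_bounded compact_continuous_image) auto
  moreover have "boundedly_differentiable n {a..b} (\<lambda>t. G1 (u t) (u' t))"
    by (rule boundedly_differentiable_bilinear[OF bounded_bilinear_blinfun_apply G1 u'(2)])
  ultimately show ?thesis
    unfolding boundedly_differentiable.simps(2) using der
    by (intro conjI exI[of _ "\<lambda>t. blinfun_apply (G1 (u t)) (u' t)"] ballI)
qed

text \<open>
  A stage with \<open>c\<^sub>i > 1\<close> looks at the solution beyond the final time. Continuing every derivative by its
  Taylor polynomial at the end point keeps all relations between consecutive derivatives.
\<close>

lemma taylor_extension:
  fixes W :: "nat \<Rightarrow> real \<Rightarrow> 'b::real_normed_vector"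
  assumes ab: "a < b" and d: "0 \<le> d"
    and der: "\<And>k t. k < n \<Longrightarrow> t \<in> {a..b} \<Longrightarrow> (W k has_vector_derivative W (Suc k) t) (at t within {a..b})"
    and bd: "\<And>k t. k \<le> n \<Longrightarrow> t \<in> {a..b} \<Longrightarrow> norm (W k t) \<le> C"
  obtains V C' where "\<And>k t. t \<in> {a..b} \<Longrightarrow> V k t = W k t"
    "\<And>k t. k < n \<Longrightarrow> t \<in> {a..b + d} \<Longrightarrow> (V k has_vector_derivative V (Suc k) t) (at t within {a..b + d})"
    "\<And>k t. k \<le> n \<Longrightarrow> t \<in> {a..b + d} \<Longrightarrow> norm (V k t) \<le> C'"
proof -
  define p where "p k t = (\<Sum>j<Suc (n - k). ((t - b) ^ j / fact j) *\<^sub>R W (k + j) b)" for k t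
  define V where "V k t = (if t \<in> {a..b} then W k t else p k t)" for k t
  have p_b: "p k b = W k b" for k
    by (simp add: p_def lessThan_Suc_eq_insert_0 sum.reindex zero_notin_Suc_image)
  have p_der: "(p k has_vector_derivative p (Suc k) t) (at t within S)" if k: "k < n" for k t S
  proof -
    have n: "n - k = Suc (n - Suc k)" using k by simp
    have 1: "((\<lambda>t. t - b) has_vector_derivative 1) (at t within S)" by (auto intro!: derivative_eq_intros)
    have 2: "((\<lambda>s. \<Sum>j<Suc (n - k). (s ^ j / fact j) *\<^sub>R W (k + j) b) has_vector_derivative
         (\<Sum>j<n - k. ((t - b) ^ j / fact j) *\<^sub>R W (k + Suc j) b)) (at (t - b) within (\<lambda>t. t - b) ` S)"
      by (rule taylor_polynomial_derivative)
    show ?thesis using vector_diff_chain_within[OF 1 2] unfolding p_def o_def n by simp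
  qed
  have V_der: "(V k has_vector_derivative V (Suc k) t) (at t within {a..b + d})" if k: "k < n" and t: "t \<in> {a..b + d}" for k t
    unfolding V_def
  proof (rule has_vector_derivative_If_within_closures[where T="{b..b + d}"])
    show "t \<in> {a..b} \<union> {b..b + d}" "{a..b + d} = {a..b} \<union> {b..b + d}" using t ab d by auto
    have cl: "closure {a..b} \<inter> closure {b..b + d} = {b}" using ab d by auto
    have u1: "{a..b} \<union> {b} = {a..b}" "{b..b + d} \<union> {b} = {b..b + d}" using ab d by auto
    show "(W k has_vector_derivative W (Suc k) t) (at t within {a..b} \<union> closure {a..b} \<inter> closure {b..b + d})"
      if "t \<in> {a..b} \<union> closure {a..b} \<inter> closure {b..b + d}"
      using that der[OF k] unfolding cl u1 by blast
    show "(p k has_vector_derivative p (Suc k) t) (at t within {b..b + d} \<union> closure {a..b} \<inter> closure {b..b + d})"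
      by (rule p_der[OF k])
    show "W k t = p k t" "W (Suc k) t = p (Suc k) t" if "t \<in> closure {a..b}" "t \<in> closure {b..b + d}"
    proof -
      have "t = b" using that cl by blast
      then show "W k t = p k t" "W (Suc k) t = p (Suc k) t" by (simp_all add: p_b)
    qed
  qed
  define C' where "C' = \<bar>C\<bar> + (\<Sum>j<Suc n. d ^ j * \<bar>C\<bar>)"
  have C': "norm (V k t) \<le> C'" if k: "k \<le> n" and t: "t \<in> {a..b + d}" for k t
  proof (cases "t \<in> {a..b}")
    case True
    then have "norm (V k t) \<le> \<bar>C\<bar>" using bd[OF k True] by (simp add: V_def)
    also have "\<dots> \<le> C'"
    proof -
      have "0 \<le> (\<Sum>j<Suc n. d ^ j * \<bar>C\<bar>)" using d by (intro sum_nonneg) auto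
      then show ?thesis by (simp only: C'_def le_add_same_cancel1)
    qed
    finally show ?thesis .
  next
    case False
    have tb: "0 \<le> t - b" "t - b \<le> d" using t False by auto
    have "norm (p k t) \<le> (\<Sum>j<Suc (n - k). d ^ j * \<bar>C\<bar>)"
      unfolding p_def
    proof (rule sum_norm_le)
      fix j assume "j \<in> {..<Suc (n - k)}"
      then have "norm (W (k + j) b) \<le> C" using k ab by (intro bd) auto
      then have "norm (W (k + j) b) \<le> \<bar>C\<bar>" by simp
      moreover have "\<bar>(t - b) ^ j / fact j\<bar> \<le> d ^ j"
      proof -
        have "(t - b) ^ j / fact j \<le> (t - b) ^ j / 1" using tb by (intro divide_left_mono) (auto simp: fact_ge_1)
        also have "\<dots> \<le> d ^ j" using tb by (simp add: power_mono)
        finally show ?thesis using tb by simp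
      qed
      ultimately show "norm (((t - b) ^ j / fact j) *\<^sub>R W (k + j) b) \<le> d ^ j * \<bar>C\<bar>"
        using d by (simp only: norm_scaleR, intro mult_mono) auto
    qed
    also have "\<dots> \<le> (\<Sum>j<Suc n. d ^ j * \<bar>C\<bar>)" using d by (intro sum_mono2) auto
    also have "\<dots> \<le> C'" by (simp add: C'_def)
    finally show ?thesis using False by (auto simp add: V_def)
  qed
  show ?thesis by (rule that[of V, OF _ V_der C']) (auto simp: V_def)
qed

lemma blin_bounded_bilinear:
  fixes B :: "'a::real_normed_vector \<Rightarrow>\<^sub>L 'a \<Rightarrow>\<^sub>L 'a"
  shows "bounded_bilinear (\<lambda>x y. B x y)"
  by (rule bounded_bilinear.comp1[OF bounded_bilinear_blinfun_apply blinfun.bounded_linear_right])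

text \<open>
  The derivative inherits the commutation with \<open>\<iota>\<close> as derivatives within an interval are unique.
\<close>

lemma derivative_linear_over:
  fixes F :: "real \<Rightarrow> 'a::banach \<Rightarrow>\<^sub>L 'a"
  assumes \<K>: "banach_over \<K>" and ab: "a < b" and t: "t \<in> {a..b}"
    and F: "\<And>s. s \<in> {a..b} \<Longrightarrow> bounded_linear_over \<K> (F s)"
    and der: "(F has_vector_derivative F') (at t within {a..b})"
  shows "bounded_linear_over \<K> F'"
proof (cases \<K>)
  case Real_Scalars
  then show ?thesis by (simp add: blinfun.bounded_linear_right)
next
  case (Complex_Scalars \<iota>)
  have \<iota>: "bounded_linear \<iota>" using \<K> Complex_Scalars by (simp add: complex_structure_def)
  have comm: "F s (\<iota> x) = \<iota> (F s x)" if "s \<in> {a..b}" for s x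
    using F[OF that] Complex_Scalars by simp
  have app: "((\<lambda>s. F s x) has_vector_derivative F' x) (at t within {a..b})" for x
    by (rule bounded_linear.has_vector_derivative[OF blinfun.bounded_linear_left der])
  have "F' (\<iota> x) = \<iota> (F' x)" for x
  proof (rule vector_derivative_unique_within_closed_interval[unfolded box_real, OF ab t app])
    have "((\<lambda>s. \<iota> (F s x)) has_vector_derivative \<iota> (F' x)) (at t within {a..b})"
      by (rule bounded_linear.has_vector_derivative[OF \<iota> app])
    then show "((\<lambda>s. F s (\<iota> x)) has_vector_derivative \<iota> (F' x)) (at t within {a..b})"
      by (rule has_vector_derivative_transform[OF t, rotated]) (use comm in auto)
  qed
  then show ?thesis using Complex_Scalars by (simp add: blinfun.bounded_linear_right)
qed

lemma blin_over_Complex: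
  "blin_over (Complex_Scalars \<iota>) B \<longleftrightarrow> (\<forall>x y. B x (\<iota> y) = \<iota> (B x y)) \<and> (\<forall>x y. B (\<iota> x) y = \<iota> (B x y))"
  by (auto simp: blin_over_def bounded_bilinear_over_def blin_bounded_bilinear blinfun.bounded_linear_right
     bounded_bilinear.bounded_linear_left[OF blin_bounded_bilinear])

lemma blin_over_Real: "blin_over Real_Scalars B"
  by (auto simp: blin_over_def bounded_bilinear_over_def blin_bounded_bilinear blinfun.bounded_linear_right
     bounded_bilinear.bounded_linear_left[OF blin_bounded_bilinear])

lemma derivative_blin_over:
  fixes F :: "real \<Rightarrow> 'a::banach \<Rightarrow>\<^sub>L 'a \<Rightarrow>\<^sub>L 'a"
  assumes \<K>: "banach_over \<K>" and ab: "a < b" and t: "t \<in> {a..b}"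
    and F: "\<And>s. s \<in> {a..b} \<Longrightarrow> blin_over \<K> (F s)"
    and der: "(F has_vector_derivative F') (at t within {a..b})"
  shows "blin_over \<K> F'"
proof (cases \<K>)
  case Real_Scalars
  then show ?thesis by (simp add: blin_over_Real)
next
  case (Complex_Scalars \<iota>)
  have \<iota>: "bounded_linear \<iota>" using \<K> Complex_Scalars by (simp add: complex_structure_def)
  have comm: "F s x (\<iota> y) = \<iota> (F s x y)" "F s (\<iota> x) y = \<iota> (F s x y)" if "s \<in> {a..b}" for s x y
    using F[OF that] Complex_Scalars by (auto simp: blin_over_Complex)
  have app: "((\<lambda>s. F s x y) has_vector_derivative F' x y) (at t within {a..b})" for x y
    by (rule bounded_linear.has_vector_derivative[OF blinfun.bounded_linear_left
        bounded_linear.has_vector_derivative[OF blinfun.bounded_linear_left der]])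
  have i: "((\<lambda>s. \<iota> (F s x y)) has_vector_derivative \<iota> (F' x y)) (at t within {a..b})" for x y
    by (rule bounded_linear.has_vector_derivative[OF \<iota> app])
  have "F' x (\<iota> y) = \<iota> (F' x y)" for x y
    by (rule vector_derivative_unique_within_closed_interval[unfolded box_real, OF ab t app],
        rule has_vector_derivative_transform[OF t _ i]) (use comm in auto)
  moreover have "F' (\<iota> x) y = \<iota> (F' x y)" for x y
    by (rule vector_derivative_unique_within_closed_interval[unfolded box_real, OF ab t app],
        rule has_vector_derivative_transform[OF t _ i]) (use comm in auto)
  ultimately show ?thesis using Complex_Scalars by (simp add: blin_over_Complex)
qed

text \<open>
  The second argument is treated by differentiating the commutation of \<open>g'(p)\<close> with \<open>\<iota>\<close>, and the first
  argument by symmetry.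
\<close>

lemma second_derivative_blin_over:
  fixes g :: "'a::banach \<Rightarrow> 'a"
  assumes \<K>: "banach_over \<K>" and S: "open S" "x \<in> S"
    and g: "\<And>p. p \<in> S \<Longrightarrow> (g has_derivative blinfun_apply (g1 p)) (at p)"
    and over: "\<And>p. p \<in> S \<Longrightarrow> bounded_linear_over \<K> (blinfun_apply (g1 p))"
    and g1: "(g1 has_derivative blinfun_apply (g2 x)) (at x)"
  shows "blin_over \<K> (g2 x)"
proof (cases \<K>)
  case Real_Scalars
  then show ?thesis by (simp add: blin_over_Real)
next
  case (Complex_Scalars \<iota>)
  have \<iota>: "bounded_linear \<iota>" using \<K> Complex_Scalars by (simp add: complex_structure_def)
  have second: "g2 x y (\<iota> z) = \<iota> (g2 x y z)" for y z
  proof -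
    have app: "((\<lambda>p. g1 p z) has_derivative (\<lambda>y. g2 x y z)) (at x)" for z
      by (rule bounded_linear.has_derivative[OF blinfun.bounded_linear_left g1])
    have "((\<lambda>p. \<iota> (g1 p z)) has_derivative (\<lambda>y. \<iota> (g2 x y z))) (at x)"
      by (rule bounded_linear.has_derivative[OF \<iota> app])
    then have "((\<lambda>p. g1 p (\<iota> z)) has_derivative (\<lambda>y. \<iota> (g2 x y z))) (at x)"
      by (rule has_derivative_transform_within_open[OF _ S]) (use over Complex_Scalars in simp)
    from has_derivative_unique[OF app this] show ?thesis by metis
  qed
  have "g2 x (\<iota> y) z = \<iota> (g2 x y z)" for y z
    using second_derivative_symmetric[where g=g and ?g1.0=g1 and ?g2.0=g2, OF S g g1] second by metis
  then show ?thesis using second Complex_Scalars by (simp add: blin_over_Complex)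
qed

section \<open>Expansion of the exact solution\<close>

lemma uO_taylor:
  fixes W :: "nat \<Rightarrow> real \<Rightarrow> 'b::real_normed_vector"
  assumes der: "\<And>k s. k < n \<Longrightarrow> s \<in> {a..b2} \<Longrightarrow> (W k has_vector_derivative W (Suc k) s) (at s within {a..b2})"
    and bd: "\<And>k s. k \<le> n \<Longrightarrow> s \<in> {a..b2} \<Longrightarrow> norm (W k s) \<le> C" and "b < b2" "0 \<le> c"
  shows "uO {a..b} n (\<lambda>t h. W 0 (t + c * h) - (\<Sum>k<n. ((c * h) ^ k / fact k) *\<^sub>R W k t))"
  unfolding uO_def
proof (intro exI[of _ "C * c ^ n"])
  have "\<forall>\<^sub>F h in at_right 0. 0 < h \<and> h \<le> (b2 - b) / (c + 1)"
    using assms by (intro eventually_small) auto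
  then show "\<forall>\<^sub>F h in at_right 0. \<forall>t\<in>{a..b}. norm (W 0 (t + c * h) - (\<Sum>k<n. ((c * h) ^ k / fact k) *\<^sub>R W k t)) \<le> C * c ^ n * h ^ n"
  proof eventually_elim
    case (elim h)
    show ?case
    proof
      fix t assume t: "t \<in> {a..b}"
      have "h * (c + 1) \<le> b2 - b" using elim assms(4) by (simp add: pos_le_divide_eq)
      then have ch: "c * h \<le> b2 - b" "0 \<le> c * h" using elim assms(4) by (simp_all add: algebra_simps)
      have "norm (W 0 (t + c * h) - (\<Sum>k<n. ((c * h) ^ k / fact k) *\<^sub>R W k t)) \<le> C * (c * h) ^ n"
      proof (rule taylor_bound[where a=a and b=b2])
        show "t + c * h \<in> {a..b2}" using t ch assms(3) unfolding atLeastAtMost_iff by linarith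
      qed (use t ch assms(3) der bd in auto)
      then show "norm (W 0 (t + c * h) - (\<Sum>k<n. ((c * h) ^ k / fact k) *\<^sub>R W k t)) \<le> C * c ^ n * h ^ n"
        by (simp add: power_mult_distrib mult.assoc)
    qed
  qed
qed

lemma uO_small:
  assumes "uO I k X" "0 < k" "0 < \<epsilon>"
  shows "\<forall>\<^sub>F h in at_right 0. \<forall>t\<in>I. norm (X t h) < \<epsilon>"
proof -
  obtain C where C: "0 \<le> C" "\<forall>\<^sub>F h in at_right 0. 0 < h \<and> h \<le> 1 \<and> (\<forall>t\<in>I. norm (X t h) \<le> C * h ^ k)"
    using uO_D[OF assms(1)] by blast
  have "\<forall>\<^sub>F h in at_right 0. 0 < h \<and> h \<le> \<epsilon> / (C + 1)"
    using assms C by (intro eventually_small) auto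
  with C(2) show ?thesis
  proof eventually_elim
    case (elim h)
    have "C * h ^ k \<le> C * h"
      using elim C(1) assms(2) power_decreasing[of 1 k h] by (intro mult_left_mono) auto
    also have "\<dots> < (C + 1) * h" using elim by simp
    also have "\<dots> \<le> \<epsilon>" using elim C(1) by (simp add: field_simps)
    finally show ?case using elim by force
  qed
qed

text \<open>
  Taylor expansion along the segment from \<open>x\<close> to \<open>x + e\<close>.
\<close>

lemma cubic_taylor_bound:
  fixes g :: "'a::real_normed_vector \<Rightarrow> 'b::real_normed_vector"
  assumes S: "convex S" "x \<in> S" "x + e \<in> S"
    and g: "\<And>p. p \<in> S \<Longrightarrow> (g has_derivative blinfun_apply (g1 p)) (at p)"
      "\<And>p. p \<in> S \<Longrightarrow> (g1 has_derivative blinfun_apply (g2 p)) (at p)"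
      "\<And>p. p \<in> S \<Longrightarrow> (g2 has_derivative blinfun_apply (g3 p)) (at p)"
      "\<And>p. p \<in> S \<Longrightarrow> norm (g3 p) \<le> C"
  shows "norm (g (x + e) - (g x + g1 x e + (1 / 2) *\<^sub>R g2 x e e)) \<le> C * norm e ^ 3"
proof -
  have inS: "x + s *\<^sub>R e \<in> S" if "s \<in> {0..1}" for s
  proof -
    have "x + s *\<^sub>R e = (1 - s) *\<^sub>R x + s *\<^sub>R (x + e)" by (simp add: algebra_simps)
    then show ?thesis using S that by (simp add: convexD)
  qed
  define W where "W k s = (if k = 0 then g (x + s *\<^sub>R e) else if k = 1 then g1 (x + s *\<^sub>R e) e
     else if k = 2 then g2 (x + s *\<^sub>R e) e e else g3 (x + s *\<^sub>R e) e e e)" for k :: nat and s :: real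
  have line: "((\<lambda>s. x + s *\<^sub>R e) has_derivative (\<lambda>h. h *\<^sub>R e)) (at s within {0..1})" for s
    by (auto intro!: derivative_eq_intros)
  have "norm (W 0 (0 + 1) - (\<Sum>k<3. (1 ^ k / fact k) *\<^sub>R W k 0)) \<le> (C * norm e ^ 3) * 1 ^ 3"
  proof (rule taylor_bound[where a=0 and b=1])
    fix k :: nat and s :: real assume k: "k < 3" and s: "s \<in> {0..1}"
    have 0: "((\<lambda>s. g (x + s *\<^sub>R e)) has_vector_derivative g1 (x + s *\<^sub>R e) e) (at s within {0..1})"
      using has_derivative_compose[OF line g(1)[OF inS[OF s]]]
      by (simp add: has_vector_derivative_def blinfun.scaleR_right)
    have 1: "((\<lambda>s. g1 (x + s *\<^sub>R e)) has_vector_derivative g2 (x + s *\<^sub>R e) e) (at s within {0..1})"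
      using has_derivative_compose[OF line g(2)[OF inS[OF s]]]
      by (simp add: has_vector_derivative_def blinfun.scaleR_right)
    have 2: "((\<lambda>s. g2 (x + s *\<^sub>R e)) has_vector_derivative g3 (x + s *\<^sub>R e) e) (at s within {0..1})"
      using has_derivative_compose[OF line g(3)[OF inS[OF s]]]
      by (simp add: has_vector_derivative_def blinfun.scaleR_right)
    note app = bounded_linear.has_vector_derivative[OF blinfun.bounded_linear_left]
    have "k = 0 \<or> k = 1 \<or> k = 2" using k by auto
    then show "(W k has_vector_derivative W (Suc k) s) (at s within {0..1})"
      unfolding W_def using 0 app[OF 1] app[OF app[OF 2]] by auto
  next
    fix s :: real assume s: "s \<in> {0..1}"
    let ?L = "g3 (x + s *\<^sub>R e)"
    have "norm (?L e e e) \<le> norm (?L e e) * norm e" by (rule norm_blinfun)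
    also have "\<dots> \<le> (norm (?L e) * norm e) * norm e" by (intro mult_right_mono norm_blinfun) auto
    also have "\<dots> \<le> ((norm ?L * norm e) * norm e) * norm e" by (intro mult_right_mono norm_blinfun) auto
    also have "\<dots> \<le> ((C * norm e) * norm e) * norm e" using g(4)[OF inS[OF s]] by (intro mult_right_mono) auto
    finally show "norm (W 3 s) \<le> C * norm e ^ 3" by (simp add: W_def power3_eq_cube mult.assoc)
  qed auto
  then show ?thesis by (simp add: W_def numeral_3_eq_3 add.assoc)
qed

text \<open>
  The data of the proof: \<open>W k\<close>, \<open>F k\<close>, \<open>G k\<close>, \<open>H k\<close> are the \<open>k\<close>-th time derivatives of \<open>u\<close>, \<open>g \<circ> u\<close>, \<open>g' \<circ> u\<close>
  and \<open>g'' \<circ> u\<close>. They live on \<open>[t0, t2]\<close>, where \<open>u\<close> is continued beyond the final time \<open>t1\<close> and solves the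
  differential equation only up to \<open>t1\<close>.
\<close>

locale smooth_setting = c0_semigroup T for T :: "real \<Rightarrow> 'a::banach \<Rightarrow>\<^sub>L 'a" +
  fixes \<K> :: "'a scalars" and D :: "'a set" and A g :: "'a \<Rightarrow> 'a" and M :: exprk
    and g1 :: "'a \<Rightarrow> 'a \<Rightarrow>\<^sub>L 'a" and g2 :: "'a \<Rightarrow> 'a \<Rightarrow>\<^sub>L 'a \<Rightarrow>\<^sub>L 'a" and g3 :: "'a \<Rightarrow> 'a \<Rightarrow>\<^sub>L 'a \<Rightarrow>\<^sub>L 'a \<Rightarrow>\<^sub>L 'a"
    and W F :: "nat \<Rightarrow> real \<Rightarrow> 'a" and G :: "nat \<Rightarrow> real \<Rightarrow> 'a \<Rightarrow>\<^sub>L 'a" and H :: "nat \<Rightarrow> real \<Rightarrow> 'a \<Rightarrow>\<^sub>L 'a \<Rightarrow>\<^sub>L 'a"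
    and t0 t1 t2 r C :: real
  assumes gen: "infinitesimal_generator T D A" and over: "banach_over \<K>"
    and t01: "t0 < t1" and t12: "t1 < t2" and r: "0 < r"
    and W_der: "\<And>k t. k < 6 \<Longrightarrow> t \<in> {t0..t2} \<Longrightarrow> (W k has_vector_derivative W (Suc k) t) (at t within {t0..t2})"
    and W_bd: "\<And>k t. k \<le> 6 \<Longrightarrow> t \<in> {t0..t2} \<Longrightarrow> norm (W k t) \<le> C"
    and F_der: "\<And>k t. k < 6 \<Longrightarrow> t \<in> {t0..t2} \<Longrightarrow> (F k has_vector_derivative F (Suc k) t) (at t within {t0..t2})"
    and F_bd: "\<And>k t. k \<le> 6 \<Longrightarrow> t \<in> {t0..t2} \<Longrightarrow> norm (F k t) \<le> C"
    and F_0: "\<And>t. t \<in> {t0..t2} \<Longrightarrow> F 0 t = g (W 0 t)"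
    and G_der: "\<And>k t. k < 4 \<Longrightarrow> t \<in> {t0..t2} \<Longrightarrow> (G k has_vector_derivative G (Suc k) t) (at t within {t0..t2})"
    and G_bd: "\<And>k t. k \<le> 4 \<Longrightarrow> t \<in> {t0..t2} \<Longrightarrow> norm (G k t) \<le> C"
    and G_0: "\<And>t. t \<in> {t0..t2} \<Longrightarrow> G 0 t = g1 (W 0 t)"
    and H_der: "\<And>k t. k < 2 \<Longrightarrow> t \<in> {t0..t2} \<Longrightarrow> (H k has_vector_derivative H (Suc k) t) (at t within {t0..t2})"
    and H_bd: "\<And>k t. k \<le> 2 \<Longrightarrow> t \<in> {t0..t2} \<Longrightarrow> norm (H k t) \<le> C"
    and H_0: "\<And>t. t \<in> {t0..t2} \<Longrightarrow> H 0 t = g2 (W 0 t)"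
    and G_over: "\<And>k t. k \<le> 3 \<Longrightarrow> t \<in> {t0..t2} \<Longrightarrow> bounded_linear_over \<K> (G k t)"
    and H_over: "\<And>k t. k \<le> 1 \<Longrightarrow> t \<in> {t0..t2} \<Longrightarrow> blin_over \<K> (H k t)"
    and solves: "\<And>t. t \<in> {t0..t1} \<Longrightarrow> W 0 t \<in> D \<and> W 1 t = A (W 0 t) + g (W 0 t)"
    and g_der: "\<And>t p. t \<in> {t0..t1} \<Longrightarrow> p \<in> ball (W 0 t) r \<Longrightarrow> (g has_derivative blinfun_apply (g1 p)) (at p)"
      "\<And>t p. t \<in> {t0..t1} \<Longrightarrow> p \<in> ball (W 0 t) r \<Longrightarrow> (g1 has_derivative blinfun_apply (g2 p)) (at p)"
      "\<And>t p. t \<in> {t0..t1} \<Longrightarrow> p \<in> ball (W 0 t) r \<Longrightarrow> (g2 has_derivative blinfun_apply (g3 p)) (at p)"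
    and g_bd: "\<And>t p. t \<in> {t0..t1} \<Longrightarrow> p \<in> ball (W 0 t) r \<Longrightarrow> norm (g1 p) \<le> C"
      "\<And>t p. t \<in> {t0..t1} \<Longrightarrow> p \<in> ball (W 0 t) r \<Longrightarrow> norm (g3 p) \<le> C"
    and nn: "nonneg_scalings M"
    and cond: "\<And>h. 0 < h \<Longrightarrow> stiff_conditions_except_quadrature6 \<K> T M h"
begin

abbreviation "tI \<equiv> {t0..t1}"

lemma node_nonneg: "0 \<le> node M i" using nn by (simp add: nonneg_scalings_def)

lemma C_nonneg: "0 \<le> C"
proof -
  have "norm (F 0 t0) \<le> C" using t01 t12 by (intro F_bd) auto
  then show ?thesis using norm_ge_zero order_trans by blast
qed

lemma bounded_data:
  "k \<le> 6 \<Longrightarrow> bounded (W k ` tI)" "k \<le> 6 \<Longrightarrow> bounded (F k ` tI)"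
  "k \<le> 4 \<Longrightarrow> bounded (G k ` tI)" "k \<le> 2 \<Longrightarrow> bounded (H k ` tI)"
  using W_bd F_bd G_bd H_bd t12 by (auto simp: bounded_iff intro!: exI[of _ C])

text \<open>
  The differentiated equations \<open>u\<^sup>(\<^sup>k\<^sup>+\<^sup>1\<^sup>) = A u\<^sup>(\<^sup>k\<^sup>) + f\<^sup>(\<^sup>k\<^sup>)\<close>, by differentiating the integrated form of the
  equation for \<open>k\<close>. In particular, the derivatives of \<open>u\<close> up to order five stay in the domain of \<open>A\<close>.
\<close>

lemma generator_graph_W:
  assumes "k \<le> 5" "t \<in> tI"
  shows "generator_graph (W k t) (W (Suc k) t - F k t)"
  using assms
proof (induction k arbitrary: t)
  case 0
  then have "generator_graph (W 0 t) (A (W 0 t))" using generator_graph_of_generator[OF gen] solves by blast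
  moreover have "A (W 0 t) = W 1 t - F 0 t" using solves[OF 0(2)] F_0[of t] 0(2) t12 by simp
  ultimately show ?case by simp
next
  case (Suc k)
  have sub: "tI \<subseteq> {t0..t2}" using t12 by auto
  have W': "(W k has_vector_derivative W (Suc k) t) (at t within tI)"
    "(W (Suc k) has_vector_derivative W (Suc (Suc k)) t) (at t within tI)"
    "(F k has_vector_derivative F (Suc k) t) (at t within tI)"
    using W_der[of k t] W_der[of "Suc k" t] F_der[of k t] Suc.prems sub
    by (auto intro: has_vector_derivative_within_subset[OF _ sub])
  show ?case unfolding generator_graph_def
  proof (intro allI impI)
    fix s :: real assume s: "0 \<le> s"
    have eq: "T s (W k \<tau>) - W k \<tau> = s *\<^sub>R phi_op T 1 s (W (Suc k) \<tau> - F k \<tau>)" if "\<tau> \<in> tI" for \<tau>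
      using Suc.IH[of \<tau>] Suc.prems that s by (simp add: generator_graph_def)
    have L: "((\<lambda>\<tau>. T s (W k \<tau>) - W k \<tau>) has_vector_derivative T s (W (Suc k) t) - W (Suc k) t) (at t within tI)"
      by (intro has_vector_derivative_diff W' bounded_linear.has_vector_derivative[OF blinfun.bounded_linear_right])
    have "bounded_linear (\<lambda>y. s *\<^sub>R phi_op T 1 s y)"
      by (intro bounded_linear_const_scaleR phi_op_bounded_linear s)
    from bounded_linear.has_vector_derivative[OF this has_vector_derivative_diff[OF W'(2,3)]]
    have "((\<lambda>\<tau>. T s (W k \<tau>) - W k \<tau>) has_vector_derivative s *\<^sub>R phi_op T 1 s (W (Suc (Suc k)) t - F (Suc k) t)) (at t within tI)"
      by (rule has_vector_derivative_transform[OF Suc.prems(2), rotated]) (use eq in auto)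
    from vector_derivative_unique_within_closed_interval[unfolded box_real, OF t01 Suc.prems(2) L this]
    show "T s (W (Suc k) t) - W (Suc k) t = s *\<^sub>R phi_op T 1 s (W (Suc (Suc k)) t - F (Suc k) t)" .
  qed
qed

lemma phi_op_diff: "0 \<le> \<tau> \<Longrightarrow> phi_op T k \<tau> (x - y) = phi_op T k \<tau> x - phi_op T k \<tau> y"
  using bounded_linear.linear[OF phi_op_bounded_linear] linear_diff by blast

text \<open>
  Writing \<open>f\<^sup>(\<^sup>q\<^sup>-\<^sup>1\<^sup>) = u\<^sup>(\<^sup>q\<^sup>) - A u\<^sup>(\<^sup>q\<^sup>-\<^sup>1\<^sup>)\<close>, the recursion of the \<open>\<phi>\<close>-functions lets the sum telescope. The
  identity holds for every \<open>\<tau> \<ge> 0\<close>, even when \<open>t + \<tau>\<close> lies beyond the interval of existence.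
\<close>

lemma exponential_taylor_identity:
  assumes t: "t \<in> tI" and \<tau>: "0 \<le> \<tau>" and n: "n \<le> 5"
  shows "T \<tau> (W 0 t) + (\<Sum>q=1..Suc n. \<tau> ^ q *\<^sub>R phi_op T q \<tau> (F (q - 1) t)) =
    (\<Sum>k<Suc n. (\<tau> ^ k / fact k) *\<^sub>R W k t) + \<tau> ^ Suc n *\<^sub>R phi_op T (Suc n) \<tau> (W (Suc n) t)"
  using n
proof (induction n)
  case 0
  have "T \<tau> (W 0 t) - W 0 t = \<tau> *\<^sub>R phi_op T 1 \<tau> (W 1 t - F 0 t)"
    using generator_graph_W[of 0 t] t \<tau> by (simp add: generator_graph_def)
  then show ?case using \<tau> by (simp add: phi_op_diff scaleR_diff_right algebra_simps)
next
  case (Suc n)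
  have "phi_op T (Suc n) \<tau> (W (Suc n) t) = (1 / fact (Suc n)) *\<^sub>R W (Suc n) t
      + \<tau> *\<^sub>R phi_op T (Suc (Suc n)) \<tau> (W (Suc (Suc n)) t - F (Suc n) t)"
    using generator_graph_W[of "Suc n" t] t \<tau> Suc.prems by (intro phi_op_recursion) auto
  then have step: "\<tau> ^ Suc n *\<^sub>R phi_op T (Suc n) \<tau> (W (Suc n) t) = (\<tau> ^ Suc n / fact (Suc n)) *\<^sub>R W (Suc n) t
      + \<tau> ^ Suc (Suc n) *\<^sub>R phi_op T (Suc (Suc n)) \<tau> (W (Suc (Suc n)) t)
      - \<tau> ^ Suc (Suc n) *\<^sub>R phi_op T (Suc (Suc n)) \<tau> (F (Suc n) t)"
    using \<tau> by (simp add: phi_op_diff scaleR_add_right scaleR_diff_right mult.commute del: fact_Suc)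
  have IH: "T \<tau> (W 0 t) + (\<Sum>q=1..Suc n. \<tau> ^ q *\<^sub>R phi_op T q \<tau> (F (q - 1) t)) =
    (\<Sum>k<Suc n. (\<tau> ^ k / fact k) *\<^sub>R W k t) + \<tau> ^ Suc n *\<^sub>R phi_op T (Suc n) \<tau> (W (Suc n) t)"
    using Suc by simp
  have s1: "(\<Sum>q=1..Suc (Suc n). \<tau> ^ q *\<^sub>R phi_op T q \<tau> (F (q - 1) t)) =
     (\<Sum>q=1..Suc n. \<tau> ^ q *\<^sub>R phi_op T q \<tau> (F (q - 1) t)) + \<tau> ^ Suc (Suc n) *\<^sub>R phi_op T (Suc (Suc n)) \<tau> (F (Suc n) t)"
    by simp
  have s2: "(\<Sum>k<Suc (Suc n). (\<tau> ^ k / fact k) *\<^sub>R W k t) = (\<Sum>k<Suc n. (\<tau> ^ k / fact k) *\<^sub>R W k t)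
     + (\<tau> ^ Suc n / fact (Suc n)) *\<^sub>R W (Suc n) t"
    by (rule sum.lessThan_Suc)
  show ?case unfolding s1 s2 add.assoc[symmetric] IH step by (simp del: fact_Suc)
qed

text \<open>
  Variation of constants with the Taylor polynomial of \<open>g \<circ> u\<close>, in the accuracy needed for the stages.
\<close>

lemma exponential_taylor:
  assumes c: "0 \<le> c"
  shows "uO tI 6 (\<lambda>t h. T (c * h) (W 0 t) + (\<Sum>q=1..5. (c * h) ^ q *\<^sub>R phi_op T q (c * h) (F (q - 1) t)) - W 0 (t + c * h))"
proof (rule uO_eq)
  show "uO tI 6 (\<lambda>t h. c ^ 6 *\<^sub>R (h ^ 6 *\<^sub>R phi_op T 6 (c * h) (W 6 t)) - c ^ 6 *\<^sub>R (h ^ 6 *\<^sub>R phi_op T 6 (c * h) (F 5 t))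
     - (W 0 (t + c * h) - (\<Sum>k<6. ((c * h) ^ k / fact k) *\<^sub>R W k t)))"
    using uO_power[of tI 0 _ 6, simplified] bounded_data c
    by (intro uO_diff uO_scaleR uO_power[of tI 0 _ 6, simplified] uO_phi_op uO_const uO_taylor[where W=W and n=6, OF W_der W_bd t12]) auto
  fix t h assume t: "t \<in> tI" and h: "0 < h" "h \<le> (1::real)"
  have "0 \<le> c * h" using c h by simp
  from exponential_taylor_identity[OF t this, of 5]
  have "T (c * h) (W 0 t) + ((\<Sum>q=1..5. (c * h) ^ q *\<^sub>R phi_op T q (c * h) (F (q - 1) t)) + (c * h) ^ 6 *\<^sub>R phi_op T 6 (c * h) (F 5 t)) =
    (\<Sum>k<6. ((c * h) ^ k / fact k) *\<^sub>R W k t) + (c * h) ^ 6 *\<^sub>R phi_op T 6 (c * h) (W 6 t)"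
  proof -
    have s: "Suc 5 = 6" by simp
    have "(\<Sum>q=1..6. (c * h) ^ q *\<^sub>R phi_op T q (c * h) (F (q - 1) t)) = (\<Sum>q=1..5. (c * h) ^ q *\<^sub>R phi_op T q (c * h) (F (q - 1) t)) + (c * h) ^ 6 *\<^sub>R phi_op T 6 (c * h) (F 5 t)"
      using sum.cl_ivl_Suc[of "\<lambda>q. (c * h) ^ q *\<^sub>R phi_op T q (c * h) (F (q - 1) t)" 1 5] by (simp add: s del: sum.cl_ivl_Suc)
    then show ?thesis using exponential_taylor_identity[OF t \<open>0 \<le> c * h\<close>, of 5] unfolding s by simp
  qed
  then show "T (c * h) (W 0 t) + (\<Sum>q=1..5. (c * h) ^ q *\<^sub>R phi_op T q (c * h) (F (q - 1) t)) - W 0 (t + c * h)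
    = c ^ 6 *\<^sub>R (h ^ 6 *\<^sub>R phi_op T 6 (c * h) (W 6 t)) - c ^ 6 *\<^sub>R (h ^ 6 *\<^sub>R phi_op T 6 (c * h) (F 5 t))
     - (W 0 (t + c * h) - (\<Sum>k<6. ((c * h) ^ k / fact k) *\<^sub>R W k t))"
    by (simp add: power_mult_distrib algebra_simps)
qed

text \<open>
  One order more than \<open>exponential_taylor\<close>, for \<open>c = 1\<close>. The seventh derivative of \<open>u\<close> is not available,
  so the telescoping identity does not reach this order; integrating the Taylor remainder of \<open>g \<circ> u\<close> in the
  variation-of-constants formula gains the missing factor \<open>h\<close>, at the price of \<open>t + h \<le> t1\<close>.
\<close>

lemma exact_step_expansion:
  "uO tI 7 (\<lambda>t h. if t + h \<le> t1 then T h (W 0 t) + (\<Sum>q=1..6. h ^ q *\<^sub>R phi_op T q h (F (q - 1) t)) - W 0 (t + h) else 0)"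
proof -
  obtain E where E: "1 \<le> E" "\<And>s. 0 \<le> s \<Longrightarrow> s \<le> 1 \<Longrightarrow> norm (T s) \<le> E" using T_locally_bounded by blast
  have main: "norm (T h (W 0 t) + (\<Sum>q=1..6. h ^ q *\<^sub>R phi_op T q h (F (q - 1) t)) - W 0 (t + h)) \<le> E * C * h ^ 7"
    if t: "t \<in> tI" and h: "0 < h" "h \<le> 1" "t + h \<le> t1" for t h
  proof -
    have h0: "0 \<le> h" using h by simp
    have inI: "t + \<theta> * h \<in> tI" if "\<theta> \<in> {0..1}" for \<theta>
    proof -
      have "0 \<le> \<theta> * h" "\<theta> * h \<le> 1 * h" using that h by (auto intro!: mult_right_mono)
      then show ?thesis using t h unfolding atLeastAtMost_iff by linarith
    qed
    have voc: "((\<lambda>\<theta>. T ((1 - \<theta>) * h) (h *\<^sub>R W 1 (t + \<theta> * h) - h *\<^sub>R (W 1 (t + \<theta> * h) - F 0 (t + \<theta> * h))))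
        has_integral W 0 (t + 1 * h) - T h (W 0 (t + 0 * h))) {0..1}"
    proof (rule variation_of_constants[where v="\<lambda>\<theta>. W 0 (t + \<theta> * h)" and v'="\<lambda>\<theta>. h *\<^sub>R W 1 (t + \<theta> * h)"
          and y="\<lambda>\<theta>. W 1 (t + \<theta> * h) - F 0 (t + \<theta> * h)"])
      fix \<theta> :: real assume th: "\<theta> \<in> {0..1}"
      have im: "(\<lambda>\<theta>. t + \<theta> * h) ` {0..1} \<subseteq> {t0..t2}" using inI t12 by fastforce
      have 1: "(W 0 has_vector_derivative W 1 (t + \<theta> * h)) (at (t + \<theta> * h) within (\<lambda>\<theta>. t + \<theta> * h) ` {0..1})"
        using W_der[of 0 "t + \<theta> * h"] inI[OF th] t12 by (intro has_vector_derivative_within_subset[OF _ im]) auto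
      have 2: "((\<lambda>\<theta>. t + \<theta> * h) has_vector_derivative h) (at \<theta> within {0..1})"
        by (auto intro!: derivative_eq_intros simp flip: has_real_derivative_iff_has_vector_derivative)
      show "((\<lambda>\<theta>. W 0 (t + \<theta> * h)) has_vector_derivative h *\<^sub>R W 1 (t + \<theta> * h)) (at \<theta> within {0..1})"
        using vector_diff_chain_within[OF 2 1] by (simp add: o_def)
      show "generator_graph (W 0 (t + \<theta> * h)) (W 1 (t + \<theta> * h) - F 0 (t + \<theta> * h))"
        using generator_graph_W[of 0] inI[OF th] by simp
    qed (rule h0)
    have ex: "((\<lambda>\<theta>. h *\<^sub>R T ((1 - \<theta>) * h) (F 0 (t + \<theta> * h))) has_integral W 0 (t + h) - T h (W 0 t)) {0..1}"
      using voc by (simp add: blinfun.scaleR_right flip: scaleR_diff_right)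
    \<comment> \<open>The sum of the \<open>\<phi>\<close>-terms is the same integral with \<open>f\<close> replaced by its Taylor polynomial.\<close>
    have po: "((\<lambda>\<theta>. \<Sum>q=1..6. h ^ q *\<^sub>R ((\<theta> ^ (q - 1) / fact (q - 1)) *\<^sub>R T ((1 - \<theta>) * h) (F (q - 1) t)))
        has_integral (\<Sum>q=1..6. h ^ q *\<^sub>R phi_op T q h (F (q - 1) t))) {0..1}"
      by (intro has_integral_sum has_integral_cmul phi_op_has_integral h0) auto
    have "norm ((\<Sum>q=1..6. h ^ q *\<^sub>R phi_op T q h (F (q - 1) t)) - (W 0 (t + h) - T h (W 0 t))) \<le> E * C * h ^ 7"
    proof (rule unit_interval_integral_bound[OF has_integral_diff[OF po ex]])
      fix \<theta> :: real assume th: "\<theta> \<in> {0..1}"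
      define R where "R = F 0 (t + \<theta> * h) - (\<Sum>k<6. ((\<theta> * h) ^ k / fact k) *\<^sub>R F k t)"
      note C0 = C_nonneg
      have "norm R \<le> C * (\<theta> * h) ^ 6"
        unfolding R_def using t inI[OF th] t12 th h F_bd by (intro taylor_bound[where a=t0 and b=t2] F_der) auto
      also have "\<dots> \<le> C * (1 * h) ^ 6"
        using th h C0 by (intro mult_left_mono power_mono mult_right_mono) auto
      finally have R: "norm R \<le> C * h ^ 6" by simp
      have "(\<Sum>q=1..6. h ^ q *\<^sub>R ((\<theta> ^ (q - 1) / fact (q - 1)) *\<^sub>R T ((1 - \<theta>) * h) (F (q - 1) t))) =
          (\<Sum>k<6. h ^ Suc k *\<^sub>R ((\<theta> ^ k / fact k) *\<^sub>R T ((1 - \<theta>) * h) (F k t)))"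
        by (rule sum.reindex_bij_witness[of _ Suc "\<lambda>q. q - 1"]) auto
      also have "\<dots> = h *\<^sub>R T ((1 - \<theta>) * h) (\<Sum>k<6. ((\<theta> * h) ^ k / fact k) *\<^sub>R F k t)"
        by (simp add: blinfun.sum_right blinfun.scaleR_right scaleR_sum_right power_mult_distrib mult_ac)
      finally have "(\<Sum>q=1..6. h ^ q *\<^sub>R ((\<theta> ^ (q - 1) / fact (q - 1)) *\<^sub>R T ((1 - \<theta>) * h) (F (q - 1) t)))
          - h *\<^sub>R T ((1 - \<theta>) * h) (F 0 (t + \<theta> * h)) = - (h *\<^sub>R T ((1 - \<theta>) * h) R)"
        unfolding R_def by (simp add: blinfun.diff_right scaleR_diff_right)
      moreover have "norm (h *\<^sub>R T ((1 - \<theta>) * h) R) \<le> E * C * h ^ 7"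
      proof -
        have "(1 - \<theta>) * h \<le> 1 * 1" using th h by (intro mult_mono) auto
        then have "norm (T ((1 - \<theta>) * h) R) \<le> E * norm R"
          using th h by (intro T_apply_bound[OF E(2)]) auto
        also have "\<dots> \<le> E * (C * h ^ 6)" using R E(1) by (intro mult_left_mono) auto
        finally have "h * norm (T ((1 - \<theta>) * h) R) \<le> h * (E * (C * h ^ 6))" using h by (intro mult_left_mono) auto
        then show ?thesis using h by (simp add: power_numeral_reduce mult_ac)
      qed
      ultimately show "norm ((\<Sum>q=1..6. h ^ q *\<^sub>R ((\<theta> ^ (q - 1) / fact (q - 1)) *\<^sub>R T ((1 - \<theta>) * h) (F (q - 1) t)))
          - h *\<^sub>R T ((1 - \<theta>) * h) (F 0 (t + \<theta> * h))) \<le> E * C * h ^ 7" by simp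
    qed
    then show ?thesis by (simp add: algebra_simps)
  qed
  note C0 = C_nonneg
  show ?thesis unfolding uO_def
    using main E(1) C0 eventually_small[of 1, simplified]
    by (intro exI[of _ "E * C"]) (auto elim!: eventually_mono)
qed

end

section \<open>Errors of the stages\<close>

lemma uO_h1: "uO I 0 X \<Longrightarrow> uO I 1 (\<lambda>t h. h *\<^sub>R X t h)"
  using uO_h[of I 0 X] by simp

lemma stage_error_identity:
  fixes x p1 p2 p3 p4 p5 a y S1 S2 S3 S4 S5 w :: "'b::real_vector"
  shows "x + (c * h) *\<^sub>R p1 + h *\<^sub>R (a + y + (h *\<^sub>R S1 + h ^ 2 *\<^sub>R S2 + h ^ 3 *\<^sub>R S3 + h ^ 4 *\<^sub>R S4 + h ^ 5 *\<^sub>R S5)) - w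
    - (h ^ 2 *\<^sub>R (S1 - c ^ 2 *\<^sub>R p2) + h ^ 3 *\<^sub>R (S2 - c ^ 3 *\<^sub>R p3) + h ^ 4 *\<^sub>R (S3 - c ^ 4 *\<^sub>R p4)
       + h ^ 5 *\<^sub>R (S4 - c ^ 5 *\<^sub>R p5) + h *\<^sub>R a)
    = (x + ((c * h) *\<^sub>R p1 + (c * h) ^ 2 *\<^sub>R p2 + (c * h) ^ 3 *\<^sub>R p3 + (c * h) ^ 4 *\<^sub>R p4 + (c * h) ^ 5 *\<^sub>R p5) - w)
    + (h *\<^sub>R y + h ^ 6 *\<^sub>R S5)"
  by (simp add: power_mult_distrib scaleR_add_right scaleR_diff_right power_numeral_reduce mult_ac)

context smooth_setting begin

definition stage :: "nat \<Rightarrow> real \<Rightarrow> 'a \<Rightarrow> 'a" where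
  "stage i h x = exprk_stage M T D A g h x i"

lemma stage_eq:
  assumes "0 \<le> h"
  shows "stage i h x = T (node M i * h) x + (node M i * h) *\<^sub>R phi_op T 1 (node M i * h) (g x)
    + h *\<^sub>R (\<Sum>j=2..<i. aop M h i j (g (stage j h x) - g x))"
  unfolding stage_def
  by (subst exprk_stage.simps, subst exp_euler_eq[OF gen]) (use assms node_nonneg in auto)

lemma step_eq:
  assumes "0 \<le> h"
  shows "exprk_step M T D A g h x = T h x + h *\<^sub>R phi_op T 1 h (g x)
    + h *\<^sub>R (\<Sum>i=2..stages M. bop M h i (g (stage i h x) - g x))"
  unfolding exprk_step_def stage_def by (subst exp_euler_eq[OF gen]) (use assms in auto)

lemma g_lipschitz:
  assumes "t \<in> tI" "x \<in> ball (W 0 t) r" "y \<in> ball (W 0 t) r"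
  shows "norm (g x - g y) \<le> C * norm (x - y)"
proof (rule differentiable_bound[OF convex_ball])
  fix p assume p: "p \<in> ball (W 0 t) r"
  show "(g has_derivative blinfun_apply (g1 p)) (at p within ball (W 0 t) r)"
    using g_der(1)[OF assms(1) p] by (rule has_derivative_at_withinI)
  show "onorm (blinfun_apply (g1 p)) \<le> C"
    using g_bd(1)[OF assms(1) p] by (simp add: norm_blinfun.rep_eq)
qed (use assms in auto)

lemma semigroup_increment:
  assumes "0 \<le> c"
  shows "uO tI 1 (\<lambda>t h. T (c * h) (W 0 t) - W 0 t)"
proof (rule uO_eq)
  show "uO tI 1 (\<lambda>t h. c *\<^sub>R (h *\<^sub>R phi_op T 1 (c * h) (W 1 t - F 0 t)))"
    using bounded_data assms
    by (intro uO_scaleR uO_h1 uO_phi_op uO_diff uO_const) auto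
  show "T (c * h) (W 0 t) - W 0 t = c *\<^sub>R (h *\<^sub>R phi_op T 1 (c * h) (W 1 t - F 0 t))"
    if "t \<in> tI" "0 < h" for t h
    using generator_graph_W[of 0 t] that assms by (simp add: generator_graph_def)
qed

lemma stage_near:
  shows "uO tI 1 (\<lambda>t h. stage i h (W 0 t) - W 0 t)"
proof (induction i rule: less_induct)
  case (less i)
  have "uO tI 0 (\<lambda>t h. g (stage j h (W 0 t)) - g (W 0 t))" if "j < i" for j
  proof (rule uO_norm_le[OF _ uO_mono[OF less[OF that]]])
    show "\<forall>\<^sub>F h in at_right 0. \<forall>t\<in>tI. norm (g (stage j h (W 0 t)) - g (W 0 t)) \<le> C * norm (stage j h (W 0 t) - W 0 t)"
      using uO_small[OF less[OF that] _ r, simplified]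
    proof eventually_elim
      case (elim h)
      then show ?case using r by (auto intro!: g_lipschitz simp: dist_norm norm_minus_commute)
    qed
  qed simp
  then have g: "uO tI 0 (\<lambda>t h. \<Sum>j=2..<i. aop M h i j (g (stage j h (W 0 t)) - g (W 0 t)))"
    by (intro uO_sum uO_aop nn) auto
  show ?case
  proof (rule uO_eq)
    show "uO tI 1 (\<lambda>t h. (T (node M i * h) (W 0 t) - W 0 t) + (node M i *\<^sub>R (h *\<^sub>R phi_op T 1 (node M i * h) (F 0 t))
       + h *\<^sub>R (\<Sum>j=2..<i. aop M h i j (g (stage j h (W 0 t)) - g (W 0 t)))))"
      using bounded_data node_nonneg
      by (intro uO_add uO_scaleR uO_h1 uO_phi_op uO_const semigroup_increment g) auto
    fix t h :: real assume "t \<in> tI" "0 < h"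
    then show "stage i h (W 0 t) - W 0 t = (T (node M i * h) (W 0 t) - W 0 t) + (node M i *\<^sub>R (h *\<^sub>R phi_op T 1 (node M i * h) (F 0 t))
       + h *\<^sub>R (\<Sum>j=2..<i. aop M h i j (g (stage j h (W 0 t)) - g (W 0 t))))"
      using t12 by (subst stage_eq) (auto simp: F_0)
  qed
qed

lemma solution_near:
  assumes "0 \<le> c"
  shows "uO tI 1 (\<lambda>t h. W 0 (t + c * h) - W 0 t)"
  using uO_taylor[where W=W and n=1, OF W_der W_bd t12 assms] by simp

definition stage_error :: "nat \<Rightarrow> real \<Rightarrow> real \<Rightarrow> 'a" where
  "stage_error i t h = stage i h (W 0 t) - W 0 (t + node M i * h)"

definition nonlinearity_error :: "nat \<Rightarrow> real \<Rightarrow> real \<Rightarrow> 'a" where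
  "nonlinearity_error i t h = g (stage i h (W 0 t)) - g (W 0 (t + node M i * h))"

lemma eventually_times:
  "\<forall>\<^sub>F h in at_right 0. \<forall>t\<in>tI. t + node M i * h \<in> {t0..t2}"
proof -
  have "0 < (t2 - t1) / (node M i + 1)" using t12 node_nonneg[of i] by (intro divide_pos_pos) auto
  from eventually_small[OF this] show ?thesis
  proof eventually_elim
    case (elim h)
    have "h * (node M i + 1) \<le> t2 - t1" using elim node_nonneg[of i] by (simp add: pos_le_divide_eq)
    then have "node M i * h \<le> t2 - t1" "0 \<le> node M i * h"
      using elim node_nonneg[of i] by (simp_all add: algebra_simps)
    then show ?case by auto
  qed
qed

lemma nonlinearity_increment:
  "uO tI 6 (\<lambda>t h. g (stage i h (W 0 t)) - g (W 0 t) - nonlinearity_error i t h - (\<Sum>k=1..5. ((node M i * h) ^ k / fact k) *\<^sub>R F k t))"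
proof (rule uO_cong)
  show "uO tI 6 (\<lambda>t h. F 0 (t + node M i * h) - (\<Sum>k<6. ((node M i * h) ^ k / fact k) *\<^sub>R F k t))"
    by (rule uO_taylor[where W=F and n=6, OF F_der F_bd t12 node_nonneg])
  show "\<forall>\<^sub>F h in at_right 0. \<forall>t\<in>tI. g (stage i h (W 0 t)) - g (W 0 t) - nonlinearity_error i t h - (\<Sum>k=1..5. ((node M i * h) ^ k / fact k) *\<^sub>R F k t)
      = F 0 (t + node M i * h) - (\<Sum>k<6. ((node M i * h) ^ k / fact k) *\<^sub>R F k t)"
    using eventually_times[of i]
  proof eventually_elim
    case (elim h)
    have s: "(\<Sum>k<6. f k) = f 0 + (\<Sum>k=1..5. f k)" for f :: "nat \<Rightarrow> 'a"
      by (simp add: eval_nat_numeral)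
    show ?case
    proof
      fix t assume t: "t \<in> tI"
      have "g (W 0 (t + node M i * h)) = F 0 (t + node M i * h)" "g (W 0 t) = F 0 t"
        using elim t t12 by (auto simp: F_0)
      then show "g (stage i h (W 0 t)) - g (W 0 t) - nonlinearity_error i t h - (\<Sum>k=1..5. ((node M i * h) ^ k / fact k) *\<^sub>R F k t)
        = F 0 (t + node M i * h) - (\<Sum>k<6. ((node M i * h) ^ k / fact k) *\<^sub>R F k t)"
        by (simp add: s nonlinearity_error_def)
    qed
  qed
qed

text \<open>
  The parts of the nonlinearity that are explicit in \<open>t\<close> combine with the \<open>\<phi>\<close>-terms of the exact solution to
  the operators \<open>\<psi>\<^sub>q\<^sub>,\<^sub>i\<close>; what remains of the previous stages are their errors.
\<close>

lemma stage_error_recursion: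
  "uO tI 6 (\<lambda>t h. stage_error i t h -
        (h ^ 2 *\<^sub>R psi_op T M h 2 i (F 1 t) + h ^ 3 *\<^sub>R psi_op T M h 3 i (F 2 t)
         + h ^ 4 *\<^sub>R psi_op T M h 4 i (F 3 t) + h ^ 5 *\<^sub>R psi_op T M h 5 i (F 4 t)
         + h *\<^sub>R (\<Sum>j=2..<i. aop M h i j (nonlinearity_error j t h))))"
proof (rule uO_eq)
  define R where "R j t h = g (stage j h (W 0 t)) - g (W 0 t) - nonlinearity_error j t h - (\<Sum>k=1..5. ((node M j * h) ^ k / fact k) *\<^sub>R F k t)" for j t h
  let ?X = "\<lambda>t h. T (node M i * h) (W 0 t) + (\<Sum>q=1..5. (node M i * h) ^ q *\<^sub>R phi_op T q (node M i * h) (F (q - 1) t)) - W 0 (t + node M i * h)"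
  let ?Y = "\<lambda>t h. \<Sum>j=2..<i. aop M h i j (R j t h)"
  let ?Z = "\<lambda>t h. \<Sum>j=2..<i. (node M j ^ 5 / fact 5) *\<^sub>R aop M h i j (F 5 t)"
  show "uO tI 6 (\<lambda>t h. ?X t h + (h *\<^sub>R ?Y t h + h ^ 6 *\<^sub>R ?Z t h))"
  proof (intro uO_add)
    show "uO tI 6 ?X" by (rule exponential_taylor[OF node_nonneg])
    show "uO tI 6 (\<lambda>t h. h *\<^sub>R ?Y t h)"
      unfolding R_def by (intro uO_mono[OF uO_h[where k=6]] uO_sum uO_aop nn nonlinearity_increment) auto
    have "uO tI 0 ?Z" using bounded_data by (intro uO_sum uO_scaleR uO_aop nn uO_const) auto
    from uO_power[OF this, of 6] show "uO tI 6 (\<lambda>t h. h ^ 6 *\<^sub>R ?Z t h)" by simp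
  qed
  fix t h assume t: "t \<in> tI" and h: "0 < h" "h \<le> (1::real)"
  have h0: "0 \<le> h" using h by simp
  have gR: "g (stage j h (W 0 t)) - g (W 0 t) = nonlinearity_error j t h + R j t h + (\<Sum>k=1..5. ((node M j * h) ^ k / fact k) *\<^sub>R F k t)" for j
    by (simp add: R_def)
  have F0: "g (W 0 t) = F 0 t" using F_0[of t] t t12 by simp
  have five: "(\<Sum>k=1..5. f k) = f 1 + f 2 + f 3 + f 4 + f 5" for f :: "nat \<Rightarrow> 'a"
    by (simp add: eval_nat_numeral)
  define S where "S k = (\<Sum>j=2..<i. (node M j ^ k / fact k) *\<^sub>R aop M h i j (F k t))" for k
  have pull: "((c * h) ^ k / fact k) *\<^sub>R x = h ^ k *\<^sub>R ((c ^ k / fact k) *\<^sub>R x)" for c k and x :: 'a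
    by (simp add: power_mult_distrib)
  have "(\<Sum>j=2..<i. aop M h i j (g (stage j h (W 0 t)) - g (W 0 t))) =
    (\<Sum>j=2..<i. aop M h i j (nonlinearity_error j t h)) + ?Y t h + (h ^ 1 *\<^sub>R S 1 + h ^ 2 *\<^sub>R S 2 + h ^ 3 *\<^sub>R S 3 + h ^ 4 *\<^sub>R S 4 + h ^ 5 *\<^sub>R S 5)"
    unfolding gR five S_def pull
    by (simp only: aop_add[OF nn h0] aop_scaleR[OF nn h0] sum.distrib scaleR_sum_right)
  then have aexp: "(\<Sum>j=2..<i. aop M h i j (g (stage j h (W 0 t)) - g (W 0 t))) =
    (\<Sum>j=2..<i. aop M h i j (nonlinearity_error j t h)) + ?Y t h + (h *\<^sub>R S 1 + h ^ 2 *\<^sub>R S 2 + h ^ 3 *\<^sub>R S 3 + h ^ 4 *\<^sub>R S 4 + h ^ 5 *\<^sub>R S 5)"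
    by (simp only: power_one_right)
  have psis: "psi_op T M h 2 i (F 1 t) = S 1 - node M i ^ 2 *\<^sub>R phi_op T 2 (node M i * h) (F 1 t)"
    "psi_op T M h 3 i (F 2 t) = S 2 - node M i ^ 3 *\<^sub>R phi_op T 3 (node M i * h) (F 2 t)"
    "psi_op T M h 4 i (F 3 t) = S 3 - node M i ^ 4 *\<^sub>R phi_op T 4 (node M i * h) (F 3 t)"
    "psi_op T M h 5 i (F 4 t) = S 4 - node M i ^ 5 *\<^sub>R phi_op T 5 (node M i * h) (F 4 t)"
    by (simp_all add: psi_op_def S_def)
  have X: "?X t h = T (node M i * h) (W 0 t) + ((node M i * h) *\<^sub>R phi_op T 1 (node M i * h) (F 0 t)
     + (node M i * h) ^ 2 *\<^sub>R phi_op T 2 (node M i * h) (F 1 t) + (node M i * h) ^ 3 *\<^sub>R phi_op T 3 (node M i * h) (F 2 t)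
     + (node M i * h) ^ 4 *\<^sub>R phi_op T 4 (node M i * h) (F 3 t) + (node M i * h) ^ 5 *\<^sub>R phi_op T 5 (node M i * h) (F 4 t))
     - W 0 (t + node M i * h)"
    unfolding five by simp
  have Z: "?Z t h = S 5" by (simp only: S_def)
  show "stage_error i t h -
        (h ^ 2 *\<^sub>R psi_op T M h 2 i (F 1 t) + h ^ 3 *\<^sub>R psi_op T M h 3 i (F 2 t)
         + h ^ 4 *\<^sub>R psi_op T M h 4 i (F 3 t) + h ^ 5 *\<^sub>R psi_op T M h 5 i (F 4 t)
         + h *\<^sub>R (\<Sum>j=2..<i. aop M h i j (nonlinearity_error j t h))) = ?X t h + (h *\<^sub>R ?Y t h + h ^ 6 *\<^sub>R ?Z t h)"
    unfolding stage_error_def stage_eq[OF h0, of i] aexp unfolding F0 psis X Z by (rule stage_error_identity)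
qed

text \<open>
  Second-order expansion of \<open>g\<close> at \<open>u(t + c\<^sub>i h)\<close>, followed by the Taylor expansions of \<open>g'(u(t + c\<^sub>i h))\<close> to
  order four and of \<open>g''(u(t + c\<^sub>i h))\<close> to order two. As \<open>E\<^sub>i = O(h\<^sup>2)\<close>, all remainders are \<open>O(h\<^sup>6)\<close>.
\<close>

lemma nonlinearity_error_expansion:
  assumes E2: "uO tI 2 (stage_error i)"
  shows "uO tI 6 (\<lambda>t h. nonlinearity_error i t h -
        (G 0 t (stage_error i t h) + (node M i * h) *\<^sub>R G 1 t (stage_error i t h) + (node M i * h)\<^sup>2 *\<^sub>R ((1 / 2) *\<^sub>R G 2 t) (stage_error i t h)
         + (node M i * h) ^ 3 *\<^sub>R ((1 / 6) *\<^sub>R G 3 t) (stage_error i t h)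
         + ((1 / 2) *\<^sub>R H 0 t) (stage_error i t h) (stage_error i t h) + (node M i * h) *\<^sub>R ((1 / 2) *\<^sub>R H 1 t) (stage_error i t h) (stage_error i t h)))"
proof -
  let ?x = "\<lambda>t h. W 0 (t + node M i * h)"
  define GR where "GR t h = G 0 (t + node M i * h) - (\<Sum>k<4. ((node M i * h) ^ k / fact k) *\<^sub>R G k t)" for t h
  define HR where "HR t h = H 0 (t + node M i * h) - (\<Sum>k<2. ((node M i * h) ^ k / fact k) *\<^sub>R H k t)" for t h
  have GR: "uO tI 4 GR" unfolding GR_def[abs_def]
    by (rule uO_taylor[where W=G and n=4, OF G_der G_bd t12 node_nonneg])
  have HR: "uO tI 2 HR" unfolding HR_def[abs_def]
    by (rule uO_taylor[where W=H and n=2, OF H_der H_bd t12 node_nonneg])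
  define Q where "Q t h = nonlinearity_error i t h - (G 0 (t + node M i * h) (stage_error i t h) + (1 / 2) *\<^sub>R H 0 (t + node M i * h) (stage_error i t h) (stage_error i t h))" for t h
  have EE: "uO tI 4 (\<lambda>t h. norm (stage_error i t h) *\<^sub>R norm (stage_error i t h))"
    using uO_mult_norm_le[OF _ E2 E2, of "\<lambda>t h. norm (stage_error i t h) *\<^sub>R norm (stage_error i t h)" 1] by simp
  have Q: "uO tI 6 Q"
  proof -
    have "uO tI (4 + 2) Q"
    proof (rule uO_mult_norm_le[OF _ EE E2])
      show "\<forall>\<^sub>F h in at_right 0. \<forall>t\<in>tI. norm (Q t h) \<le> C * (norm (norm (stage_error i t h) *\<^sub>R norm (stage_error i t h)) * norm (stage_error i t h))"
        using eventually_times[of i] uO_small[OF solution_near[OF node_nonneg[of i]] _ r, simplified]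
          uO_small[OF stage_near[of i] _ r, simplified]
      proof eventually_elim
        case (elim h)
        show ?case
        proof
          fix t assume t: "t \<in> tI"
          have x: "?x t h \<in> ball (W 0 t) r" using elim(2) t by (auto simp: dist_norm norm_minus_commute)
          have y: "?x t h + stage_error i t h \<in> ball (W 0 t) r"
            using elim(3) t by (auto simp: dist_norm norm_minus_commute stage_error_def)
          have "norm (g (?x t h + stage_error i t h) - (g (?x t h) + g1 (?x t h) (stage_error i t h) + (1 / 2) *\<^sub>R g2 (?x t h) (stage_error i t h) (stage_error i t h))) \<le> C * norm (stage_error i t h) ^ 3"
            by (rule cubic_taylor_bound[OF convex_ball x y g_der[OF t] g_bd(2)[OF t]])
          moreover have "g1 (?x t h) = G 0 (t + node M i * h)" "g2 (?x t h) = H 0 (t + node M i * h)"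
            using elim(1) t by (auto simp: G_0 H_0)
          moreover have "g (?x t h + stage_error i t h) = nonlinearity_error i t h + g (?x t h)" by (simp add: stage_error_def nonlinearity_error_def)
          ultimately show "norm (Q t h) \<le> C * (norm (norm (stage_error i t h) *\<^sub>R norm (stage_error i t h)) * norm (stage_error i t h))"
            by (simp add: Q_def power3_eq_cube algebra_simps)
        qed
      qed
    qed
    then show ?thesis by simp
  qed
  have GE: "uO tI 6 (\<lambda>t h. GR t h (stage_error i t h))"
    using uO_mult_norm_le[OF _ GR E2, of "\<lambda>t h. GR t h (stage_error i t h)" 1] by (simp add: norm_blinfun)
  have HE0: "uO tI 4 (\<lambda>t h. HR t h (stage_error i t h))"
    using uO_mult_norm_le[OF _ HR E2, of "\<lambda>t h. HR t h (stage_error i t h)" 1] by (simp add: norm_blinfun)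
  have HE: "uO tI 6 (\<lambda>t h. HR t h (stage_error i t h) (stage_error i t h))"
    using uO_mult_norm_le[OF _ HE0 E2, of "\<lambda>t h. HR t h (stage_error i t h) (stage_error i t h)" 1] by (simp add: norm_blinfun)
  show ?thesis
  proof (rule uO_eq[OF uO_add[OF Q uO_add[OF GE uO_scaleR[OF HE, of "1 / 2"]]]])
    fix t h :: real
    have G4: "G 0 (t + node M i * h) = GR t h + (G 0 t + (node M i * h) *\<^sub>R G 1 t + (node M i * h)\<^sup>2 *\<^sub>R ((1 / 2) *\<^sub>R G 2 t)
         + (node M i * h) ^ 3 *\<^sub>R ((1 / 6) *\<^sub>R G 3 t))"
      by (simp add: GR_def eval_nat_numeral)
    have H2: "H 0 (t + node M i * h) = HR t h + (H 0 t + (node M i * h) *\<^sub>R H 1 t)"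
      by (simp add: HR_def eval_nat_numeral)
    have Q': "nonlinearity_error i t h = Q t h + (G 0 (t + node M i * h) (stage_error i t h) + (1 / 2) *\<^sub>R H 0 (t + node M i * h) (stage_error i t h) (stage_error i t h))"
      by (simp add: Q_def)
    show "nonlinearity_error i t h -
        (G 0 t (stage_error i t h) + (node M i * h) *\<^sub>R G 1 t (stage_error i t h) + (node M i * h)\<^sup>2 *\<^sub>R ((1 / 2) *\<^sub>R G 2 t) (stage_error i t h)
         + (node M i * h) ^ 3 *\<^sub>R ((1 / 6) *\<^sub>R G 3 t) (stage_error i t h)
         + ((1 / 2) *\<^sub>R H 0 t) (stage_error i t h) (stage_error i t h) + (node M i * h) *\<^sub>R ((1 / 2) *\<^sub>R H 1 t) (stage_error i t h) (stage_error i t h))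
      = Q t h + (GR t h (stage_error i t h) + (1 / 2) *\<^sub>R HR t h (stage_error i t h) (stage_error i t h))"
      unfolding Q' unfolding G4 H2
      by (simp add: blinfun.add_left blinfun.scaleR_left scaleR_add_right mult.commute)
  qed
qed

end

section \<open>Local error and stability\<close>

lemma scaleR_linear_over:
  fixes L :: "'a::banach \<Rightarrow>\<^sub>L 'a"
  assumes "banach_over \<K>" "bounded_linear_over \<K> L"
  shows "bounded_linear_over \<K> (blinfun_apply (c *\<^sub>R L))"
proof (cases \<K>)
  case (Complex_Scalars \<iota>)
  then have "bounded_linear \<iota>" using assms(1) by (simp add: complex_structure_def)
  then interpret \<iota>: bounded_linear \<iota> .
  show ?thesis using assms(2) Complex_Scalars
    by (simp add: blinfun.bounded_linear_right blinfun.scaleR_left \<iota>.scaleR)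
qed (simp add: blinfun.bounded_linear_right)

lemma scaleR_blin_over:
  fixes B :: "'a::banach \<Rightarrow>\<^sub>L 'a \<Rightarrow>\<^sub>L 'a"
  assumes "banach_over \<K>" "blin_over \<K> B"
  shows "blin_over \<K> (c *\<^sub>R B)"
proof (cases \<K>)
  case (Complex_Scalars \<iota>)
  then have "bounded_linear \<iota>" using assms(1) by (simp add: complex_structure_def)
  then interpret \<iota>: bounded_linear \<iota> .
  show ?thesis using assms(2) Complex_Scalars
    by (simp add: blin_over_Complex blinfun.scaleR_left \<iota>.scaleR)
qed (simp add: blin_over_Real)

lemma uO_if: "uO I k X \<Longrightarrow> uO I k (\<lambda>t h. if P t h then X t h else 0)"
  by (rule uO_norm_le[where K=1]) auto

lemma uO_subset: "uO I k X \<Longrightarrow> I' \<subseteq> I \<Longrightarrow> uO I' k X"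
  unfolding uO_def by (blast intro: eventually_mono)

lemma norm_le_of_scaled_norm_le:
  assumes "0 < d" "norm ((1 / d) *\<^sub>R z) \<le> L" shows "norm z \<le> L * d"
  using assms by (simp add: pos_divide_le_eq)

text \<open>
  Summation by parts: control of the partial sums of \<open>V\<close> and of the increments of \<open>y\<close> suffices.
\<close>

lemma abel_summation:
  fixes V :: "nat \<Rightarrow> 'a::real_vector \<Rightarrow> 'a"
  assumes V: "\<And>l x y. V l (x - y) = V l x - V l y"
  shows "(\<Sum>n<Suc m. V (m - n) (y n)) =
    (\<Sum>l<Suc m. V l (y 0)) + (\<Sum>n<m. \<Sum>l<m - n. V l (y (Suc n) - y n))"
proof (induction m arbitrary: y)
  case (Suc m)
  have "(\<Sum>n<Suc (Suc m). V (Suc m - n) (y n)) = V (Suc m) (y 0) + (\<Sum>n<Suc m. V (m - n) (y (Suc n)))"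
    by (subst sum.lessThan_Suc_shift) simp
  also have "(\<Sum>n<Suc m. V (m - n) (y (Suc n))) =
     (\<Sum>l<Suc m. V l (y 1)) + (\<Sum>n<m. \<Sum>l<m - n. V l (y (Suc (Suc n)) - y (Suc n)))"
    using Suc[of "\<lambda>n. y (Suc n)"] by simp
  also have "(\<Sum>l<Suc m. V l (y 1)) = (\<Sum>l<Suc m. V l (y 0)) + (\<Sum>l<Suc m. V l (y 1 - y 0))"
    by (simp only: V sum_subtractf) simp
  finally have "(\<Sum>n<Suc (Suc m). V (Suc m - n) (y n)) = (V (Suc m) (y 0) + (\<Sum>l<Suc m. V l (y 0)))
     + ((\<Sum>l<Suc m. V l (y 1 - y 0)) + (\<Sum>n<m. \<Sum>l<m - n. V l (y (Suc (Suc n)) - y (Suc n))))"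
    by (simp only: add.assoc)
  also have "V (Suc m) (y 0) + (\<Sum>l<Suc m. V l (y 0)) = (\<Sum>l<Suc (Suc m). V l (y 0))"
    by (simp only: sum.lessThan_Suc[of _ "Suc m"] add.commute)
  also have "(\<Sum>l<Suc m. V l (y 1 - y 0)) + (\<Sum>n<m. \<Sum>l<m - n. V l (y (Suc (Suc n)) - y (Suc n)))
     = (\<Sum>n<Suc m. \<Sum>l<Suc m - n. V l (y (Suc n) - y n))"
    by (subst sum.lessThan_Suc_shift[of _ m]) simp
  finally show ?case .
qed simp

text \<open>
  The recursive bound is available only as long as all previous errors are at most \<open>\<rho>\<close>, because the
  nonlinearity is controlled only near the solution. Smallness of the final bound keeps the induction going.
\<close>

lemma discrete_gronwall:
  fixes e :: "nat \<Rightarrow> real"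
  assumes a: "0 \<le> a" and b: "0 \<le> b"
    and small: "a * exp (b * real N) \<le> \<rho>"
    and rec: "\<And>m. m \<le> N \<Longrightarrow> (\<And>n. n < m \<Longrightarrow> e n \<le> \<rho>) \<Longrightarrow> e m \<le> a + b * (\<Sum>n<m. e n)"
  shows "e N \<le> a * exp (b * real N)"
proof -
  have "e m \<le> a * (1 + b) ^ m \<and> e m \<le> \<rho>" if "m \<le> N" for m
    using that
  proof (induction m rule: less_induct)
    case (less m)
    have le: "a * (1 + b) ^ m \<le> \<rho>"
    proof -
      have "(1 + b) ^ m \<le> exp b ^ m" using b by (intro power_mono exp_ge_add_one_self) auto
      also have "\<dots> = exp (b * real m)" by (simp flip: exp_of_nat_mult add: mult.commute)
      also have "\<dots> \<le> exp (b * real N)" using b less.prems by (simp add: mult_left_mono)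
      finally have "a * (1 + b) ^ m \<le> a * exp (b * real N)" using a by (rule mult_left_mono)
      then show ?thesis using small by simp
    qed
    have "e m \<le> a + b * (\<Sum>n<m. e n)" using less by (intro rec) auto
    also have "\<dots> \<le> a + b * (\<Sum>n<m. a * (1 + b) ^ n)"
      using less b by (intro add_left_mono mult_left_mono sum_mono) auto
    also have "\<dots> = a * (1 + b) ^ m"
    proof (induction m)
      case (Suc m)
      then show ?case by (simp add: algebra_simps)
    qed simp
    finally show ?case using le by simp
  qed
  then have "e N \<le> a * (1 + b) ^ N" by simp
  also have "\<dots> \<le> a * exp b ^ N" using a b by (intro mult_left_mono power_mono exp_ge_add_one_self) auto
  also have "\<dots> = a * exp (b * real N)" by (simp flip: exp_of_nat_mult add: mult.commute)
  finally show ?thesis .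
qed

lemma local_error_identity:
  fixes x p1 p2 p3 p4 p5 p6 b y S5 w :: "'b::real_vector"
  shows "x + h *\<^sub>R p1 + h *\<^sub>R (b + y + (h *\<^sub>R p2 + h ^ 2 *\<^sub>R p3 + h ^ 3 *\<^sub>R p4 + h ^ 4 *\<^sub>R p5 + h ^ 5 *\<^sub>R S5)) - w - h ^ 6 *\<^sub>R (S5 - p6)
   = (x + (h *\<^sub>R p1 + h ^ 2 *\<^sub>R p2 + h ^ 3 *\<^sub>R p3 + h ^ 4 *\<^sub>R p4 + h ^ 5 *\<^sub>R p5 + h ^ 6 *\<^sub>R p6) - w) + (h *\<^sub>R b + h *\<^sub>R y)"
  by (simp add: scaleR_add_right scaleR_diff_right power_numeral_reduce mult_ac)

context smooth_setting begin

lemma weighted_increments_small: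
  "uO tI 7 (\<lambda>t h. h *\<^sub>R (\<Sum>i=2..stages M. bop M h i (nonlinearity_error i t h)))"
proof (rule stage_expansion[where f=F and J="\<lambda>m t. (1 / fact m) *\<^sub>R G m t" and B="\<lambda>m t. (1 / 2) *\<^sub>R H m t" and E=stage_error and \<K>=\<K>])
  show "bounded ((\<lambda>t. (1 / fact m) *\<^sub>R G m t) ` tI)" if "m \<le> 3" for m
    using bounded_scaling[OF bounded_data(3)[of m], of "1 / fact m"] that by (simp add: image_image)
  show "bounded ((\<lambda>t. (1 / 2) *\<^sub>R H m t) ` tI)" if "m \<le> 1" for m
    using bounded_scaling[OF bounded_data(4)[of m], of "1 / 2"] that by (simp add: image_image)
  show "uO tI 6 (\<lambda>t h. stage_error i t h -
        (h ^ 2 *\<^sub>R psi_op T M h 2 i (F 1 t) + h ^ 3 *\<^sub>R psi_op T M h 3 i (F 2 t)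
         + h ^ 4 *\<^sub>R psi_op T M h 4 i (F 3 t) + h ^ 5 *\<^sub>R psi_op T M h 5 i (F 4 t)
         + h *\<^sub>R (\<Sum>j=2..<i. aop M h i j (nonlinearity_error j t h))))" for i
    by (rule stage_error_recursion)
  show "uO tI 6 (\<lambda>t h. nonlinearity_error i t h -
        (((1 / fact 0) *\<^sub>R G 0 t) (stage_error i t h) + (node M i * h) *\<^sub>R ((1 / fact 1) *\<^sub>R G 1 t) (stage_error i t h)
         + (node M i * h)\<^sup>2 *\<^sub>R ((1 / fact 2) *\<^sub>R G 2 t) (stage_error i t h)
         + (node M i * h) ^ 3 *\<^sub>R ((1 / fact 3) *\<^sub>R G 3 t) (stage_error i t h)
         + ((1 / 2) *\<^sub>R H 0 t) (stage_error i t h) (stage_error i t h) + (node M i * h) *\<^sub>R ((1 / 2) *\<^sub>R H 1 t) (stage_error i t h) (stage_error i t h)))"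
    if "uO tI 2 (stage_error i)" for i
    using nonlinearity_error_expansion[OF that] by (simp add: fact_numeral)
  show "bounded_linear_over \<K> (blinfun_apply ((1 / fact m) *\<^sub>R G m t))" if "m \<le> 3" "t \<in> tI" for m t
    using that t12 by (intro scaleR_linear_over over G_over) auto
  show "blin_over \<K> ((1 / 2) *\<^sub>R H m t)" if "m \<le> 1" "t \<in> tI" for m t
    using that t12 by (intro scaleR_blin_over over H_over) auto
qed (use nn cond bounded_data in auto)

text \<open>
  The operator \<open>\<delta>(hA)\<close> by which the sixth quadrature condition fails to hold in the strong sense.
\<close>

definition leading_defect :: "real \<Rightarrow> 'a \<Rightarrow> 'a" where
  "leading_defect h x = (\<Sum>i=2..stages M. (node M i ^ 5 / fact 5) *\<^sub>R bop M h i x) - phi_op T 6 h x"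

text \<open>
  The stiff order conditions remove the contributions of the stage errors, and the quadrature conditions
  for \<open>q \<le> 5\<close> those of the derivatives of \<open>g \<circ> u\<close> up to the fourth; the fifth derivative is left with
  \<open>\<delta>(hA)\<close>.
\<close>

lemma local_error:
  "uO tI 7 (\<lambda>t h. if t + h \<le> t1 then exprk_step M T D A g h (W 0 t) - W 0 (t + h) - h ^ 6 *\<^sub>R leading_defect h (F 5 t) else 0)"
proof (rule uO_eq)
  define R where "R j t h = g (stage j h (W 0 t)) - g (W 0 t) - nonlinearity_error j t h - (\<Sum>k=1..5. ((node M j * h) ^ k / fact k) *\<^sub>R F k t)" for j t h
  let ?X = "\<lambda>t h. T h (W 0 t) + (\<Sum>q=1..6. h ^ q *\<^sub>R phi_op T q h (F (q - 1) t)) - W 0 (t + h)"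
  let ?B = "\<lambda>t h. \<Sum>i=2..stages M. bop M h i (nonlinearity_error i t h)"
  let ?Y = "\<lambda>t h. \<Sum>i=2..stages M. bop M h i (R i t h)"
  show "uO tI 7 (\<lambda>t h. (if t + h \<le> t1 then ?X t h else 0) + (if t + h \<le> t1 then h *\<^sub>R ?B t h + h *\<^sub>R ?Y t h else 0))"
  proof (rule uO_add[OF exact_step_expansion], intro uO_if uO_add weighted_increments_small)
    have "uO tI 6 ?Y" unfolding R_def by (intro uO_sum uO_bop nn nonlinearity_increment)
    from uO_h[OF this] show "uO tI 7 (\<lambda>t h. h *\<^sub>R ?Y t h)" by simp
  qed
  fix t h assume t: "t \<in> tI" and h: "0 < h" "h \<le> (1::real)"
  have h0: "0 \<le> h" using h by simp
  have gR: "g (stage j h (W 0 t)) - g (W 0 t) = nonlinearity_error j t h + R j t h + (\<Sum>k=1..5. ((node M j * h) ^ k / fact k) *\<^sub>R F k t)" for j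
    by (simp add: R_def)
  have F0: "g (W 0 t) = F 0 t" using F_0[of t] t t12 by simp
  have five: "(\<Sum>k=1..5. f k) = f 1 + f 2 + f 3 + f 4 + f 5" for f :: "nat \<Rightarrow> 'a"
    by (simp add: eval_nat_numeral)
  have six: "(\<Sum>k=1..6. f k) = f 1 + f 2 + f 3 + f 4 + f 5 + f 6" for f :: "nat \<Rightarrow> 'a"
    by (simp add: eval_nat_numeral)
  define S where "S k = (\<Sum>i=2..stages M. (node M i ^ k / fact k) *\<^sub>R bop M h i (F k t))" for k
  have pull: "((c * h) ^ k / fact k) *\<^sub>R x = h ^ k *\<^sub>R ((c ^ k / fact k) *\<^sub>R x)" for c k and x :: 'a
    by (simp add: power_mult_distrib)
  have "(\<Sum>i=2..stages M. bop M h i (g (stage i h (W 0 t)) - g (W 0 t))) =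
    ?B t h + ?Y t h + (h ^ 1 *\<^sub>R S 1 + h ^ 2 *\<^sub>R S 2 + h ^ 3 *\<^sub>R S 3 + h ^ 4 *\<^sub>R S 4 + h ^ 5 *\<^sub>R S 5)"
    unfolding gR five S_def pull
    by (simp only: bop_add[OF nn h0] bop_scaleR[OF nn h0] sum.distrib scaleR_sum_right)
  then have bexp: "(\<Sum>i=2..stages M. bop M h i (g (stage i h (W 0 t)) - g (W 0 t))) =
    ?B t h + ?Y t h + (h *\<^sub>R S 1 + h ^ 2 *\<^sub>R S 2 + h ^ 3 *\<^sub>R S 3 + h ^ 4 *\<^sub>R S 4 + h ^ 5 *\<^sub>R S 5)"
    by (simp only: power_one_right)
  have quad: "quadrature_condition T M h 2" "quadrature_condition T M h 3" "quadrature_condition T M h 4" "quadrature_condition T M h 5"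
    using cond[OF h(1)] unfolding stiff_conditions_except_quadrature6_def Let_def by blast+
  have S: "S 1 = phi_op T 2 h (F 1 t)" "S 2 = phi_op T 3 h (F 2 t)" "S 3 = phi_op T 4 h (F 3 t)" "S 4 = phi_op T 5 h (F 4 t)"
    using quad by (simp_all add: quadrature_condition_def S_def)
  have X: "?X t h = T h (W 0 t) + (h *\<^sub>R phi_op T 1 h (F 0 t)
     + h ^ 2 *\<^sub>R phi_op T 2 h (F 1 t) + h ^ 3 *\<^sub>R phi_op T 3 h (F 2 t)
     + h ^ 4 *\<^sub>R phi_op T 4 h (F 3 t) + h ^ 5 *\<^sub>R phi_op T 5 h (F 4 t) + h ^ 6 *\<^sub>R phi_op T 6 h (F 5 t))
     - W 0 (t + h)"
    unfolding six by simp
  have "exprk_step M T D A g h (W 0 t) - W 0 (t + h) - h ^ 6 *\<^sub>R leading_defect h (F 5 t) = ?X t h + (h *\<^sub>R ?B t h + h *\<^sub>R ?Y t h)"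
    unfolding step_eq[OF h0] bexp unfolding F0 S X leading_defect_def unfolding S_def[of 5, symmetric] by (rule local_error_identity)
  then show "(if t + h \<le> t1 then exprk_step M T D A g h (W 0 t) - W 0 (t + h) - h ^ 6 *\<^sub>R leading_defect h (F 5 t) else 0)
    = (if t + h \<le> t1 then ?X t h else 0) + (if t + h \<le> t1 then h *\<^sub>R ?B t h + h *\<^sub>R ?Y t h else 0)" by simp
qed

text \<open>
  Perturbations of the exact solution. With the differences divided by the deviation from the solution, a
  uniform \<open>O(1)\<close> over this set is a local Lipschitz condition that is uniform in \<open>t\<close> and \<open>h\<close>.
\<close>

definition perturbed :: "real \<Rightarrow> (real \<times> 'a) set" where
  "perturbed \<rho> = {(t, x). t \<in> tI \<and> x \<noteq> W 0 t \<and> norm (x - W 0 t) \<le> \<rho>}"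

definition inverse_deviation :: "real \<times> 'a \<Rightarrow> real" where
  "inverse_deviation p = 1 / norm (snd p - W 0 (fst p))"

lemma perturbed_mono: "\<rho>' \<le> \<rho> \<Longrightarrow> perturbed \<rho>' \<subseteq> perturbed \<rho>"
  by (auto simp: perturbed_def)

lemma uO_perturbed_identity: "uO (perturbed \<rho>) 0 (\<lambda>p h. inverse_deviation p *\<^sub>R (snd p - W 0 (fst p)))"
  unfolding uO_def inverse_deviation_def perturbed_def by (intro exI[of _ 1] always_eventually) auto

lemma nonlinearity_lipschitz_near_solution:
  fixes X Y :: "real \<times> 'a \<Rightarrow> real \<Rightarrow> 'a"
  assumes lip: "uO (perturbed \<rho>) 0 (\<lambda>p h. inverse_deviation p *\<^sub>R (X p h - Y p h))" and \<rho>: "0 < \<rho>"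
    and near: "\<forall>\<^sub>F h in at_right 0. \<forall>p\<in>perturbed \<rho>. norm (Y p h - W 0 (fst p)) < r / 2"
  obtains \<rho>' where "0 < \<rho>'" "\<rho>' \<le> \<rho>"
    "uO (perturbed \<rho>') 0 (\<lambda>p h. inverse_deviation p *\<^sub>R (g (X p h) - g (Y p h)))"
proof -
  obtain L where L: "0 \<le> L" "\<forall>\<^sub>F h in at_right 0. 0 < h \<and> h \<le> 1 \<and> (\<forall>p\<in>perturbed \<rho>. norm (inverse_deviation p *\<^sub>R (X p h - Y p h)) \<le> L * h ^ 0)"
    using uO_D[OF lip] by blast
  define \<rho>' where "\<rho>' = min \<rho> (r / (2 * (L + 1)))"
  have \<rho>': "0 < \<rho>'" "\<rho>' \<le> \<rho>" "\<rho>' \<le> r / (2 * (L + 1))" using \<rho> r L(1) by (auto simp: \<rho>'_def)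
  have "uO (perturbed \<rho>') 0 (\<lambda>p h. inverse_deviation p *\<^sub>R (g (X p h) - g (Y p h)))"
  proof (rule uO_norm_le[OF _ uO_subset[OF lip perturbed_mono[OF \<rho>'(2)]]])
    show "\<forall>\<^sub>F h in at_right 0. \<forall>p\<in>perturbed \<rho>'. norm (inverse_deviation p *\<^sub>R (g (X p h) - g (Y p h))) \<le> C * norm (inverse_deviation p *\<^sub>R (X p h - Y p h))"
      using L(2) near
    proof eventually_elim
      case (elim h)
      show ?case
      proof
        fix p assume p: "p \<in> perturbed \<rho>'"
        then have p': "p \<in> perturbed \<rho>" using perturbed_mono[OF \<rho>'(2)] by blast
        obtain t x where tx: "p = (t, x)" "t \<in> tI" "x \<noteq> W 0 t" "norm (x - W 0 t) \<le> \<rho>'" using p by (auto simp: perturbed_def)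
        have d: "norm (x - W 0 t) > 0" using tx by simp
        have "norm (inverse_deviation p *\<^sub>R (X p h - Y p h)) \<le> L" using elim p' by auto
        then have "norm (X p h - Y p h) \<le> L * norm (x - W 0 t)"
          using norm_le_of_scaled_norm_le[OF d, of "X p h - Y p h"] by (simp add: inverse_deviation_def tx(1))
        also have "\<dots> \<le> L * (r / (2 * (L + 1)))" using tx \<rho>' L(1) by (intro mult_left_mono) auto
        also have "\<dots> \<le> r / 2"
        proof -
          have "L * r \<le> (L + 1) * r" using r by simp
          then show ?thesis using L(1) r by (simp add: field_simps)
        qed
        finally have 1: "norm (X p h - Y p h) \<le> r / 2" .
        have 2: "norm (Y p h - W 0 t) < r / 2" using elim(2) p' tx(1) by auto
        have 3: "norm (X p h - W 0 t) < r"
          using norm_triangle_ineq[of "X p h - Y p h" "Y p h - W 0 t"] 1 2 by simp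
        have "norm (g (X p h) - g (Y p h)) \<le> C * norm (X p h - Y p h)"
          using 2 3 r by (intro g_lipschitz[OF tx(2)]) (auto simp: dist_norm norm_minus_commute)
        then have "\<bar>inverse_deviation p\<bar> * norm (g (X p h) - g (Y p h)) \<le> \<bar>inverse_deviation p\<bar> * (C * norm (X p h - Y p h))"
          by (rule mult_left_mono) simp
        then show "norm (inverse_deviation p *\<^sub>R (g (X p h) - g (Y p h))) \<le> C * norm (inverse_deviation p *\<^sub>R (X p h - Y p h))"
          by (simp add: mult_ac)
      qed
    qed
  qed
  then show ?thesis using that \<rho>' by blast
qed

text \<open>
  Stage \<open>n\<close> is Lipschitz continuous because the \<open>g\<close>-values of the previous stages are; its own \<open>g\<close>-value is
  after shrinking \<open>\<rho>\<close> so that the stage remains in the strip.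
\<close>

lemma stages_lipschitz:
  "\<exists>\<rho>>0. uO (perturbed \<rho>) 0 (\<lambda>p h. inverse_deviation p *\<^sub>R (g (snd p) - g (W 0 (fst p)))) \<and>
     (\<forall>i<n. uO (perturbed \<rho>) 0 (\<lambda>p h. inverse_deviation p *\<^sub>R (g (stage i h (snd p)) - g (stage i h (W 0 (fst p))))))"
proof (induction n)
  case 0
  obtain \<rho>' where "0 < \<rho>'" "uO (perturbed \<rho>') 0 (\<lambda>p h. inverse_deviation p *\<^sub>R (g (snd p) - g (W 0 (fst p))))"
    using nonlinearity_lipschitz_near_solution[of 1 "\<lambda>p h. snd p" "\<lambda>p h. W 0 (fst p)", OF uO_perturbed_identity] r by auto
  then show ?case by auto
next
  case (Suc n)
  then obtain \<rho> where \<rho>: "0 < \<rho>" and g0: "uO (perturbed \<rho>) 0 (\<lambda>p h. inverse_deviation p *\<^sub>R (g (snd p) - g (W 0 (fst p))))"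
    and gi: "\<And>i. i < n \<Longrightarrow> uO (perturbed \<rho>) 0 (\<lambda>p h. inverse_deviation p *\<^sub>R (g (stage i h (snd p)) - g (stage i h (W 0 (fst p)))))"
    by blast
  let ?g0 = "\<lambda>p h. inverse_deviation p *\<^sub>R (g (snd p) - g (W 0 (fst p)))"
  let ?gi = "\<lambda>i p h. inverse_deviation p *\<^sub>R (g (stage i h (snd p)) - g (stage i h (W 0 (fst p))))"
  have "uO (perturbed \<rho>) 0 (\<lambda>p h. inverse_deviation p *\<^sub>R (stage n h (snd p) - stage n h (W 0 (fst p))))"
  proof (rule uO_eq)
    show "uO (perturbed \<rho>) 0 (\<lambda>p h. T (node M n * h) (inverse_deviation p *\<^sub>R (snd p - W 0 (fst p)))
      + (node M n *\<^sub>R (h *\<^sub>R phi_op T 1 (node M n * h) (?g0 p h)) + h *\<^sub>R (\<Sum>j=2..<n. aop M h n j (?gi j p h - ?g0 p h))))"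
      using node_nonneg
      by (intro uO_add uO_T uO_perturbed_identity uO_scaleR uO_mono[OF uO_h1] uO_phi_op uO_sum uO_aop uO_diff nn g0 gi) auto
    fix p h assume "p \<in> perturbed \<rho>" and h: "0 < h" "h \<le> (1::real)"
    have h0: "0 \<le> h" using h by simp
    have a: "inverse_deviation p *\<^sub>R aop M h n j x = aop M h n j (inverse_deviation p *\<^sub>R x)" for j x by (simp add: aop_scaleR[OF nn h0])
    have ch: "0 \<le> node M n * h" using h0 node_nonneg by simp
    have b: "inverse_deviation p *\<^sub>R phi_op T 1 (node M n * h) x = phi_op T 1 (node M n * h) (inverse_deviation p *\<^sub>R x)" for x
      using phi_op_scaleR[OF ch] by simp
    have "stage n h (snd p) - stage n h (W 0 (fst p)) =
       T (node M n * h) (snd p - W 0 (fst p)) + (node M n * h) *\<^sub>R phi_op T 1 (node M n * h) (g (snd p) - g (W 0 (fst p)))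
       + h *\<^sub>R (\<Sum>j=2..<n. aop M h n j ((g (stage j h (snd p)) - g (stage j h (W 0 (fst p)))) - (g (snd p) - g (W 0 (fst p)))))"
      unfolding stage_eq[OF h0, of n]
      by (simp add: blinfun.diff_right phi_op_diff[OF ch] aop_diff[OF nn h0] sum_subtractf scaleR_diff_right)
    then have "inverse_deviation p *\<^sub>R (stage n h (snd p) - stage n h (W 0 (fst p))) =
       inverse_deviation p *\<^sub>R (T (node M n * h) (snd p - W 0 (fst p)) + (node M n * h) *\<^sub>R phi_op T 1 (node M n * h) (g (snd p) - g (W 0 (fst p)))
       + h *\<^sub>R (\<Sum>j=2..<n. aop M h n j ((g (stage j h (snd p)) - g (stage j h (W 0 (fst p)))) - (g (snd p) - g (W 0 (fst p))))))"
      by (simp only:)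
    also have "\<dots> = T (node M n * h) (inverse_deviation p *\<^sub>R (snd p - W 0 (fst p)))
      + (node M n *\<^sub>R (h *\<^sub>R phi_op T 1 (node M n * h) (?g0 p h)) + h *\<^sub>R (\<Sum>j=2..<n. aop M h n j (?gi j p h - ?g0 p h)))"
      unfolding scaleR_diff_right[of "inverse_deviation p", symmetric] a[symmetric] b[symmetric]
      by (simp add: blinfun.scaleR_right scaleR_add_right scaleR_sum_right mult_ac)
    finally show "inverse_deviation p *\<^sub>R (stage n h (snd p) - stage n h (W 0 (fst p))) = T (node M n * h) (inverse_deviation p *\<^sub>R (snd p - W 0 (fst p)))
      + (node M n *\<^sub>R (h *\<^sub>R phi_op T 1 (node M n * h) (?g0 p h)) + h *\<^sub>R (\<Sum>j=2..<n. aop M h n j (?gi j p h - ?g0 p h)))" .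
  qed
  moreover have "\<forall>\<^sub>F h in at_right 0. \<forall>p\<in>perturbed \<rho>. norm (stage n h (W 0 (fst p)) - W 0 (fst p)) < r / 2"
    using uO_small[OF stage_near[of n], of "r / 2"] r
    by (auto simp: perturbed_def elim!: eventually_mono)
  ultimately obtain \<rho>' where \<rho>': "0 < \<rho>'" "\<rho>' \<le> \<rho>" "uO (perturbed \<rho>') 0 (?gi n)"
    using nonlinearity_lipschitz_near_solution[where X="\<lambda>p h. stage n h (snd p)"
      and Y="\<lambda>p h. stage n h (W 0 (fst p))", OF _ \<rho>] by blast
  show ?case
  proof (intro exI[of _ \<rho>'] conjI allI impI \<rho>'(1))
    show "uO (perturbed \<rho>') 0 ?g0" by (rule uO_subset[OF g0 perturbed_mono[OF \<rho>'(2)]])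
    fix i assume "i < Suc n"
    then show "uO (perturbed \<rho>') 0 (?gi i)"
      using uO_subset[OF gi perturbed_mono[OF \<rho>'(2)]] \<rho>'(3) by (cases "i = n") auto
  qed
qed

text \<open>
  The step map is the semigroup plus \<open>h\<close> times a map that is Lipschitz continuous near the solution, so that
  errors are propagated by exact powers of the semigroup, up to perturbations of size \<open>h\<close>.
\<close>

lemma step_stability:
  obtains L \<rho> where "0 \<le> L" "0 < \<rho>"
    "\<forall>\<^sub>F h in at_right 0. \<forall>t\<in>tI. \<forall>x. norm (x - W 0 t) \<le> \<rho> \<longrightarrow>
       norm (exprk_step M T D A g h x - exprk_step M T D A g h (W 0 t) - T h (x - W 0 t)) \<le> h * L * norm (x - W 0 t)"
proof -
  obtain \<rho> where \<rho>: "0 < \<rho>" and g0: "uO (perturbed \<rho>) 0 (\<lambda>p h. inverse_deviation p *\<^sub>R (g (snd p) - g (W 0 (fst p))))"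
    and gi: "\<And>i. i < Suc (stages M) \<Longrightarrow> uO (perturbed \<rho>) 0 (\<lambda>p h. inverse_deviation p *\<^sub>R (g (stage i h (snd p)) - g (stage i h (W 0 (fst p)))))"
    using stages_lipschitz[of "Suc (stages M)"] by blast
  let ?g0 = "\<lambda>p h. inverse_deviation p *\<^sub>R (g (snd p) - g (W 0 (fst p)))"
  let ?gi = "\<lambda>i p h. inverse_deviation p *\<^sub>R (g (stage i h (snd p)) - g (stage i h (W 0 (fst p))))"
  let ?Z = "\<lambda>p h. exprk_step M T D A g h (snd p) - exprk_step M T D A g h (W 0 (fst p)) - T h (snd p - W 0 (fst p))"
  have "uO (perturbed \<rho>) 1 (\<lambda>p h. inverse_deviation p *\<^sub>R ?Z p h)"
  proof (rule uO_eq)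
    show "uO (perturbed \<rho>) 1 (\<lambda>p h. h *\<^sub>R (phi_op T 1 (1 * h) (?g0 p h) + (\<Sum>i=2..stages M. bop M h i (?gi i p h - ?g0 p h))))"
      by (intro uO_h1 uO_add uO_phi_op uO_sum uO_bop uO_diff nn g0 gi) auto
    fix p h assume "p \<in> perturbed \<rho>" and h: "0 < h" "h \<le> (1::real)"
    have h0: "0 \<le> h" using h by simp
    have a: "inverse_deviation p *\<^sub>R bop M h j x = bop M h j (inverse_deviation p *\<^sub>R x)" for j x by (simp add: bop_scaleR[OF nn h0])
    have b: "inverse_deviation p *\<^sub>R phi_op T 1 h x = phi_op T 1 h (inverse_deviation p *\<^sub>R x)" for x
      using phi_op_scaleR[OF h0] by simp
    have "inverse_deviation p *\<^sub>R ?Z p h = inverse_deviation p *\<^sub>R (h *\<^sub>R (phi_op T 1 h (g (snd p) - g (W 0 (fst p)))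
       + (\<Sum>i=2..stages M. bop M h i ((g (stage i h (snd p)) - g (stage i h (W 0 (fst p)))) - (g (snd p) - g (W 0 (fst p)))))))"
      unfolding step_eq[OF h0]
      by (simp add: blinfun.diff_right phi_op_diff[OF h0] bop_diff[OF nn h0] sum_subtractf scaleR_diff_right scaleR_add_right)
    also have "\<dots> = h *\<^sub>R (phi_op T 1 (1 * h) (?g0 p h) + (\<Sum>i=2..stages M. bop M h i (?gi i p h - ?g0 p h)))"
      unfolding scaleR_diff_right[of "inverse_deviation p", symmetric] a[symmetric] mult_1 b[symmetric]
      by (simp add: scaleR_add_right scaleR_sum_right mult_ac)
    finally show "inverse_deviation p *\<^sub>R ?Z p h = h *\<^sub>R (phi_op T 1 (1 * h) (?g0 p h) + (\<Sum>i=2..stages M. bop M h i (?gi i p h - ?g0 p h)))" .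
  qed
  then obtain L where L: "0 \<le> L" "\<forall>\<^sub>F h in at_right 0. 0 < h \<and> h \<le> 1 \<and> (\<forall>p\<in>perturbed \<rho>. norm (inverse_deviation p *\<^sub>R ?Z p h) \<le> L * h ^ 1)"
    using uO_D by blast
  from L(2) have "\<forall>\<^sub>F h in at_right 0. \<forall>t\<in>tI. \<forall>x. norm (x - W 0 t) \<le> \<rho> \<longrightarrow>
       norm (exprk_step M T D A g h x - exprk_step M T D A g h (W 0 t) - T h (x - W 0 t)) \<le> h * L * norm (x - W 0 t)"
  proof eventually_elim
    case (elim h)
    show ?case
    proof (intro ballI allI impI)
      fix t x assume t: "t \<in> tI" "norm (x - W 0 t) \<le> \<rho>"
      show "norm (exprk_step M T D A g h x - exprk_step M T D A g h (W 0 t) - T h (x - W 0 t)) \<le> h * L * norm (x - W 0 t)"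
      proof (cases "x = W 0 t")
        case False
        then have "(t, x) \<in> perturbed \<rho>" "norm (x - W 0 t) > 0" using t by (auto simp: perturbed_def)
        then have d: "norm (x - W 0 t) > 0" and b: "norm (inverse_deviation (t, x) *\<^sub>R ?Z (t, x) h) \<le> L * h ^ 1"
          using elim by auto
        show ?thesis
          using norm_le_of_scaled_norm_le[OF d b[unfolded inverse_deviation_def fst_conv snd_conv]] by (simp add: mult_ac)
      qed simp
    qed
  qed
  then show ?thesis using that[OF L(1) \<rho>] by blast
qed

end

section \<open>Global error\<close>

context smooth_setting begin

lemma leading_defect_add: "0 \<le> h \<Longrightarrow> leading_defect h (x + y) = leading_defect h x + leading_defect h y"
  by (simp add: leading_defect_def bop_add[OF nn] phi_op_add scaleR_add_right sum.distrib)

lemma leading_defect_scaleR: "0 \<le> h \<Longrightarrow> leading_defect h (c *\<^sub>R x) = c *\<^sub>R leading_defect h x"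
  by (simp add: leading_defect_def bop_scaleR[OF nn] phi_op_scaleR scaleR_diff_right scaleR_sum_right mult.commute)

lemma leading_defect_diff: "0 \<le> h \<Longrightarrow> leading_defect h (x - y) = leading_defect h x - leading_defect h y"
  using leading_defect_add[of h x "- 1 *\<^sub>R y"] leading_defect_scaleR[of h "- 1" y] by simp

lemma accumulated_defect:
  assumes e0: "e 0 = 0" and rec: "\<And>n. n < N \<Longrightarrow> e (Suc n) = T h (e n) + d n" and h: "0 \<le> h"
  shows "e N = (\<Sum>n<N. T (real (N - Suc n) * h) (d n))"
  using rec
proof (induction N)
  case 0
  then show ?case by (simp add: e0)
next
  case (Suc N)
  have "e (Suc N) = T h (\<Sum>n<N. T (real (N - Suc n) * h) (d n)) + d N"
    using Suc.prems[of N] Suc.IH Suc.prems by simp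
  also have "T h (\<Sum>n<N. T (real (N - Suc n) * h) (d n)) = (\<Sum>n<N. T (real (Suc N - Suc n) * h) (d n))"
    unfolding blinfun.sum_right
  proof (rule sum.cong[OF refl])
    fix n assume "n \<in> {..<N}"
    then have "real (Suc N - Suc n) = 1 + real (N - Suc n)" by (simp add: of_nat_diff)
    then have "real (Suc N - Suc n) * h = h + real (N - Suc n) * h" by (simp add: algebra_simps)
    then show "T h (T (real (N - Suc n) * h) (d n)) = T (real (Suc N - Suc n) * h) (d n)"
      using h by (simp only:) (simp add: T_add_apply)
  qed
  also have "d N = T (real (Suc N - Suc N) * h) (d N)" by (simp add: T_zero)
  finally show ?case by simp
qed

text \<open>
  Summation by parts with the bounded sums \<open>\<Sum> T (l h) \<delta>(hA)\<close>; the increments of \<open>f\<^sup>(\<^sup>5\<^sup>)\<close> over one step are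
  \<open>O(h)\<close>, and there are \<open>O(1/h)\<close> of them.
\<close>

lemma leading_defect_sum_bound:
  assumes K: "\<And>m x. real m * h \<le> t1 - t0 \<Longrightarrow> norm (\<Sum>l<m. T (real l * h) (leading_defect h x)) \<le> K * norm x"
    and h: "0 < h" and N: "real N * h \<le> t1 - t0"
  shows "norm (\<Sum>n<N. T (real (N - Suc n) * h) (leading_defect h (F 5 (t0 + real n * h)))) \<le> \<bar>K\<bar> * C * (1 + (t1 - t0))"
proof (cases N)
  case 0
  then show ?thesis using C_nonneg t01 by simp
next
  case (Suc m)
  have h0: "0 \<le> h" using h by simp
  define y where "y n = F 5 (t0 + real n * h)" for n
  have times: "t0 + real n * h \<in> tI" if "n \<le> N" for n
  proof -
    have "real n * h \<le> real N * h" using that h by (intro mult_right_mono) auto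
    then have "real n * h \<le> t1 - t0" using N by linarith
    moreover have "0 \<le> real n * h" using h by simp
    ultimately show ?thesis unfolding atLeastAtMost_iff by linarith
  qed
  have K': "norm (\<Sum>l<k. T (real l * h) (leading_defect h x)) \<le> \<bar>K\<bar> * B" if "k \<le> N" "norm x \<le> B" for k x B
  proof -
    have "real k * h \<le> real N * h" using that h by (intro mult_right_mono) auto
    then have "norm (\<Sum>l<k. T (real l * h) (leading_defect h x)) \<le> K * norm x" using N by (intro K) auto
    also have "\<dots> \<le> \<bar>K\<bar> * norm x" by (intro mult_right_mono) auto
    also have "\<dots> \<le> \<bar>K\<bar> * B" using that by (intro mult_left_mono) auto
    finally show ?thesis .
  qed
  have y0: "norm (y 0) \<le> C" using times[of 0] t12 unfolding y_def by (intro F_bd) auto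
  have dy: "norm (y (Suc n) - y n) \<le> C * h" if "n < m" for n
  proof -
    let ?a = "t0 + real n * h" and ?b = "t0 + real (Suc n) * h"
    have ab: "?a \<in> tI" "?b \<in> tI" using times[of n] times[of "Suc n"] that Suc by auto
    have sub: "{?a..?b} \<subseteq> {t0..t2}" using ab t12 by auto
    have le: "?a \<le> ?b" using h by simp
    have "norm (F 5 ?b - F 5 ?a) \<le> C * (?b - ?a)"
    proof (rule vector_derivative_norm_bound[OF le])
      fix s assume s: "s \<in> {?a..?b}"
      then have s2: "s \<in> {t0..t2}" using sub by blast
      show "(F 5 has_vector_derivative F (Suc 5) s) (at s within {?a..?b})"
        by (rule has_vector_derivative_within_subset[OF F_der[OF _ s2] sub]) simp
      show "norm (F (Suc 5) s) \<le> C" by (rule F_bd[OF _ s2]) simp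
    qed
    then show ?thesis by (simp add: y_def algebra_simps)
  qed
  have "(\<Sum>n<N. T (real (N - Suc n) * h) (leading_defect h (F 5 (t0 + real n * h)))) = (\<Sum>n<Suc m. T (real (m - n) * h) (leading_defect h (y n)))"
    unfolding Suc y_def by simp
  also have "\<dots> = (\<Sum>l<Suc m. T (real l * h) (leading_defect h (y 0))) + (\<Sum>n<m. \<Sum>l<m - n. T (real l * h) (leading_defect h (y (Suc n) - y n)))"
    by (rule abel_summation[where V="\<lambda>l x. T (real l * h) (leading_defect h x)"]) (simp add: leading_defect_diff[OF h0] blinfun.diff_right)
  also have "norm \<dots> \<le> \<bar>K\<bar> * C + (\<Sum>n<m. \<bar>K\<bar> * (C * h))"
  proof (rule order_trans[OF norm_triangle_ineq add_mono])
    show "norm (\<Sum>l<Suc m. T (real l * h) (leading_defect h (y 0))) \<le> \<bar>K\<bar> * C" using y0 Suc by (intro K') auto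
    show "norm (\<Sum>n<m. \<Sum>l<m - n. T (real l * h) (leading_defect h (y (Suc n) - y n))) \<le> (\<Sum>n<m. \<bar>K\<bar> * (C * h))"
      using dy Suc by (intro sum_norm_le K') auto
  qed
  also have "\<dots> = \<bar>K\<bar> * C * (1 + real m * h)" by (simp add: algebra_simps)
  also have "\<dots> \<le> \<bar>K\<bar> * C * (1 + (t1 - t0))"
  proof -
    have "real m * h \<le> real N * h" using h Suc by (intro mult_right_mono) auto
    then show ?thesis using N C_nonneg by (intro mult_left_mono) auto
  qed
  finally show ?thesis .
qed

text \<open>
  Solving the error recursion expresses the global error by the semigroup applied to the nonlinear
  perturbations (handled by Gronwall), to the leading defects (bounded by summation by parts) and to the
  \<open>O(h\<^sup>7)\<close> remainders (\<open>O(1/h)\<close> terms).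
\<close>

lemma convergence:
  assumes K: "\<And>m h x. 0 < h \<Longrightarrow> h \<le> 1 \<Longrightarrow> real m * h \<le> t1 - t0 \<Longrightarrow>
    norm (\<Sum>l<m. T (real l * h) (leading_defect h x)) \<le> K * norm x"
  shows "\<exists>C' h0. 0 < h0 \<and> (\<forall>h n. 0 < h \<and> h \<le> h0 \<and> t0 + real n * h \<le> t1 \<longrightarrow>
     norm ((exprk_step M T D A g h ^^ n) (W 0 t0) - W 0 (t0 + real n * h)) \<le> C' * h ^ 6)"
proof -
  define \<tau> where "\<tau> = t1 - t0"
  have \<tau>: "0 < \<tau>" using t01 by (simp add: \<tau>_def)
  obtain E0 where E0: "1 \<le> E0" "\<And>t. 0 \<le> t \<Longrightarrow> t \<le> \<tau> \<Longrightarrow> norm (T t) \<le> E0" using T_locally_bounded by blast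
  obtain L \<rho> where L: "0 \<le> L" and \<rho>: "0 < \<rho>" and stab: "\<forall>\<^sub>F h in at_right 0. \<forall>t\<in>tI. \<forall>x. norm (x - W 0 t) \<le> \<rho> \<longrightarrow>
       norm (exprk_step M T D A g h x - exprk_step M T D A g h (W 0 t) - T h (x - W 0 t)) \<le> h * L * norm (x - W 0 t)"
    using step_stability by blast
  obtain C1 where C1: "0 \<le> C1" and loc: "\<forall>\<^sub>F h in at_right 0. 0 < h \<and> h \<le> 1 \<and> (\<forall>t\<in>tI. norm (if t + h \<le> t1
      then exprk_step M T D A g h (W 0 t) - W 0 (t + h) - h ^ 6 *\<^sub>R leading_defect h (F 5 t) else 0) \<le> C1 * h ^ 7)"
    using uO_D[OF local_error] by blast
  define a where "a = \<bar>K\<bar> * C * (1 + \<tau>) + E0 * C1 * \<tau>"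
  have a0: "0 \<le> a" using C_nonneg \<tau> E0(1) C1 by (simp add: a_def)
  define b where "b = E0 * L"
  have b0: "0 \<le> b" using E0(1) L by (simp add: b_def)
  define C' where "C' = a * exp (b * \<tau>)"
  have C'0: "0 \<le> C'" using a0 by (simp add: C'_def)
  have "\<forall>\<^sub>F h in at_right 0. 0 < h \<and> h \<le> \<rho> / (C' + 1)"
    using \<rho> C'0 by (intro eventually_small) auto
  with stab loc have "\<forall>\<^sub>F h in at_right 0. \<forall>n. t0 + real n * h \<le> t1 \<longrightarrow>
     norm ((exprk_step M T D A g h ^^ n) (W 0 t0) - W 0 (t0 + real n * h)) \<le> C' * h ^ 6"
  proof eventually_elim
    case (elim h)
    have h: "0 < h" "h \<le> 1" using elim by auto
    have h0: "0 \<le> h" using h by simp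
    have small: "C' * h ^ 6 \<le> \<rho>"
    proof -
      have "C' * h ^ 6 \<le> C' * h" using h C'0 power_decreasing[of 1 6 h] by (intro mult_left_mono) auto
      also have "\<dots> \<le> (C' + 1) * h" using h by simp
      also have "\<dots> \<le> \<rho>" using elim(3) C'0 by (simp add: pos_le_divide_eq mult.commute)
      finally show ?thesis .
    qed
    show ?case
    proof (intro allI impI)
      fix N assume N: "t0 + real N * h \<le> t1"
      define v where "v n = (exprk_step M T D A g h ^^ n) (W 0 t0)" for n
      define tt where "tt n = t0 + real n * h" for n
      define e where "e n = v n - W 0 (tt n)" for n
      define s where "s n = exprk_step M T D A g h (v n) - exprk_step M T D A g h (W 0 (tt n)) - T h (v n - W 0 (tt n))" for n
      define R where "R n = exprk_step M T D A g h (W 0 (tt n)) - W 0 (tt (Suc n)) - h ^ 6 *\<^sub>R leading_defect h (F 5 (tt n))" for n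
      have grid: "real n * h \<le> \<tau>" if "n \<le> N" for n
      proof -
        have "real n * h \<le> real N * h" using that h by (intro mult_right_mono) auto
        then show ?thesis using N by (simp add: \<tau>_def)
      qed
      have tt: "tt n \<in> tI" if "n \<le> N" for n using grid[OF that] h by (simp add: tt_def \<tau>_def)
      have ttS: "tt (Suc n) = tt n + h" for n by (simp add: tt_def algebra_simps)
      have step: "e (Suc n) = T h (e n) + (s n + (h ^ 6 *\<^sub>R leading_defect h (F 5 (tt n)) + R n))" for n
        by (simp add: e_def s_def R_def v_def)
      have e0: "e 0 = 0" by (simp add: e_def v_def tt_def)
      have R: "norm (R n) \<le> C1 * h ^ 7" if "n < N" for n
      proof -
        have "tt n + h \<le> t1" using tt[of "Suc n"] that by (simp add: ttS)
        then show ?thesis using elim(2) tt[of n] that unfolding R_def ttS by force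
      qed
      have Tb: "norm (T (real (m - Suc n) * h) x) \<le> E0 * norm x" if "m \<le> N" for m n x
        using that grid[of "m - Suc n"] h0 by (intro T_apply_bound[OF E0(2)]) auto
      have rec: "norm (e m) \<le> a * h ^ 6 + (b * h) * (\<Sum>n<m. norm (e n))"
        if m: "m \<le> N" and prev: "\<And>n. n < m \<Longrightarrow> norm (e n) \<le> \<rho>" for m
      proof -
        have "e m = (\<Sum>n<m. T (real (m - Suc n) * h) (s n + (h ^ 6 *\<^sub>R leading_defect h (F 5 (tt n)) + R n)))"
          by (rule accumulated_defect[OF e0 step h0])
        also have "\<dots> = (\<Sum>n<m. T (real (m - Suc n) * h) (s n))
          + (h ^ 6 *\<^sub>R (\<Sum>n<m. T (real (m - Suc n) * h) (leading_defect h (F 5 (tt n)))) + (\<Sum>n<m. T (real (m - Suc n) * h) (R n)))"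
          by (simp only: blinfun.add_right blinfun.scaleR_right sum.distrib scaleR_sum_right)
        finally have em: "e m = (\<Sum>n<m. T (real (m - Suc n) * h) (s n))
          + (h ^ 6 *\<^sub>R (\<Sum>n<m. T (real (m - Suc n) * h) (leading_defect h (F 5 (tt n)))) + (\<Sum>n<m. T (real (m - Suc n) * h) (R n)))" .
        have p1: "norm (\<Sum>n<m. T (real (m - Suc n) * h) (s n)) \<le> (b * h) * (\<Sum>n<m. norm (e n))"
        proof -
          have "norm (\<Sum>n<m. T (real (m - Suc n) * h) (s n)) \<le> (\<Sum>n<m. (b * h) * norm (e n))"
          proof (rule sum_norm_le)
            fix n assume n: "n \<in> {..<m}"
            have "norm (s n) \<le> h * L * norm (e n)"
              using elim(1) tt[of n] prev[of n] n m unfolding s_def e_def by auto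
            then have "E0 * norm (s n) \<le> E0 * (h * L * norm (e n))" using E0(1) by (intro mult_left_mono) auto
            then show "norm (T (real (m - Suc n) * h) (s n)) \<le> (b * h) * norm (e n)"
              using Tb[OF m, of n "s n"] by (simp add: b_def mult_ac)
          qed
          then show ?thesis by (simp add: sum_distrib_left)
        qed
        have p2: "norm (h ^ 6 *\<^sub>R (\<Sum>n<m. T (real (m - Suc n) * h) (leading_defect h (F 5 (tt n))))) \<le> (\<bar>K\<bar> * C * (1 + \<tau>)) * h ^ 6"
        proof -
          have "norm (\<Sum>n<m. T (real (m - Suc n) * h) (leading_defect h (F 5 (tt n)))) \<le> \<bar>K\<bar> * C * (1 + \<tau>)"
            unfolding tt_def \<tau>_def using grid[OF m] by (intro leading_defect_sum_bound K h) (auto simp: \<tau>_def)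
          then show ?thesis using h by (simp add: mult.commute mult_left_mono)
        qed
        have p3: "norm (\<Sum>n<m. T (real (m - Suc n) * h) (R n)) \<le> (E0 * C1 * \<tau>) * h ^ 6"
        proof -
          have "norm (\<Sum>n<m. T (real (m - Suc n) * h) (R n)) \<le> (\<Sum>n<m. E0 * (C1 * h ^ 7))"
          proof (rule sum_norm_le)
            fix n assume "n \<in> {..<m}"
            then have "E0 * norm (R n) \<le> E0 * (C1 * h ^ 7)" using R[of n] m E0(1) by (intro mult_left_mono) auto
            then show "norm (T (real (m - Suc n) * h) (R n)) \<le> E0 * (C1 * h ^ 7)"
              using Tb[OF m, of n "R n"] by linarith
          qed
          also have "\<dots> = (E0 * C1 * h ^ 6) * (real m * h)" by (simp add: power_numeral_reduce mult_ac)
          also have "\<dots> \<le> (E0 * C1 * h ^ 6) * \<tau>" using grid[OF m] E0(1) C1 h by (intro mult_left_mono) auto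
          finally show ?thesis by (simp add: mult_ac)
        qed
        have "norm (e m) \<le> (b * h) * (\<Sum>n<m. norm (e n)) + ((\<bar>K\<bar> * C * (1 + \<tau>)) * h ^ 6 + (E0 * C1 * \<tau>) * h ^ 6)"
          unfolding em
          by (rule order_trans[OF norm_triangle_ineq add_mono[OF p1 order_trans[OF norm_triangle_ineq add_mono[OF p2 p3]]]])
        also have "\<dots> = a * h ^ 6 + (b * h) * (\<Sum>n<m. norm (e n))" by (simp add: a_def algebra_simps)
        finally show ?thesis .
      qed
      have exp_le: "(a * h ^ 6) * exp ((b * h) * real N) \<le> C' * h ^ 6"
      proof -
        have "(b * h) * real N \<le> b * \<tau>" using grid[of N] b0 mult_left_mono[of "real N * h" \<tau> b] by (simp add: mult_ac)
        then have "a * h ^ 6 * exp ((b * h) * real N) \<le> a * h ^ 6 * exp (b * \<tau>)" using a0 h by (intro mult_left_mono) auto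
        then show ?thesis by (simp add: C'_def mult_ac)
      qed
      have "norm (e N) \<le> (a * h ^ 6) * exp ((b * h) * real N)"
      proof (rule discrete_gronwall[where \<rho>=\<rho>])
        show "a * h ^ 6 * exp (b * h * real N) \<le> \<rho>" using exp_le small by linarith
      qed (use a0 b0 h rec in auto)
      then show "norm ((exprk_step M T D A g h ^^ N) (W 0 t0) - W 0 (t0 + real N * h)) \<le> C' * h ^ 6"
        using exp_le by (simp add: e_def v_def tt_def)
    qed
  qed
  then obtain h0 where h0: "h0 > 0" "\<And>h n. 0 < h \<Longrightarrow> h < h0 \<Longrightarrow> t0 + real n * h \<le> t1 \<Longrightarrow>
     norm ((exprk_step M T D A g h ^^ n) (W 0 t0) - W 0 (t0 + real n * h)) \<le> C' * h ^ 6"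
    unfolding eventually_at_right_field by auto
  show ?thesis
    by (intro exI[of _ C'] exI[of _ "h0 / 2"] conjI allI impI) (use h0 in auto)
qed

end

section \<open>Normal form of a method\<close>

text \<open>
  The method with all coefficients outside the index ranges of the scheme replaced by zero. It has the same
  numerical solution and satisfies the same conditions, but its coefficient operators are bounded and linear
  for all indices, which spares range conditions in the expansions.
\<close>

definition normalized :: "exprk \<Rightarrow> exprk" where
  "normalized M = M\<lparr>node := (\<lambda>i. if i \<in> {1..stages M} then node M i else 0),
     acoef := (\<lambda>i j. if i \<in> {2..stages M} \<and> j \<in> {2..<i} then acoef M i j else []),
     bcoef := (\<lambda>i. if i \<in> {2..stages M} then bcoef M i else [])\<rparr>"

lemma normalized_simps [simp]:
  "stages (normalized M) = stages M"
  "2 \<le> i \<Longrightarrow> i \<le> stages M \<Longrightarrow> node (normalized M) i = node M i"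
  "2 \<le> i \<Longrightarrow> i \<le> stages M \<Longrightarrow> 2 \<le> j \<Longrightarrow> j < i \<Longrightarrow> acoef (normalized M) i j = acoef M i j"
  "2 \<le> i \<Longrightarrow> i \<le> stages M \<Longrightarrow> bcoef (normalized M) i = bcoef M i"
  by (auto simp: normalized_def)

lemma nonneg_scalings_normalized:
  assumes "exprk_method M" shows "nonneg_scalings (normalized M)"
proof -
  have *: "0 \<le> r" if "admissible_coef M p" "(w, k, r) \<in> set p" for p w k r
    using that assms by (fastforce simp: admissible_coef_def exprk_method_def)
  have a: "0 \<le> r" if "2 \<le> i" "i \<le> stages M" "2 \<le> j" "j < i" "(w, k, r) \<in> set (acoef M i j)" for i j w k r
    by (rule *[OF _ that(5)]) (use assms that in \<open>auto simp: exprk_method_def\<close>)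
  have b: "0 \<le> r" if "2 \<le> i" "i \<le> stages M" "(w, k, r) \<in> set (bcoef M i)" for i w k r
    by (rule *[OF _ that(3)]) (use assms that in \<open>auto simp: exprk_method_def\<close>)
  have c: "0 \<le> node M i" if "1 \<le> i" "i \<le> stages M" for i
    using assms that by (auto simp: exprk_method_def)
  show ?thesis
    unfolding nonneg_scalings_def normalized_def by (auto split: if_splits dest: a b intro: c)
qed

lemma exprk_stage_normalized:
  "2 \<le> i \<Longrightarrow> i \<le> stages M \<Longrightarrow> exprk_stage (normalized M) T D A g h x i = exprk_stage M T D A g h x i"
proof (induction i rule: less_induct)
  case (less i)
  have "(\<Sum>j=2..<i. comb_op T h (acoef (normalized M) i j) (g (exprk_stage (normalized M) T D A g h x j) - g x)) =
     (\<Sum>j=2..<i. comb_op T h (acoef M i j) (g (exprk_stage M T D A g h x j) - g x))"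
    using less by (intro sum.cong) auto
  then show ?case using less.prems
    by (subst (1 2) exprk_stage.simps) simp
qed

lemma exprk_step_normalized:
  "exprk_step (normalized M) T D A g h = exprk_step M T D A g h"
  by (rule ext) (auto simp: exprk_step_def exprk_stage_normalized intro!: sum.cong)

lemma psi_op_normalized:
  "2 \<le> i \<Longrightarrow> i \<le> stages M \<Longrightarrow> psi_op T (normalized M) h q i x = psi_op T M h q i x"
  by (auto simp: psi_op_def intro!: sum.cong)

lemma stiff_conditions_normalized:
  "stiff_conditions_except_quadrature6 \<K> T (normalized M) h \<longleftrightarrow> stiff_conditions_except_quadrature6 \<K> T M h"
proof -
  have "quadrature_condition T (normalized M) h q = quadrature_condition T M h q" for q
    unfolding quadrature_condition_def by simp
  then show ?thesis
    unfolding stiff_conditions_except_quadrature6_def Let_def by (simp add: psi_op_normalized)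
qed

section \<open>Convergence of order six\<close>

theorem theorem3p1:
  fixes \<K> :: "('a::banach) scalars"
    and T :: "real \<Rightarrow> 'a \<Rightarrow>\<^sub>L 'a"
    and D :: "'a set"
    and A g :: "'a \<Rightarrow> 'a"
    and t0 tend r :: real
    and u0 :: 'a
    and u :: "real \<Rightarrow> 'a"
    and M :: exprk
  assumes "banach_over \<K>"
    and "analytic_semigroup \<K> T"
    and "infinitesimal_generator T D A"
    and "t0 < tend"
    and "smooth_solution D A g t0 tend u0 u"
    and "0 < r"
    and "frechet_differentiable6 \<K> g (strip_along u t0 tend r)"
    and "exprk_method M"
    and "((\<forall>h>0. stiff_conditions_except_quadrature6 \<K> T M h) \<and>
          (\<forall>h>0. quadrature_condition T M h 6))
       \<or> ((\<forall>h>0. stiff_conditions_except_quadrature6 \<K> T M h) \<and>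
          weak_quadrature_condition M 6)"
  shows "\<exists>C h0. 0 < h0 \<and>
           (\<forall>h n. 0 < h \<and> h \<le> h0 \<and> t0 + real n * h \<le> tend \<longrightarrow>
              norm (exprk_solution M T D A g u0 h n - u (t0 + real n * h)) \<le> C * h ^ 6)"
proof -
  interpret c0_semigroup T using assms(2) by (rule analytic_semigroup_c0)
  have stiff: "stiff_conditions_except_quadrature6 \<K> T M h" if "0 < h" for h using assms(9) that by blast
  define S where "S = strip_along u t0 tend r"
  have openS: "open S" by (auto simp: S_def strip_along_def)
  obtain g1 g2 g3 g4 g5 g6 Mg where g: "\<forall>x\<in>S.
        bounded_linear_over \<K> (blinfun_apply (g1 x)) \<and>
        (g has_derivative blinfun_apply (g1 x)) (at x) \<and>
        (g1 has_derivative blinfun_apply (g2 x)) (at x) \<and>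
        (g2 has_derivative blinfun_apply (g3 x)) (at x) \<and>
        (g3 has_derivative blinfun_apply (g4 x)) (at x) \<and>
        (g4 has_derivative blinfun_apply (g5 x)) (at x) \<and>
        (g5 has_derivative blinfun_apply (g6 x)) (at x) \<and>
        norm (g1 x) \<le> Mg \<and> norm (g2 x) \<le> Mg \<and> norm (g3 x) \<le> Mg \<and>
        norm (g4 x) \<le> Mg \<and> norm (g5 x) \<le> Mg \<and> norm (g6 x) \<le> Mg"
    using assms(7) unfolding frechet_differentiable6_def S_def[symmetric] by (elim exE) (rule that)
  have sol: "u t0 = u0" "\<And>t. t \<in> {t0..tend} \<Longrightarrow> u t \<in> D"
    "\<And>t. t \<in> {t0..tend} \<Longrightarrow> (u has_vector_derivative (A (u t) + g (u t))) (at t within {t0..tend})"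
    using assms(5) by (auto simp: smooth_solution_def)
  obtain w Mw where w: "w 0 = u"
    "\<And>k t. k < 6 \<Longrightarrow> t \<in> {t0..tend} \<Longrightarrow> (w k has_vector_derivative w (Suc k) t) (at t within {t0..tend})"
    "\<And>k t. k \<le> 6 \<Longrightarrow> t \<in> {t0..tend} \<Longrightarrow> norm (w k t) \<le> Mw"
  proof -
    have "\<exists>w :: nat \<Rightarrow> real \<Rightarrow> 'a. \<exists>M. w 0 = u \<and>
        (\<forall>k<6. \<forall>t\<in>{t0..tend}. (w k has_vector_derivative w (Suc k) t) (at t within {t0..tend})) \<and>
        (\<forall>k\<le>6. \<forall>t\<in>{t0..tend}. norm (w k t) \<le> M)"
      using assms(5) unfolding smooth_solution_def by (elim conjE)
    then show ?thesis using that by blast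
  qed
  obtain W C1 where W: "\<And>k t. t \<in> {t0..tend} \<Longrightarrow> W k t = w k t"
    "\<And>k t. k < 6 \<Longrightarrow> t \<in> {t0..tend + 1} \<Longrightarrow> (W k has_vector_derivative W (Suc k) t) (at t within {t0..tend + 1})"
    "\<And>k t. k \<le> 6 \<Longrightarrow> t \<in> {t0..tend + 1} \<Longrightarrow> norm (W k t) \<le> C1"
    using taylor_extension[where W=w and n=6 and d=1, OF assms(4) _ w(2,3)] by auto
  have W0: "W 0 t = u t" if "t \<in> {t0..tend}" for t using W(1)[OF that] w(1) by simp
  obtain d where d: "0 < d" "d \<le> 1" "\<And>t. t \<in> {tend..tend + d} \<Longrightarrow> W 0 t \<in> ball (u tend) r"
  proof -
    have "continuous (at tend within {t0..tend + 1}) (W 0)"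
      using W(2)[of 0 tend] assms(4) by (intro has_vector_derivative_continuous) auto
    then obtain d where d: "d > 0" "\<And>t. t \<in> {t0..tend + 1} \<Longrightarrow> dist t tend < d \<Longrightarrow> dist (W 0 t) (W 0 tend) < r"
      using assms(6) unfolding continuous_within_eps_delta by meson
    show ?thesis
    proof (rule that[of "min (d / 2) 1"])
      fix t assume "t \<in> {tend..tend + min (d / 2) 1}"
      then have "dist (W 0 t) (W 0 tend) < r" using d(1) assms(4) by (intro d(2)) (auto simp: dist_real_def)
      then show "W 0 t \<in> ball (u tend) r" using W0[of tend] assms(4) by (simp add: dist_commute)
    qed (use d in auto)
  qed
  \<comment> \<open>The continued solution remains in the strip a little beyond the final time.\<close>
  define t2 where "t2 = tend + d"
  have t2: "tend < t2" using d by (simp add: t2_def)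
  have sub: "{t0..t2} \<subseteq> {t0..tend + 1}" using d by (auto simp: t2_def)
  have W_der: "(W k has_vector_derivative W (Suc k) t) (at t within {t0..t2})" if "k < 6" "t \<in> {t0..t2}" for k t
    using W(2)[of k t] that sub by (intro has_vector_derivative_within_subset[OF _ sub]) auto
  have W_bd: "norm (W k t) \<le> C1" if "k \<le> 6" "t \<in> {t0..t2}" for k t
    using W(3)[of k t] that sub by auto
  have ball_S: "ball (u t) r \<subseteq> S" if "t \<in> {t0..tend}" for t
    using that by (auto simp: S_def strip_along_def)
  have inS: "W 0 t \<in> S" if "t \<in> {t0..t2}" for t
  proof (cases "t \<le> tend")
    case True
    then show ?thesis using ball_S[of t] that W0[of t] assms(6) by auto
  next
    case False
    then show ?thesis using d(3)[of t] that ball_S[of tend] assms(4) by (auto simp: t2_def)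
  qed
  have gd: "\<And>x. x \<in> S \<Longrightarrow> (g has_derivative blinfun_apply (g1 x)) (at x)"
    "\<And>x. x \<in> S \<Longrightarrow> (g1 has_derivative blinfun_apply (g2 x)) (at x)"
    "\<And>x. x \<in> S \<Longrightarrow> (g2 has_derivative blinfun_apply (g3 x)) (at x)"
    "\<And>x. x \<in> S \<Longrightarrow> (g3 has_derivative blinfun_apply (g4 x)) (at x)"
    "\<And>x. x \<in> S \<Longrightarrow> (g4 has_derivative blinfun_apply (g5 x)) (at x)"
    "\<And>x. x \<in> S \<Longrightarrow> (g5 has_derivative blinfun_apply (g6 x)) (at x)"
    "\<And>x. x \<in> S \<Longrightarrow> bounded_linear_over \<K> (blinfun_apply (g1 x))"
    "\<And>x. x \<in> S \<Longrightarrow> norm (g1 x) \<le> Mg" "\<And>x. x \<in> S \<Longrightarrow> norm (g3 x) \<le> Mg" "\<And>x. x \<in> S \<Longrightarrow> norm (g6 x) \<le> Mg"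
    using g by blast+
  have bW: "boundedly_differentiable n {t0..t2} (W 0)" if "n \<le> 6" for n
    using boundedly_differentiable_mono[OF boundedly_differentiable_of_seq[where W=W and n=6 and I="{t0..t2}" and C=C1, OF W_der W_bd] that] .
  \<comment> \<open>Smoothness of the derivatives of \<open>g\<close> along the solution, from the highest one downwards.\<close>
  have "bounded ((\<lambda>t. g6 (W 0 t)) ` {t0..t2})"
    using gd(10)[OF inS] by (auto simp: bounded_iff intro!: exI[of _ Mg])
  then have b6: "boundedly_differentiable 0 {t0..t2} (\<lambda>t. g6 (W 0 t))" by simp
  have b5: "boundedly_differentiable (Suc 0) {t0..t2} (\<lambda>t. g5 (W 0 t))"
    by (rule boundedly_differentiable_compose[OF bW gd(6)[OF inS] b6]) auto
  have b4: "boundedly_differentiable (Suc (Suc 0)) {t0..t2} (\<lambda>t. g4 (W 0 t))"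
    by (rule boundedly_differentiable_compose[OF bW gd(5)[OF inS] b5]) auto
  have b3: "boundedly_differentiable (Suc (Suc (Suc 0))) {t0..t2} (\<lambda>t. g3 (W 0 t))"
    by (rule boundedly_differentiable_compose[OF bW gd(4)[OF inS] b4]) auto
  have b2: "boundedly_differentiable (Suc (Suc (Suc (Suc 0)))) {t0..t2} (\<lambda>t. g2 (W 0 t))"
    by (rule boundedly_differentiable_compose[OF bW gd(3)[OF inS] b3]) auto
  have b1: "boundedly_differentiable (Suc (Suc (Suc (Suc (Suc 0))))) {t0..t2} (\<lambda>t. g1 (W 0 t))"
    by (rule boundedly_differentiable_compose[OF bW gd(2)[OF inS] b2]) auto
  have b0: "boundedly_differentiable (Suc (Suc (Suc (Suc (Suc (Suc 0)))))) {t0..t2} (\<lambda>t. g (W 0 t))"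
    by (rule boundedly_differentiable_compose[OF bW gd(1)[OF inS] b1]) auto
  have b0': "boundedly_differentiable 6 {t0..t2} (\<lambda>t. g (W 0 t))" using b0 by (rule boundedly_differentiable_mono) simp
  have b1': "boundedly_differentiable 4 {t0..t2} (\<lambda>t. g1 (W 0 t))" using b1 by (rule boundedly_differentiable_mono) simp
  have b2': "boundedly_differentiable 2 {t0..t2} (\<lambda>t. g2 (W 0 t))" using b2 by (rule boundedly_differentiable_mono) simp
  obtain F C2 where F: "F 0 = (\<lambda>t. g (W 0 t))"
    "\<And>k t. k < 6 \<Longrightarrow> t \<in> {t0..t2} \<Longrightarrow> (F k has_vector_derivative F (Suc k) t) (at t within {t0..t2})"
    "\<And>k t. k \<le> 6 \<Longrightarrow> t \<in> {t0..t2} \<Longrightarrow> norm (F k t) \<le> C2"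
    using boundedly_differentiable_seq[OF b0'] by blast
  obtain G C3 where G: "G 0 = (\<lambda>t. g1 (W 0 t))"
    "\<And>k t. k < 4 \<Longrightarrow> t \<in> {t0..t2} \<Longrightarrow> (G k has_vector_derivative G (Suc k) t) (at t within {t0..t2})"
    "\<And>k t. k \<le> 4 \<Longrightarrow> t \<in> {t0..t2} \<Longrightarrow> norm (G k t) \<le> C3"
    using boundedly_differentiable_seq[OF b1'] by blast
  obtain H C4 where H: "H 0 = (\<lambda>t. g2 (W 0 t))"
    "\<And>k t. k < 2 \<Longrightarrow> t \<in> {t0..t2} \<Longrightarrow> (H k has_vector_derivative H (Suc k) t) (at t within {t0..t2})"
    "\<And>k t. k \<le> 2 \<Longrightarrow> t \<in> {t0..t2} \<Longrightarrow> norm (H k t) \<le> C4"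
    using boundedly_differentiable_seq[OF b2'] by blast
  have t02: "t0 < t2" using assms(4) t2 by simp
  have G_over: "bounded_linear_over \<K> (blinfun_apply (G k t))" if "k \<le> 3" "t \<in> {t0..t2}" for k t
    using that
  proof (induction k arbitrary: t)
    case 0
    then show ?case using gd(7)[OF inS] by (simp add: G(1))
  next
    case (Suc k)
    show ?case
      by (rule derivative_linear_over[OF assms(1) t02 Suc.prems(2) _ G(2)]) (use Suc in auto)
  qed
  have H_over: "blin_over \<K> (H k t)" if "k \<le> 1" "t \<in> {t0..t2}" for k t
    using that
  proof (induction k arbitrary: t)
    case 0
    have "blin_over \<K> (g2 (W 0 t))"
      by (rule second_derivative_blin_over[where g=g and ?g1.0=g1 and ?g2.0=g2, OF assms(1) openS inS[OF 0(2)] gd(1) gd(7) gd(2)[OF inS[OF 0(2)]]])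
    then show ?case by (simp add: H(1))
  next
    case (Suc k)
    show ?case
      by (rule derivative_blin_over[OF assms(1) t02 Suc.prems(2) _ H(2)]) (use Suc in auto)
  qed
  have W1: "W 1 t = A (u t) + g (u t)" if t: "t \<in> {t0..tend}" for t
  proof -
    have "(u has_vector_derivative w 1 t) (at t within {t0..tend})"
      using w(2)[of 0 t] t w(1) by simp
    from vector_derivative_unique_within_closed_interval[unfolded box_real, OF assms(4) t this sol(3)[OF t]]
    show ?thesis using W(1)[OF t] by simp
  qed
  define C where "C = max Mg (max C1 (max C2 (max C3 C4)))"
  have C: "Mg \<le> C" "C1 \<le> C" "C2 \<le> C" "C3 \<le> C" "C4 \<le> C" by (auto simp: C_def)
  interpret smooth_setting T \<K> D A g "normalized M" g1 g2 g3 W F G H t0 tend t2 r C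
  proof
    show "nonneg_scalings (normalized M)" by (rule nonneg_scalings_normalized[OF assms(8)])
    show "stiff_conditions_except_quadrature6 \<K> T (normalized M) h" if "0 < h" for h
      using stiff[OF that] by (simp only: stiff_conditions_normalized)
    show "W 0 t \<in> D \<and> W 1 t = A (W 0 t) + g (W 0 t)" if "t \<in> {t0..tend}" for t
      using sol(2)[OF that] W1[OF that] W0[OF that] by simp
    fix t p assume "t \<in> {t0..tend}" "p \<in> ball (W 0 t) r"
    then have p: "p \<in> S" using ball_S[of t] W0[of t] by auto
    show "(g has_derivative blinfun_apply (g1 p)) (at p)" "(g1 has_derivative blinfun_apply (g2 p)) (at p)"
      "(g2 has_derivative blinfun_apply (g3 p)) (at p)" by (fact gd(1)[OF p] gd(2)[OF p] gd(3)[OF p])+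
    show "norm (g1 p) \<le> C" "norm (g3 p) \<le> C" using gd(8)[OF p] gd(9)[OF p] C by linarith+
  next
    show "norm (W k t) \<le> C" if "k \<le> 6" "t \<in> {t0..t2}" for k t using W_bd[OF that] C by linarith
    show "norm (F k t) \<le> C" if "k \<le> 6" "t \<in> {t0..t2}" for k t using F(3)[OF that] C by linarith
    show "norm (G k t) \<le> C" if "k \<le> 4" "t \<in> {t0..t2}" for k t using G(3)[OF that] C by linarith
    show "norm (H k t) \<le> C" if "k \<le> 2" "t \<in> {t0..t2}" for k t using H(3)[OF that] C by linarith
  qed (fact assms(3) assms(1) assms(4) t2 assms(6) W_der F(2) G(2) H(2) G_over H_over | simp add: F(1) G(1) H(1))+
  have "\<exists>K. \<forall>m h x. 0 < h \<longrightarrow> h \<le> 1 \<longrightarrow> real m * h \<le> tend - t0 \<longrightarrow>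
    norm (\<Sum>l<m. T (real l * h) (leading_defect h x)) \<le> K * norm x"
    using assms(9)
  proof
    assume "(\<forall>h>0. stiff_conditions_except_quadrature6 \<K> T M h) \<and> (\<forall>h>0. quadrature_condition T M h 6)"
    then have "leading_defect h x = 0" if "0 < h" for h x
      using that unfolding leading_defect_def by (simp add: quadrature_condition_def)
    then show ?thesis by (intro exI[of _ 0]) simp
  next
    assume "(\<forall>h>0. stiff_conditions_except_quadrature6 \<K> T M h) \<and> weak_quadrature_condition M 6"
    then have weak: "(\<Sum>i\<in>{2..stages M}. comb_val (bcoef (normalized M) i) 0 * (node (normalized M) i ^ 5 / fact 5)) = phi 6 0"
      by (simp add: weak_quadrature_condition_def)
    have scal: "\<And>i w k \<rho>. i \<in> {2..stages M} \<Longrightarrow> (w, k, \<rho>) \<in> set (bcoef (normalized M) i) \<Longrightarrow> 0 \<le> \<rho>"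
      using nn unfolding nonneg_scalings_def by blast
    obtain K where "\<And>m h x. 0 < h \<Longrightarrow> h \<le> 1 \<Longrightarrow> real m * h \<le> tend - t0 \<Longrightarrow>
      norm (\<Sum>l<m. T (real l * h) ((\<Sum>i\<in>{2..stages M}. (node (normalized M) i ^ 5 / fact 5) *\<^sub>R comb_op T h (bcoef (normalized M) i) x) - phi_op T 6 h x)) \<le> K * norm x"
      by (rule weak_quadrature_grid_sum_bound[OF analytic_semigroup_smoothing[OF assms(1,2)] _ scal weak]) auto
    then show ?thesis unfolding leading_defect_def by (intro exI[of _ K]) simp
  qed
  then obtain K where K: "\<And>m h x. 0 < h \<Longrightarrow> h \<le> 1 \<Longrightarrow> real m * h \<le> tend - t0 \<Longrightarrow>
    norm (\<Sum>l<m. T (real l * h) (leading_defect h x)) \<le> K * norm x" by blast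
  obtain C' h0 where h0: "0 < h0" and conv: "\<And>h n. 0 < h \<Longrightarrow> h \<le> h0 \<Longrightarrow> t0 + real n * h \<le> tend \<Longrightarrow>
     norm ((exprk_step (normalized M) T D A g h ^^ n) (W 0 t0) - W 0 (t0 + real n * h)) \<le> C' * h ^ 6"
    using convergence[OF K] by blast
  show ?thesis
  proof (rule exI[of _ C'], rule exI[of _ h0], intro conjI allI impI h0)
    fix h n assume *: "0 < h \<and> h \<le> h0 \<and> t0 + real n * h \<le> tend"
    have "W 0 t0 = u0" using W0[of t0] assms(4) sol(1) by simp
    moreover have "W 0 (t0 + real n * h) = u (t0 + real n * h)" using * by (intro W0) auto
    ultimately show "norm (exprk_solution M T D A g u0 h n - u (t0 + real n * h)) \<le> C' * h ^ 6"
      using conv[of h n] * by (simp add: exprk_solution_def exprk_step_normalized)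
  qed
qed

end
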